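(* Let $F$ be any local field of characteristic zero. For any $\pi\in\Pi_F(n)$, the space $$\mathcal{S}_\pi^\circ(F^\times):=\mathrm{Span}\{\phi_{\xi,\varphi_\pi}\mid\xi\in C_c^\infty(\mathrm{GL}_n(F)),\ \varphi_\pi\in\mathcal{C}(\pi)\}$$ is equal to the space $C_c^\infty(F^\times)$ of all smooth, compactly supported functions on $F^\times$.
   Context: $\Pi_F(n)$ is the set of equivalence classes of irreducible smooth representations of $\mathrm{GL}_n(F)$ if $F$ is non-Archimedean, and of irreducible Casselman-Wallach representations if $F$ is Archimedean. $\mathcal{C}(\pi)$ is the space of smooth matrix coefficients of $\pi$. For $x\in F^\times$, $\mathrm{d}_xg$ is the $\mathrm{SL}_n(F)$-invariant measure on the fiber $\{g\in\mathrm{GL}_n(F):\det g=x\}$ induced from a normalized Haar measure on $\mathrm{SL}_n(F)$, so that Haar measure on $\mathrm{GL}_n(F)$ disintegrates as $\mathrm{d}_xg\,\mathrm{d}^\times x$; and $\phi_{\xi,\varphi_\pi}(x)=\int_{\det g=x}\xi(g)\varphi_\pi(g)\,\mathrm{d}_xg$. *)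

theory Defs
  imports "HOL-Analysis.Analysis" "HOL-Library.Function_Algebras"
begin

section \<open>Local fields of characteristic zero\<close>

text \<open>
  A local field is a field that is locally compact for the topology given by a nontrivial absolute
  value.  The triangle inequality and definiteness of \<open>absval\<close> follow from the metric axioms.  The
  absolute value need not be the normalized one; all notions below depend only on the topology.
\<close>

class local_field = field_char_0 + metric_space +
  fixes absval :: "'a \<Rightarrow> real"
  assumes dist_absval: "dist x y = absval (x - y)"
    and absval_mult: "absval (x * y) = absval x * absval y"
    and absval_nontrivial: "\<exists>x. x \<noteq> 0 \<and> absval x \<noteq> 1"
    and absval_locally_compact: "\<exists>r>0. compact {x. absval x \<le> r}"

instantiation real :: local_field
begin

definition absval_real :: "real \<Rightarrow> real" where "absval_real = norm"

instance
proof
  show "\<exists>x::real. x \<noteq> 0 \<and> absval x \<noteq> 1"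
    by (rule exI[of _ 2]) (simp add: absval_real_def)
  have "{x::real. absval x \<le> 1} = cball 0 1" by (auto simp: absval_real_def)
  then show "\<exists>r>0. compact {x::real. absval x \<le> r}" by (metis compact_cball zero_less_one)
qed (simp_all add: absval_real_def dist_norm abs_mult)

end

instantiation complex :: local_field
begin

definition absval_complex :: "complex \<Rightarrow> real" where "absval_complex = norm"

instance
proof
  show "\<exists>x::complex. x \<noteq> 0 \<and> absval x \<noteq> 1"
    by (rule exI[of _ 2]) (simp add: absval_complex_def)
  have "{x::complex. absval x \<le> 1} = cball 0 1" by (auto simp: absval_complex_def)
  then show "\<exists>r>0. compact {x::complex. absval x \<le> r}" by (metis compact_cball zero_less_one)
qed (simp_all add: absval_complex_def dist_norm norm_mult)

end

definition archimedean :: "'a::local_field itself \<Rightarrow> bool" where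
  "archimedean _ \<longleftrightarrow> (\<exists>x y :: 'a. absval (x + y) > max (absval x) (absval y))"

text \<open>
  For Archimedean \<open>F\<close> (so \<open>F\<close> is isomorphic to the reals or the complex numbers) this is the unique
  continuous field embedding of the reals; it makes \<open>F\<close>-vector spaces real vector spaces.
\<close>

definition real_emb :: "real \<Rightarrow> 'a::local_field" where
  "real_emb = (THE e. continuous_on UNIV e \<and> e 1 = 1 \<and>
     (\<forall>x y. e (x + y) = e x + e y) \<and> (\<forall>x y. e (x * y) = e x * e y))"


section \<open>Smooth functions\<close>

text \<open>
  In this section \<open>s\<close> is the scalar multiplication of \<open>F\<close> on the domain, which is a finite-dimensional
  \<open>F\<close>-vector space, and \<open>sc\<close> and \<open>T\<close> are the complex scalar multiplication and the topology of the
  target.  A map on an open set \<open>U\<close> is \<open>C\<^sup>k\<close> in the real sense if its iterated directional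
  derivatives up to order \<open>k\<close>, in all directions, exist and are continuous on \<open>U\<close>.
\<close>

primrec Ck_on ::
  "('a::local_field \<Rightarrow> 'x \<Rightarrow> 'x) \<Rightarrow> (complex \<Rightarrow> 'v \<Rightarrow> 'v) \<Rightarrow> 'v topology \<Rightarrow> nat
    \<Rightarrow> 'x::{topological_space,ab_group_add} set \<Rightarrow> ('x \<Rightarrow> 'v::ab_group_add) \<Rightarrow> bool" where
  "Ck_on s sc T 0 U f \<longleftrightarrow> continuous_map (top_of_set U) T f"
| "Ck_on s sc T (Suc k) U f \<longleftrightarrow> continuous_map (top_of_set U) T f \<and>
     (\<forall>v. \<exists>f'. (\<forall>x\<in>U. limitin T
        (\<lambda>t::real. sc (complex_of_real (1 / t)) (f (x + s (real_emb t) v) - f x)) (f' x) (at 0)) \<and>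
        Ck_on s sc T k U f')"

definition smooth_on ::
  "('a::local_field \<Rightarrow> 'x \<Rightarrow> 'x) \<Rightarrow> 'x::{topological_space,ab_group_add} set \<Rightarrow> ('x \<Rightarrow> complex) \<Rightarrow> bool"
  where "smooth_on s U f \<longleftrightarrow>
    (if archimedean TYPE('a) then \<forall>k. Ck_on s (*) euclidean k U f
     else \<forall>x\<in>U. \<forall>\<^sub>F y in at x within U. f y = f x)"

text \<open>Functions in \<open>C\<^sub>c\<^sup>\<infinity>(U)\<close> are represented by their extensions by zero outside \<open>U\<close>.\<close>

definition Cc_smooth ::
  "('a::local_field \<Rightarrow> 'x \<Rightarrow> 'x) \<Rightarrow> 'x::{topological_space,ab_group_add} set \<Rightarrow> ('x \<Rightarrow> complex) set"
  where "Cc_smooth s U =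
    {f. smooth_on s U f \<and> (\<exists>C. compact C \<and> C \<subseteq> U \<and> (\<forall>x. x \<notin> C \<longrightarrow> f x = 0))}"

definition cspan :: "('x \<Rightarrow> complex) set \<Rightarrow> ('x \<Rightarrow> complex) set" where
  "cspan A = module.span (\<lambda>c f x. c * f x) A"


section \<open>Matrix groups and Haar measures\<close>

definition GL :: "('a::local_field ^'n^'n) set" where
  "GL = {g. invertible g}"

definition SL :: "('a::local_field ^'n^'n) set" where
  "SL = {g. det g = 1}"

definition mat_scale :: "'a::local_field \<Rightarrow> 'a^'n^'n \<Rightarrow> 'a^'n^'n" where
  "mat_scale c A = (\<chi> i j. c * A $ i $ j)"

text \<open>
  Left Haar measures on a locally compact group \<open>G\<close> of matrices.  Regularity is automatic, since
  matrix spaces over a local field are second countable.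
\<close>

definition haar_measure_on :: "('a::local_field ^'n^'n) set \<Rightarrow> ('a^'n^'n) measure \<Rightarrow> bool" where
  "haar_measure_on G \<mu> \<longleftrightarrow>
     sets \<mu> = sets (restrict_space borel G) \<and>
     (\<forall>g\<in>G. distr \<mu> \<mu> (\<lambda>h. g ** h) = \<mu>) \<and>
     (\<forall>C. compact C \<and> C \<subseteq> G \<longrightarrow> emeasure \<mu> C < \<infinity>) \<and>
     (\<forall>U. open U \<and> U \<inter> G \<noteq> {} \<longrightarrow> emeasure \<mu> (U \<inter> G) > 0)"

text \<open>
  For \<open>x \<noteq> 0\<close>, the measure \<open>d\<^sub>xg\<close> on the fibre \<open>det g = x\<close>, as a measure on the space of all matrices:
  the Haar measure \<open>\<mu>\<close> of \<open>SL\<^sub>n(F)\<close> transported to the coset \<open>s SL\<^sub>n(F)\<close>, where \<open>det s = x\<close>.  By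
  left invariance of \<open>\<mu>\<close> it does not depend on \<open>s\<close>, and integrating it against \<open>d\<^sup>\<times>x\<close> gives a Haar
  measure on \<open>GL\<^sub>n(F)\<close>.
\<close>

definition fibre_measure :: "('a::local_field ^'n^'n) measure \<Rightarrow> 'a \<Rightarrow> ('a^'n^'n) measure" where
  "fibre_measure \<mu> x = distr \<mu> borel (\<lambda>h. (SOME s. det s = x) ** h)"


section \<open>Representations\<close>

text \<open>
  Below, \<open>sc\<close> is the complex scalar multiplication on the space of the representation and \<open>T\<close> is its
  topology; smooth representations for non-Archimedean \<open>F\<close> carry the discrete topology.
\<close>

definition representation ::
  "(complex \<Rightarrow> 'v \<Rightarrow> 'v) \<Rightarrow> ('a::local_field ^'n^'n \<Rightarrow> 'v \<Rightarrow> 'v::ab_group_add) \<Rightarrow> bool" where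
  "representation sc \<pi> \<longleftrightarrow> vector_space sc \<and>
     (\<forall>g\<in>GL. Vector_Spaces.linear sc sc (\<pi> g)) \<and>
     (\<forall>v. \<pi> (mat 1) v = v) \<and>
     (\<forall>g\<in>GL. \<forall>h\<in>GL. \<forall>v. \<pi> (g ** h) v = \<pi> g (\<pi> h v))"

definition irreducible_rep ::
  "(complex \<Rightarrow> 'v \<Rightarrow> 'v) \<Rightarrow> 'v topology \<Rightarrow> ('a::local_field ^'n^'n \<Rightarrow> 'v \<Rightarrow> 'v::ab_group_add) \<Rightarrow> bool"
  where "irreducible_rep sc T \<pi> \<longleftrightarrow> (UNIV :: 'v set) \<noteq> {0} \<and>
     (\<forall>W. module.subspace sc W \<and> closedin T W \<and> (\<forall>g\<in>GL. \<pi> g ` W \<subseteq> W) \<longrightarrow> W = {0} \<or> W = UNIV)"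

definition nonarch_smooth :: "('a::local_field ^'n^'n \<Rightarrow> 'v \<Rightarrow> 'v) \<Rightarrow> bool" where
  "nonarch_smooth \<pi> \<longleftrightarrow> (\<forall>v. open {g \<in> GL. \<pi> g v = v})"

subsection \<open>Casselman-Wallach representations\<close>

definition seminorm :: "(complex \<Rightarrow> 'v \<Rightarrow> 'v) \<Rightarrow> ('v::ab_group_add \<Rightarrow> real) \<Rightarrow> bool" where
  "seminorm sc p \<longleftrightarrow> (\<forall>v. p v \<ge> 0) \<and> (\<forall>c v. p (sc c v) = cmod c * p v) \<and>
     (\<forall>v w. p (v + w) \<le> p v + p w)"

definition frechet_space :: "(complex \<Rightarrow> 'v \<Rightarrow> 'v) \<Rightarrow> 'v::ab_group_add topology \<Rightarrow> bool" where
  "frechet_space sc T \<longleftrightarrow> (\<exists>p :: nat \<Rightarrow> 'v \<Rightarrow> real.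
     (\<forall>j. seminorm sc (p j)) \<and>
     (\<forall>v. (\<forall>j. p j v = 0) \<longrightarrow> v = 0) \<and>
     (\<forall>U. openin T U \<longleftrightarrow> (\<forall>v\<in>U. \<exists>m. \<exists>e>0. \<forall>w. (\<forall>j\<le>m. p j (w - v) < e) \<longrightarrow> w \<in> U)) \<and>
     (\<forall>u. (\<forall>j. \<forall>e>0. \<exists>N. \<forall>k\<ge>N. \<forall>l\<ge>N. p j (u k - u l) < e) \<longrightarrow>
          (\<exists>v. limitin T u v sequentially)))"

definition continuous_rep ::
  "'v topology \<Rightarrow> ('a::local_field ^'n^'n \<Rightarrow> 'v \<Rightarrow> 'v) \<Rightarrow> bool" where
  "continuous_rep T \<pi> \<longleftrightarrow>
     continuous_map (prod_topology (top_of_set GL) T) T (\<lambda>(g, v). \<pi> g v)"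

definition smooth_vectors ::
  "(complex \<Rightarrow> 'v \<Rightarrow> 'v) \<Rightarrow> 'v topology \<Rightarrow> ('a::local_field ^'n^'n \<Rightarrow> 'v \<Rightarrow> 'v::ab_group_add) \<Rightarrow> 'v set"
  where "smooth_vectors sc T \<pi> = {v. \<forall>k. Ck_on mat_scale sc T k GL (\<lambda>g. \<pi> g v)}"

definition GL_norm :: "'a::local_field ^'n^'n \<Rightarrow> real" where
  "GL_norm g = (\<Sum>i\<in>UNIV. \<Sum>j\<in>UNIV. absval (g $ i $ j) + absval (matrix_inv g $ i $ j))"

definition moderate_growth ::
  "(complex \<Rightarrow> 'v \<Rightarrow> 'v) \<Rightarrow> 'v topology \<Rightarrow> ('a::local_field ^'n^'n \<Rightarrow> 'v \<Rightarrow> 'v::ab_group_add) \<Rightarrow> bool"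
  where "moderate_growth sc T \<pi> \<longleftrightarrow>
    (\<forall>p. seminorm sc p \<and> continuous_map T euclideanreal p \<longrightarrow>
      (\<exists>q N. seminorm sc q \<and> continuous_map T euclideanreal q \<and>
        (\<forall>g\<in>GL. \<forall>v. p (\<pi> g v) \<le> GL_norm g ^ N * q v)))"

definition compact_subgroup :: "('a::local_field ^'n^'n) set \<Rightarrow> bool" where
  "compact_subgroup K \<longleftrightarrow> compact K \<and> K \<subseteq> GL \<and> mat 1 \<in> K \<and>
     (\<forall>g\<in>K. \<forall>h\<in>K. g ** h \<in> K) \<and> (\<forall>g\<in>K. matrix_inv g \<in> K)"

definition maximal_compact_subgroup :: "('a::local_field ^'n^'n) set \<Rightarrow> bool" where
  "maximal_compact_subgroup K \<longleftrightarrow> compact_subgroup K \<and>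
     (\<forall>L. compact_subgroup L \<and> K \<subseteq> L \<longrightarrow> L = K)"

definition fin_dim :: "(complex \<Rightarrow> 'v \<Rightarrow> 'v) \<Rightarrow> 'v::ab_group_add set \<Rightarrow> bool" where
  "fin_dim sc W \<longleftrightarrow> (\<exists>B. finite B \<and> W \<subseteq> module.span sc B)"

definition K_subrep ::
  "(complex \<Rightarrow> 'v \<Rightarrow> 'v) \<Rightarrow> ('a::local_field ^'n^'n \<Rightarrow> 'v \<Rightarrow> 'v::ab_group_add) \<Rightarrow>
    ('a^'n^'n) set \<Rightarrow> 'v set \<Rightarrow> bool" where
  "K_subrep sc \<pi> K W \<longleftrightarrow> module.subspace sc W \<and> (\<forall>k\<in>K. \<pi> k ` W \<subseteq> W)"

definition K_irreducible ::
  "(complex \<Rightarrow> 'v \<Rightarrow> 'v) \<Rightarrow> ('a::local_field ^'n^'n \<Rightarrow> 'v \<Rightarrow> 'v::ab_group_add) \<Rightarrow>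
    ('a^'n^'n) set \<Rightarrow> 'v set \<Rightarrow> bool" where
  "K_irreducible sc \<pi> K W \<longleftrightarrow> K_subrep sc \<pi> K W \<and> fin_dim sc W \<and> W \<noteq> {0} \<and>
     (\<forall>W'. K_subrep sc \<pi> K W' \<and> W' \<subseteq> W \<longrightarrow> W' = {0} \<or> W' = W)"

text \<open>A linear map between subspaces always extends to the whole space.\<close>

definition K_isomorphic ::
  "(complex \<Rightarrow> 'v \<Rightarrow> 'v) \<Rightarrow> ('a::local_field ^'n^'n \<Rightarrow> 'v \<Rightarrow> 'v::ab_group_add) \<Rightarrow>
    ('a^'n^'n) set \<Rightarrow> 'v set \<Rightarrow> 'v set \<Rightarrow> bool" where
  "K_isomorphic sc \<pi> K W W' \<longleftrightarrow> (\<exists>A. Vector_Spaces.linear sc sc A \<and> bij_betw A W W' \<and>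
     (\<forall>k\<in>K. \<forall>w\<in>W. A (\<pi> k w) = \<pi> k (A w)))"

text \<open>Every isotypic component of the restriction to \<open>K\<close> is finite-dimensional.\<close>

definition admissible ::
  "(complex \<Rightarrow> 'v \<Rightarrow> 'v) \<Rightarrow> ('a::local_field ^'n^'n \<Rightarrow> 'v \<Rightarrow> 'v::ab_group_add) \<Rightarrow>
    ('a^'n^'n) set \<Rightarrow> bool" where
  "admissible sc \<pi> K \<longleftrightarrow> (\<forall>W. K_irreducible sc \<pi> K W \<longrightarrow>
     fin_dim sc (\<Union>{W'. K_irreducible sc \<pi> K W' \<and> K_isomorphic sc \<pi> K W W'}))"

definition K_finite_vectors ::
  "(complex \<Rightarrow> 'v \<Rightarrow> 'v) \<Rightarrow> ('a::local_field ^'n^'n \<Rightarrow> 'v \<Rightarrow> 'v::ab_group_add) \<Rightarrow>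
    ('a^'n^'n) set \<Rightarrow> 'v set" where
  "K_finite_vectors sc \<pi> K = {v. fin_dim sc ((\<lambda>k. \<pi> k v) ` K)}"

text \<open>
  \<open>(\<gg>, K)\<close>-submodules of the space of \<open>K\<close>-finite vectors.  The action of \<open>X \<in> \<gg> = M\<^sub>n(F)\<close> is the
  derivative at \<open>t = 0\<close> of \<open>\<pi>(1 + t X) v\<close>, which on smooth vectors is that of \<open>\<pi>(exp(t X)) v\<close>.
\<close>

definition gK_submodule ::
  "(complex \<Rightarrow> 'v \<Rightarrow> 'v) \<Rightarrow> 'v topology \<Rightarrow> ('a::local_field ^'n^'n \<Rightarrow> 'v \<Rightarrow> 'v::ab_group_add) \<Rightarrow>
    ('a^'n^'n) set \<Rightarrow> 'v set \<Rightarrow> bool" where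
  "gK_submodule sc T \<pi> K M \<longleftrightarrow> K_subrep sc \<pi> K M \<and> M \<subseteq> K_finite_vectors sc \<pi> K \<and>
     (\<forall>X. \<forall>v\<in>M. \<forall>w. limitin T (\<lambda>t::real. sc (complex_of_real (1 / t))
        (\<pi> (mat 1 + mat_scale (real_emb t) X) v - v)) w (at 0) \<longrightarrow> w \<in> M)"

definition gK_finite_length ::
  "(complex \<Rightarrow> 'v \<Rightarrow> 'v) \<Rightarrow> 'v topology \<Rightarrow> ('a::local_field ^'n^'n \<Rightarrow> 'v \<Rightarrow> 'v::ab_group_add) \<Rightarrow>
    ('a^'n^'n) set \<Rightarrow> bool" where
  "gK_finite_length sc T \<pi> K \<longleftrightarrow> (\<exists>(m::nat) M.
     M 0 = {0} \<and> M m = K_finite_vectors sc \<pi> K \<and>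
     (\<forall>i\<le>m. gK_submodule sc T \<pi> K (M i)) \<and>
     (\<forall>i<m. M i \<subset> M (Suc i) \<and>
        \<not> (\<exists>L. gK_submodule sc T \<pi> K L \<and> M i \<subset> L \<and> L \<subset> M (Suc i))))"

text \<open>
  Smooth Frechet representations of moderate growth whose Harish-Chandra module is admissible of
  finite length.  All maximal compact subgroups are conjugate, so the last condition may equally be
  imposed for a single one.
\<close>

definition casselman_wallach ::
  "(complex \<Rightarrow> 'v \<Rightarrow> 'v) \<Rightarrow> 'v topology \<Rightarrow> ('a::local_field ^'n^'n \<Rightarrow> 'v \<Rightarrow> 'v::ab_group_add) \<Rightarrow> bool"
  where "casselman_wallach sc T \<pi> \<longleftrightarrow>
    frechet_space sc T \<and> continuous_rep T \<pi> \<and> smooth_vectors sc T \<pi> = UNIV \<and>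
    moderate_growth sc T \<pi> \<and>
    (\<forall>K. maximal_compact_subgroup K \<longrightarrow> admissible sc \<pi> K \<and> gK_finite_length sc T \<pi> K)"

text \<open>
  Representatives of the classes in \<open>\<Pi>\<^sub>F(n)\<close>.  For the discrete topology, \<open>irreducible_rep\<close> is
  algebraic irreducibility.
\<close>

definition in_Pi ::
  "(complex \<Rightarrow> 'v \<Rightarrow> 'v) \<Rightarrow> 'v topology \<Rightarrow> ('a::local_field ^'n^'n \<Rightarrow> 'v \<Rightarrow> 'v::ab_group_add) \<Rightarrow> bool"
  where "in_Pi sc T \<pi> \<longleftrightarrow> representation sc \<pi> \<and> irreducible_rep sc T \<pi> \<and>
    (if archimedean TYPE('a) then casselman_wallach sc T \<pi>
     else T = discrete_topology UNIV \<and> nonarch_smooth \<pi>)"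


section \<open>Smooth matrix coefficients\<close>

text \<open>
  A spanning set of the smooth contragredient, realized in the dual space.  For non-Archimedean \<open>F\<close>
  it is the set of linear functionals with open stabilizer.  For Archimedean \<open>F\<close> the contragredient is
  the Garding space of the continuous dual, spanned by the functionals \<open>l \<circ> \<pi>(f)\<close> with
  \<open>\<pi>(f) = \<integral> f(g) \<pi>(g) dg\<close>.  The full continuous dual would be too large: it consists of all
  distribution vectors of the contragredient.  The span of the \<open>l \<circ> \<pi>(f)\<close> does not depend on the
  choice of the Haar measure \<open>\<nu>\<close> on \<open>GL\<^sub>n(F)\<close>.
\<close>

definition contragredient_vectors ::
  "('a::local_field ^'n^'n) measure \<Rightarrow> (complex \<Rightarrow> 'v \<Rightarrow> 'v) \<Rightarrow> 'v topology \<Rightarrow>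
    ('a^'n^'n \<Rightarrow> 'v \<Rightarrow> 'v::ab_group_add) \<Rightarrow> ('v \<Rightarrow> complex) set" where
  "contragredient_vectors \<nu> sc T \<pi> =
    (if archimedean TYPE('a)
     then {(\<lambda>v. LINT g|\<nu>. f g * l (\<pi> g v)) | f l.
             f \<in> Cc_smooth mat_scale GL \<and>
             Vector_Spaces.linear sc (*) l \<and> continuous_map T euclidean l}
     else {l. Vector_Spaces.linear sc (*) l \<and> open {g \<in> GL. \<forall>v. l (\<pi> g v) = l v}})"

text \<open>
  The space \<open>\<C>(\<pi>)\<close>, spanned by the functions \<open>g \<mapsto> \<langle>\<pi>(g) v, l\<rangle>\<close> on \<open>GL\<^sub>n(F)\<close>
  (extended by zero to all matrices).
\<close>

definition matrix_coefficients ::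
  "('a::local_field ^'n^'n) measure \<Rightarrow> (complex \<Rightarrow> 'v \<Rightarrow> 'v) \<Rightarrow> 'v topology \<Rightarrow>
    ('a^'n^'n \<Rightarrow> 'v \<Rightarrow> 'v::ab_group_add) \<Rightarrow> ('a^'n^'n \<Rightarrow> complex) set" where
  "matrix_coefficients \<nu> sc T \<pi> =
    cspan {(\<lambda>g. if g \<in> GL then l (\<pi> g v) else 0) | v l. l \<in> contragredient_vectors \<nu> sc T \<pi>}"

definition phi_fun ::
  "('a::local_field ^'n^'n) measure \<Rightarrow> ('a^'n^'n \<Rightarrow> complex) \<Rightarrow> ('a^'n^'n \<Rightarrow> complex) \<Rightarrow> 'a \<Rightarrow> complex"
  where "phi_fun \<mu> \<xi> \<phi> x =
    (if x = 0 then 0 else (LINT g|fibre_measure \<mu> x. \<xi> g * \<phi> g))"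

definition S_pi_circ ::
  "('a::local_field ^'n^'n) measure \<Rightarrow> ('a^'n^'n) measure \<Rightarrow> (complex \<Rightarrow> 'v \<Rightarrow> 'v) \<Rightarrow> 'v topology \<Rightarrow>
    ('a^'n^'n \<Rightarrow> 'v \<Rightarrow> 'v::ab_group_add) \<Rightarrow> ('a \<Rightarrow> complex) set" where
  "S_pi_circ \<mu> \<nu> sc T \<pi> =
    cspan {phi_fun \<mu> \<xi> \<phi> | \<xi> \<phi>.
      \<xi> \<in> Cc_smooth mat_scale GL \<and> \<phi> \<in> matrix_coefficients \<nu> sc T \<pi>}"

end

theory Submission
  imports Defs
begin

text \<open>
  The inclusion of \<open>S_pi_circ\<close> in \<open>C\<^sub>c\<^sup>\<infinity>(F\<^sup>\<times>)\<close> holds because matrix coefficients are smooth on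
  \<open>GL\<^sub>n(F)\<close>, so that \<open>\<xi> \<phi>\<close> is smooth of compact support, and because integrating such a function over
  the fibres of the determinant gives a smooth function (\<open>fibre_int_smooth\<close>).  With the section
  \<open>x \<mapsto> diag(1, \<dots>, x, \<dots>, 1)\<close> of the determinant, the fibre integral becomes an integral over
  \<open>SL\<^sub>n(F)\<close> depending on the parameter \<open>x\<close>, with integrands of a common compact support as long as \<open>x\<close>
  stays in a compact set.

  For the reverse inclusion, let \<open>f\<close> be smooth of compact support on \<open>F\<^sup>\<times>\<close>.  Since the contragredient
  is nonzero (\<open>contragredient_nonzero_nonarch\<close>, \<open>contragredient_nonzero_arch\<close>), translating one nonzero
  pairing gives, for every \<open>x \<noteq> 0\<close>, a matrix coefficient \<open>\<phi>\<^sub>x\<close> that does not vanish at some matrix of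
  determinant \<open>x\<close>.  Integrating \<open>\<phi>\<^sub>x\<close> against its conjugate times a bump function at that matrix gives
  a function \<open>D\<^sub>x \<ge> 0\<close> on \<open>F\<^sup>\<times>\<close> with \<open>D\<^sub>x(x) > 0\<close> (\<open>positive_fibre_int\<close>).  Finitely many \<open>D\<^sub>x\<close> have
  a sum \<open>E\<close> that is positive on the support of \<open>f\<close>, and \<open>f = \<Sum>\<^sub>x (f / E) D\<^sub>x\<close>
  (\<open>smooth_combination\<close>).  The factor \<open>f / E\<close>, composed with the determinant, is constant on fibres
  and can be absorbed into \<open>\<xi>\<close>.

  For non-Archimedean \<open>F\<close> smoothness means local constancy.  Fibre integrals are then treated by
  sequential compactness, and a smooth functional is obtained by averaging a linear functional over a
  compact open subgroup.

  For Archimedean \<open>F\<close> the calculus needs a real structure on \<open>F\<close>.  From \<open>\<bar>2\<bar> > 1\<close> one gets the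
  embedding of the reals by binary expansions, and an argument of Ostrowski shows that \<open>F\<close> is spanned
  over the reals by \<open>1\<close> and a square root \<open>\<iota>\<close> of \<open>-1\<close>, or by \<open>1\<close> alone (\<open>archimedean_structure\<close>).
  Finite dimension makes it possible to expand derivatives in a fixed basis of directions; this gives
  the chain rule for the determinant (\<open>Ck_det\<close>) and lets the derivative of a fibre integral be
  expressed by fibre integrals again (\<open>Ck_fibre_int\<close>).  Continuous functionals come from the
  Hahn-Banach theorem, and averaging them over \<open>GL\<^sub>n(F)\<close> puts them in the contragredient.
\<close>


section \<open>The topology of a local field\<close>

lemma absval_0 [simp]: "absval (0::'a::local_field) = 0"
  using dist_absval[of "0::'a" 0] by simp

lemma absval_nonneg [simp]: "absval (x::'a::local_field) \<ge> 0"
  using dist_absval[of x 0] zero_le_dist[of x 0] by simp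

lemma absval_eq_0 [simp]: "absval (x::'a::local_field) = 0 \<longleftrightarrow> x = 0"
  using dist_absval[of x 0] dist_eq_0_iff[of x 0] by auto

lemma absval_pos [simp]: "absval (x::'a::local_field) > 0 \<longleftrightarrow> x \<noteq> 0"
  using absval_nonneg[of x] absval_eq_0[of x] by linarith

lemma absval_1 [simp]: "absval (1::'a::local_field) = 1"
  using absval_mult[of "1::'a" 1] by simp

lemma absval_minus [simp]: "absval (- x::'a::local_field) = absval x"
  using dist_absval[of 0 x] dist_absval[of x 0] by (simp add: dist_commute)

lemma absval_minus_commute: "absval (x - y::'a::local_field) = absval (y - x)"
  using absval_minus[of "x - y"] by simp

lemma absval_triangle: "absval (x + y::'a::local_field) \<le> absval x + absval y"
  using dist_triangle[of x "- y" 0] by (simp add: dist_absval)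

lemma absval_triangle_diff: "absval (x - y::'a::local_field) \<le> absval x + absval y"
  using absval_triangle[of x "- y"] by simp

lemma absval_power: "absval (x ^ n) = absval (x::'a::local_field) ^ n"
  by (induct n) (simp_all add: absval_mult)

lemma absval_inverse: "absval (inverse x) = inverse (absval (x::'a::local_field))"
proof (cases "x = 0")
  case False
  then have "absval x * absval (inverse x) = 1"
    by (metis absval_1 absval_mult right_inverse)
  then show ?thesis
    by (metis inverse_unique)
qed simp

lemma absval_divide: "absval (x / y) = absval (x::'a::local_field) / absval y"
  by (simp add: divide_inverse absval_mult absval_inverse)

lemma absval_sum: "finite I \<Longrightarrow> absval (\<Sum>i\<in>I. f i) \<le> (\<Sum>i\<in>I. absval (f i :: 'a::local_field))"
  by (induct I rule: finite_induct) (auto intro: order_trans[OF absval_triangle])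

lemma tendsto_absval_iff:
  "(f \<longlongrightarrow> (l::'a::local_field)) F \<longleftrightarrow> ((\<lambda>x. absval (f x - l)) \<longlongrightarrow> 0) F"
  unfolding tendsto_dist_iff[of f] dist_absval ..

lemma tendsto_absval: "(f \<longlongrightarrow> (l::'a::local_field)) F \<Longrightarrow> ((\<lambda>x. absval (f x)) \<longlongrightarrow> absval l) F"
  using tendsto_dist[of f l F "\<lambda>_. 0" 0] by (simp add: dist_absval)

lemma continuous_on_absval [continuous_intros]:
  "continuous_on S f \<Longrightarrow> continuous_on S (\<lambda>x. absval (f x :: 'a::local_field))"
  unfolding continuous_on_def using tendsto_absval by blast

instance local_field \<subseteq> topological_group_add
proof
  fix a b :: 'a
  let ?F = "nhds a \<times>\<^sub>F nhds b"
  have 1: "((\<lambda>x. absval (fst x - a) + absval (snd x - b)) \<longlongrightarrow> 0 + 0) ?F"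
    by (intro tendsto_add; subst tendsto_absval_iff[symmetric])
       (auto intro: filterlim_fst filterlim_snd)
  have "((\<lambda>x. absval (fst x + snd x - (a + b))) \<longlongrightarrow> 0) ?F"
  proof (rule tendsto_sandwich[OF _ _ tendsto_const])
    show "\<forall>\<^sub>F x in ?F. absval (fst x + snd x - (a + b)) \<le> absval (fst x - a) + absval (snd x - b)"
    proof (rule always_eventually, rule allI)
      fix x
      have "fst x + snd x - (a + b) = (fst x - a) + (snd x - b)" by simp
      then show "absval (fst x + snd x - (a + b)) \<le> absval (fst x - a) + absval (snd x - b)"
        by (metis absval_triangle)
    qed
  qed (use 1 in auto)
  then show "((\<lambda>x. fst x + snd x) \<longlongrightarrow> a + b) ?F"
    using tendsto_absval_iff[of "\<lambda>x. fst x + snd x"] by blast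
  have "((\<lambda>x. absval (x - a)) \<longlongrightarrow> 0) (nhds a)"
    by (subst tendsto_absval_iff[symmetric]) (rule filterlim_ident)
  then have "((\<lambda>x. absval (- x - (- a))) \<longlongrightarrow> 0) (nhds a)"
    by (metis (no_types, lifting) Lim_cong_within absval_minus minus_diff_minus ext)
  then show "(uminus \<longlongrightarrow> - a) (nhds a)"
    using tendsto_absval_iff[of uminus] by blast
qed

instance local_field \<subseteq> topological_ab_group_add ..

instance local_field \<subseteq> topological_semigroup_mult
proof
  fix a b :: 'a
  let ?F = "nhds a \<times>\<^sub>F nhds b"
  have x: "(fst \<longlongrightarrow> a) ?F" and y: "(snd \<longlongrightarrow> b) ?F"
    by (auto intro: filterlim_fst filterlim_snd)
  have "((\<lambda>x. absval (fst x - a) * absval (snd x) + absval a * absval (snd x - b))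
           \<longlongrightarrow> 0 * absval b + absval a * 0) ?F"
    using x y by (intro tendsto_intros) (auto simp: tendsto_absval_iff[symmetric] intro: tendsto_absval)
  then have 1: "((\<lambda>x. absval (fst x - a) * absval (snd x) + absval a * absval (snd x - b)) \<longlongrightarrow> 0) ?F"
    by simp
  have "((\<lambda>x. absval (fst x * snd x - a * b)) \<longlongrightarrow> 0) ?F"
  proof (rule tendsto_sandwich[OF _ _ tendsto_const 1])
    show "\<forall>\<^sub>F x in ?F. absval (fst x * snd x - a * b)
            \<le> absval (fst x - a) * absval (snd x) + absval a * absval (snd x - b)"
    proof (rule always_eventually, rule allI)
      fix x
      have "fst x * snd x - a * b = (fst x - a) * snd x + a * (snd x - b)" by (simp add: algebra_simps)
      then show "absval (fst x * snd x - a * b)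
            \<le> absval (fst x - a) * absval (snd x) + absval a * absval (snd x - b)"
        by (metis absval_triangle absval_mult)
    qed
  qed auto
  then show "((\<lambda>x. fst x * snd x) \<longlongrightarrow> a * b) ?F"
    using tendsto_absval_iff[of "\<lambda>x. fst x * snd x"] by blast
qed

instance local_field \<subseteq> topological_monoid_mult ..

instance local_field \<subseteq> topological_comm_monoid_mult ..

lemma tendsto_inverse_field:
  assumes f: "(f \<longlongrightarrow> (l::'a::local_field)) F" and l: "l \<noteq> 0"
  shows "((\<lambda>x. inverse (f x)) \<longlongrightarrow> inverse l) F"
proof -
  have nz: "\<forall>\<^sub>F x in F. f x \<noteq> 0"
    using f l by (rule tendsto_imp_eventually_ne)
  have "((\<lambda>x. absval (f x - l) / (absval (f x) * absval l)) \<longlongrightarrow> 0 / (absval l * absval l)) F"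
    using f l by (intro tendsto_intros) (auto simp: tendsto_absval_iff[symmetric] intro: tendsto_absval)
  then have 1: "((\<lambda>x. absval (f x - l) / (absval (f x) * absval l)) \<longlongrightarrow> 0) F" by simp
  have "((\<lambda>x. absval (inverse (f x) - inverse l)) \<longlongrightarrow> 0) F"
  proof (rule Lim_transform_eventually[OF 1])
    show "\<forall>\<^sub>F x in F. absval (f x - l) / (absval (f x) * absval l) = absval (inverse (f x) - inverse l)"
      using nz
    proof eventually_elim
      case (elim x)
      have "inverse (f x) - inverse l = (l - f x) / (f x * l)"
        using elim l by (simp add: field_simps)
      then show ?case by (simp add: absval_divide absval_mult absval_minus_commute)
    qed
  qed
  then show ?thesis using tendsto_absval_iff by blast
qed

lemma continuous_on_inverse_field:
  assumes "continuous_on S f" "\<And>x. x \<in> S \<Longrightarrow> f x \<noteq> (0::'a::local_field)"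
  shows "continuous_on S (\<lambda>x. inverse (f x))"
  using assms unfolding continuous_on_def by (auto intro: tendsto_inverse_field)

lemma continuous_on_divide_field:
  assumes "continuous_on S f" "continuous_on S g" "\<And>x. x \<in> S \<Longrightarrow> g x \<noteq> (0::'a::local_field)"
  shows "continuous_on S (\<lambda>x. f x / g x)"
  unfolding divide_inverse using assms by (intro continuous_intros continuous_on_inverse_field)

lemma absval_unbounded: "\<exists>c::'a::local_field. absval c > R"
proof -
  obtain x :: 'a where x: "x \<noteq> 0" "absval x \<noteq> 1" using absval_nontrivial by blast
  obtain y :: 'a where y: "absval y > 1"
  proof (cases "absval x > 1")
    case False
    then have "absval (inverse x) > 1"
      using x absval_pos[of x] by (simp add: absval_inverse one_less_inverse_iff)
    then show ?thesis using that by blast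
  qed (use that in blast)
  obtain n where "R < absval y ^ n" using real_arch_pow[OF y] by blast
  then show ?thesis using absval_power[of y n] by metis
qed

text \<open>
  Multiplication by an element of large absolute value maps the given compact ball onto a set that
  contains any prescribed ball.
\<close>

lemma compact_absval_ball: "compact {x::'a::local_field. absval x \<le> R}"
proof -
  obtain r where r: "r > 0" "compact {x::'a. absval x \<le> r}" using absval_locally_compact by blast
  obtain c :: 'a where c: "absval c > max 0 (R / r)" using absval_unbounded by blast
  then have c0: "c \<noteq> 0" by auto
  have "compact ((\<lambda>x. c * x) ` {x. absval x \<le> r})"
    by (intro compact_continuous_image continuous_intros r)
  moreover have "closed {x::'a. absval x \<le> R}"
    by (intro closed_Collect_le continuous_intros)
  moreover have "{x::'a. absval x \<le> R} \<subseteq> (\<lambda>x. c * x) ` {x. absval x \<le> r}"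
  proof
    fix x :: 'a assume x: "x \<in> {x. absval x \<le> R}"
    have "absval (x / c) \<le> r"
      using x c r(1) c0 order_trans[OF absval_nonneg[of x], of R]
      by (auto simp: absval_divide field_simps max_def split: if_splits)
    then show "x \<in> (\<lambda>x. c * x) ` {x. absval x \<le> r}"
      using c0 by (intro image_eqI[of _ _ "x / c"]) auto
  qed
  ultimately show ?thesis by (metis compact_Int_closed inf.absorb2)
qed

instance local_field \<subseteq> heine_borel
proof
  fix f :: "nat \<Rightarrow> 'a"
  assume "bounded (range f)"
  then obtain R where "\<And>n. dist 0 (f n) \<le> R" unfolding bounded_any_center[where a=0] by auto
  then have "\<forall>n. f n \<in> {x. absval x \<le> R}" by (simp add: dist_absval)
  then show "\<exists>l r. strict_mono r \<and> (f \<circ> r) \<longlonglongrightarrow> l"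
    using compact_absval_ball[of R, where 'a='a] unfolding compact_eq_seq_compact_metric seq_compact_def
    by blast
qed


section \<open>The real numbers inside an Archimedean local field\<close>

lemma le_1_if_powers_linear:
  fixes a c :: real
  assumes "\<And>n::nat. a ^ n \<le> c * real n + d"
  shows "a \<le> 1"
proof (rule ccontr)
  assume "\<not> a \<le> 1"
  then have a: "a > 1" by simp
  then have "(\<lambda>n. c * (real n / a ^ n) + d * inverse (a ^ n)) \<longlonglongrightarrow> c * 0 + d * 0"
    by (intro tendsto_intros lim_n_over_pown LIMSEQ_inverse_realpow_zero) auto
  moreover have "1 \<le> c * (real n / a ^ n) + d * inverse (a ^ n)" for n
    using assms[of n] a by (simp add: field_simps)
  ultimately have "1 \<le> c * 0 + d * 0"
    by (intro LIMSEQ_le_const) auto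
  then show False by simp
qed

lemma absval_nat_binary:
  assumes "n < 2 ^ k"
  shows "absval (of_nat n :: 'a::local_field) \<le> (\<Sum>j<k. absval (2::'a) ^ j)"
  using assms
proof (induct k arbitrary: n)
  case (Suc k)
  have "n div 2 < 2 ^ k" using Suc.prems by auto
  note IH = Suc.hyps[OF this]
  have "of_nat n = (2 * of_nat (n div 2) + of_nat (n mod 2) :: 'a)"
    by (metis mult_div_mod_eq of_nat_add of_nat_mult of_nat_numeral)
  then have "absval (of_nat n :: 'a)
      \<le> absval (2::'a) * absval (of_nat (n div 2) :: 'a) + absval (of_nat (n mod 2) :: 'a)"
    by (metis absval_triangle absval_mult)
  moreover have "absval (of_nat (n mod 2) :: 'a) \<le> 1"
    by (cases "even n") (auto simp: even_iff_mod_2_eq_zero odd_iff_mod_2_eq_one)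
  ultimately have "absval (of_nat n :: 'a) \<le> absval (2::'a) * (\<Sum>j<k. absval (2::'a) ^ j) + 1"
    using mult_left_mono[OF IH absval_nonneg[of "2::'a"]] by linarith
  also have "\<dots> = (\<Sum>j<Suc k. absval (2::'a) ^ j)"
    by (simp add: sum.lessThan_Suc_shift sum_distrib_left del: sum.lessThan_Suc)
  finally show ?case .
qed simp

text \<open>
  If \<open>\<bar>2\<bar> \<le> 1\<close>, binary expansion bounds \<open>\<bar>m\<^sup>N\<bar>\<close> linearly in \<open>N\<close>, so all integers have absolute
  value at most \<open>1\<close>; the binomial theorem for \<open>(x + y)\<^sup>N\<close> then gives the ultrametric inequality.
\<close>

lemma archimedean_absval_2:
  assumes "archimedean TYPE('a::local_field)"
  shows "absval (2::'a) > 1"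
proof (rule ccontr)
  assume "\<not> absval (2::'a) > 1"
  then have "absval (2::'a) ^ j \<le> 1" for j by (simp add: power_le_one)
  then have bin: "absval (of_nat n :: 'a) \<le> real k" if "n < 2 ^ k" for n k
    using absval_nat_binary[OF that, where 'a='a] sum_mono[of "{..<k}" "\<lambda>j. absval (2::'a) ^ j" "\<lambda>_. 1"]
    by simp
  have nat: "absval (of_nat m :: 'a) \<le> 1" for m
  proof (rule le_1_if_powers_linear[where c="real m" and d=1])
    fix N
    have "m ^ N < 2 ^ (m * N) \<or> N = 0"
      by (cases "N = 0") (auto simp: power_mult intro: power_strict_mono less_exp)
    then show "absval (of_nat m :: 'a) ^ N \<le> real m * real N + 1"
      using bin[of "m ^ N" "m * N"] by (auto simp: absval_power)
  qed
  obtain x y :: 'a where xy: "absval (x + y) > max (absval x) (absval y)"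
    using assms unfolding archimedean_def by blast
  define M where "M = max (absval x) (absval y)"
  have M0: "M \<ge> 0" unfolding M_def by (simp add: le_max_iff_disj)
  have "absval (x + y) ^ N \<le> (real N + 1) * M ^ N" for N
  proof -
    have "absval (x + y) ^ N = absval (\<Sum>k\<le>N. of_nat (N choose k) * x ^ k * y ^ (N - k))"
      by (simp add: absval_power[symmetric] binomial_ring)
    also have "\<dots> \<le> (\<Sum>k\<le>N. absval (of_nat (N choose k) * x ^ k * y ^ (N - k)))"
      by (rule absval_sum) simp
    also have "\<dots> \<le> (\<Sum>k\<le>N. M ^ N)"
    proof (rule sum_mono)
      fix k assume k: "k \<in> {..N}"
      have "absval (of_nat (N choose k) * x ^ k * y ^ (N - k)) \<le> 1 * M ^ k * M ^ (N - k)"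
        unfolding absval_mult absval_power
        by (intro mult_mono power_mono nat mult_nonneg_nonneg zero_le_power M0 absval_nonneg)
           (auto simp: M_def)
      also have "\<dots> = M ^ N" using k by (simp add: power_add[symmetric])
      finally show "absval (of_nat (N choose k) * x ^ k * y ^ (N - k)) \<le> M ^ N" .
    qed
    finally show ?thesis by (simp add: algebra_simps)
  qed
  moreover have "M > 0"
  proof (rule ccontr)
    assume "\<not> M > 0"
    then have "absval x \<le> 0" "absval y \<le> 0" unfolding M_def by auto
    then have "x = 0" "y = 0" using absval_nonneg[of x] absval_nonneg[of y] absval_eq_0 by force+
    then show False using xy by simp
  qed
  ultimately have "(absval (x + y) / M) ^ N \<le> 1 * real N + 1" for N
    by (simp add: power_divide divide_le_eq)
  then have "absval (x + y) / M \<le> 1" by (rule le_1_if_powers_linear)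
  then show False using xy \<open>M > 0\<close> by (simp add: M_def[symmetric] field_simps)
qed

lemma absval_int_bound:
  assumes two: "absval (2::'a::local_field) > 1" and k: "\<bar>k\<bar> \<le> 2 ^ j"
  shows "absval (of_int k :: 'a) \<le> absval (2::'a) / (absval (2::'a) - 1) * absval (2::'a) ^ j"
proof -
  have "nat \<bar>k\<bar> < 2 ^ Suc j"
    using le_less_trans[OF k, of "2 ^ Suc j"] by (simp add: nat_less_iff)
  then have "absval (of_nat (nat \<bar>k\<bar>) :: 'a) \<le> (\<Sum>i<Suc j. absval (2::'a) ^ i)"
    by (rule absval_nat_binary)
  also have "\<dots> = (absval (2::'a) ^ Suc j - 1) / (absval (2::'a) - 1)"
    using two geometric_sum[of "absval (2::'a)" "Suc j"] by auto
  also have "\<dots> \<le> absval (2::'a) ^ Suc j / (absval (2::'a) - 1)"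
    using two by (intro divide_right_mono) auto
  also have "absval (of_nat (nat \<bar>k\<bar>) :: 'a) = absval (of_int k :: 'a)"
    by (cases "k \<ge> 0") (auto simp: of_nat_nat)
  finally show ?thesis by simp
qed

text \<open>
  Binary expansions: when \<open>\<bar>2\<bar> > 1\<close>, the truncations of a real number form a Cauchy sequence in \<open>F\<close>,
  and sending the number to their limit is the embedding of the reals.
\<close>

definition dyadic :: "nat \<Rightarrow> real \<Rightarrow> 'a::local_field" where
  "dyadic n x = of_int \<lfloor>2 ^ n * x\<rfloor> / 2 ^ n"

lemma dyadic_null:
  assumes two: "absval (2::'a::local_field) > 1" and k: "\<And>n. \<bar>k n\<bar> \<le> 2 ^ j"
  shows "(\<lambda>n. of_int (k n) / 2 ^ n :: 'a) \<longlonglongrightarrow> 0"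
proof -
  let ?A = "absval (2::'a)"
  let ?c = "?A / (?A - 1) * ?A ^ j"
  have "(\<lambda>n. ?c * inverse (?A ^ n)) \<longlonglongrightarrow> ?c * 0"
    using two by (intro tendsto_intros LIMSEQ_inverse_realpow_zero) auto
  then have lim: "(\<lambda>n. ?c * inverse (?A ^ n)) \<longlonglongrightarrow> 0" by simp
  have "absval (of_int (k n) / 2 ^ n :: 'a) \<le> ?c * inverse (?A ^ n)" for n
    unfolding absval_divide absval_power divide_inverse[of "absval (of_int (k n))"]
    using absval_int_bound[OF two k[of n]] two by (intro mult_right_mono) auto
  then have "(\<lambda>n. absval (of_int (k n) / 2 ^ n :: 'a)) \<longlonglongrightarrow> 0"
    by (intro tendsto_sandwich[OF _ _ tendsto_const lim]) auto
  then show ?thesis using tendsto_absval_iff[of "\<lambda>n. of_int (k n) / 2 ^ n :: 'a" 0] by simp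
qed

text \<open>
  Refining \<open>n\<close> binary digits to \<open>m\<close> digits adds an integer of size at most \<open>2\<^sup>m\<^sup>-\<^sup>n\<close> divided by \<open>2\<^sup>m\<close>,
  which has absolute value of order \<open>\<bar>2\<bar>\<^sup>-\<^sup>n\<close> in \<open>F\<close>.
\<close>

lemma dyadic_convergent:
  assumes two: "absval (2::'a::local_field) > 1"
  shows "convergent (\<lambda>n. dyadic n x :: 'a)"
proof -
  let ?A = "absval (2::'a)"
  let ?c = "?A / (?A - 1)"
  have step: "absval (dyadic m x - dyadic n x :: 'a) \<le> ?c * inverse (?A ^ n)" if nm: "n \<le> m" for m n
  proof -
    define k where "k = \<lfloor>2 ^ m * x\<rfloor> - 2 ^ (m - n) * \<lfloor>2 ^ n * x\<rfloor>"
    have p: "(2::real) ^ m = 2 ^ (m - n) * 2 ^ n" and p': "(2::'a) ^ m = 2 ^ (m - n) * 2 ^ n"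
      using nm by (simp_all add: power_add[symmetric])
    have "2 ^ (m - n) * (2 ^ n * x - 1) \<le> 2 ^ (m - n) * real_of_int \<lfloor>2 ^ n * x\<rfloor>"
      "2 ^ (m - n) * real_of_int \<lfloor>2 ^ n * x\<rfloor> \<le> 2 ^ (m - n) * (2 ^ n * x)"
      by ((intro mult_left_mono; (linarith | simp)), (intro mult_left_mono; (linarith | simp)))
    moreover have "2 ^ (m - n) * (2 ^ n * x - 1) = 2 ^ m * x - 2 ^ (m - n)"
      "2 ^ (m - n) * (2 ^ n * x) = 2 ^ m * x"
      by (simp_all add: p algebra_simps)
    moreover obtain a b c d where abcd: "a = real_of_int \<lfloor>2 ^ m * x\<rfloor>" "b = 2 ^ m * x"
      "c = 2 ^ (m - n) * real_of_int \<lfloor>2 ^ n * x\<rfloor>" "d = (2::real) ^ (m - n)" by blast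
    moreover have "a \<le> b" "b < a + 1" unfolding abcd by linarith+
    moreover have "real_of_int k = a - c" by (simp add: k_def abcd)
    moreover have "d \<ge> 1" using one_le_power[of "2::real" "m - n"] by (simp add: abcd)
    ultimately have "b - d \<le> c" "c \<le> b" "a \<le> b" "b < a + 1" "real_of_int k = a - c" "d \<ge> 1"
      by metis+
    then have "\<bar>real_of_int k\<bar> < d + 1" by linarith
    then have "\<bar>real_of_int k\<bar> < 2 ^ (m - n) + 1" by (simp only: abcd)
    then have "real_of_int \<bar>k\<bar> < real_of_int (2 ^ (m - n) + 1)" by simp
    then have k: "\<bar>k\<bar> \<le> 2 ^ (m - n)" by (simp only: of_int_less_iff)
    have "dyadic m x - dyadic n x = (of_int k / 2 ^ m :: 'a)"
      unfolding dyadic_def k_def by (simp add: p' field_simps)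
    then have "absval (dyadic m x - dyadic n x :: 'a) \<le> ?c * ?A ^ (m - n) / ?A ^ m"
      unfolding \<open>dyadic m x - dyadic n x = _\<close> absval_divide absval_power
      using absval_int_bound[OF two k] by (intro divide_right_mono) auto
    also have "\<dots> = ?c * inverse (?A ^ n)"
      using two nm by (simp add: power_diff field_simps)
    finally show ?thesis .
  qed
  have "(\<lambda>n. ?c * inverse (?A ^ n)) \<longlonglongrightarrow> ?c * 0"
    using two by (intro tendsto_intros LIMSEQ_inverse_realpow_zero) auto
  then have null: "(\<lambda>n. ?c * inverse (?A ^ n)) \<longlonglongrightarrow> 0" by simp
  have "Cauchy (\<lambda>n. dyadic n x :: 'a)"
  proof (rule metric_CauchyI)
    fix e :: real assume "e > 0"
    then obtain N where "norm (?c * inverse (?A ^ N) - 0) < e / 2"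
      using LIMSEQ_D[OF null, of "e / 2"] by auto
    then have N: "?c * inverse (?A ^ N) < e / 2"
      unfolding real_norm_def diff_0_right by (rule le_less_trans[OF abs_ge_self])
    have "dist (dyadic m x :: 'a) (dyadic n x) < e" if "m \<ge> N" "n \<ge> N" for m n
      using dist_triangle[of "dyadic m x :: 'a" "dyadic n x" "dyadic N x"] step[OF that(1)] step[OF that(2)] N
        dist_commute[of "dyadic N x :: 'a" "dyadic n x"]
      unfolding dist_absval by linarith
    then show "\<exists>M. \<forall>m\<ge>M. \<forall>n\<ge>M. dist (dyadic m x :: 'a) (dyadic n x) < e" by blast
  qed
  then show ?thesis by (simp add: Cauchy_convergent_iff)
qed

definition dyadic_lim :: "real \<Rightarrow> 'a::local_field" where
  "dyadic_lim x = lim (\<lambda>n. dyadic n x)"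

lemma dyadic_lim:
  assumes "absval (2::'a::local_field) > 1"
  shows "(\<lambda>n. dyadic n x) \<longlonglongrightarrow> (dyadic_lim x :: 'a)"
  using dyadic_convergent[OF assms] unfolding dyadic_lim_def by (rule convergent_LIMSEQ_iff[THEN iffD1])

text \<open>
  The floor function is additive up to a bounded integer, which disappears after division by \<open>2\<^sup>n\<close>.
\<close>

lemma dyadic_lim_add:
  assumes two: "absval (2::'a::local_field) > 1"
  shows "dyadic_lim (x + y) = (dyadic_lim x + dyadic_lim y :: 'a)"
proof -
  let ?k = "\<lambda>n. \<lfloor>2 ^ n * x\<rfloor> + \<lfloor>2 ^ n * y\<rfloor> - \<lfloor>2 ^ n * (x + y)\<rfloor>"
  have k: "\<bar>?k n\<bar> \<le> 2 ^ 1" for n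
    using floor_correct[of "2 ^ n * x"] floor_correct[of "2 ^ n * y"] floor_correct[of "2 ^ n * (x + y)"]
    by (simp add: algebra_simps) linarith
  have "(\<lambda>n. of_int (?k n) / 2 ^ n :: 'a) \<longlonglongrightarrow> 0"
    by (rule dyadic_null[OF two k])
  moreover have "of_int (?k n) / 2 ^ n = (dyadic n x + dyadic n y - dyadic n (x + y) :: 'a)" for n
    unfolding dyadic_def by (simp add: diff_divide_distrib add_divide_distrib)
  ultimately have "(\<lambda>n. dyadic n x + dyadic n y - dyadic n (x + y) :: 'a) \<longlonglongrightarrow> 0" by simp
  moreover have "(\<lambda>n. dyadic n x + dyadic n y - dyadic n (x + y) :: 'a)
      \<longlonglongrightarrow> dyadic_lim x + dyadic_lim y - dyadic_lim (x + y)"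
    by (intro tendsto_intros dyadic_lim two)
  ultimately have "dyadic_lim x + dyadic_lim y - dyadic_lim (x + y) = (0::'a)"
    by (rule LIMSEQ_unique[symmetric])
  then show ?thesis by simp
qed

lemma dyadic_lim_1:
  assumes two: "absval (2::'a::local_field) > 1"
  shows "dyadic_lim 1 = (1 :: 'a)"
proof -
  have "dyadic n 1 = (1::'a)" for n
  proof -
    have "\<lfloor>(2::real) ^ n * 1\<rfloor> = 2 ^ n"
      by (metis floor_of_int mult.right_neutral of_int_numeral of_int_power)
    then show ?thesis unfolding dyadic_def by simp
  qed
  then show ?thesis using dyadic_lim[OF two, of 1] by (simp add: LIMSEQ_const_iff)
qed

lemma dyadic_lim_bound:
  assumes two: "absval (2::'a::local_field) > 1" and x: "\<bar>x\<bar> \<le> 1 / 2 ^ k"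
  shows "absval (dyadic_lim x :: 'a) \<le> absval (2::'a) ^ 2 / (absval (2::'a) - 1) / absval (2::'a) ^ k"
proof (rule LIMSEQ_le_const2[OF tendsto_absval[OF dyadic_lim[OF two]]])
  let ?A = "absval (2::'a)"
  have "absval (dyadic n x :: 'a) \<le> ?A\<^sup>2 / (?A - 1) / ?A ^ k" if n: "n \<ge> k" for n
  proof -
    have "\<bar>2 ^ n * x\<bar> \<le> 2 ^ n * (1 / 2 ^ k)" unfolding abs_mult using x by (intro mult_mono) auto
    also have "\<dots> = 2 ^ (n - k)" using n by (simp add: power_diff)
    finally have "\<bar>real_of_int \<lfloor>2 ^ n * x\<rfloor>\<bar> \<le> 2 ^ (n - k) + 1" by linarith
    also have "\<dots> \<le> 2 ^ Suc (n - k)" by simp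
    finally have "real_of_int \<bar>\<lfloor>2 ^ n * x\<rfloor>\<bar> \<le> real_of_int (2 ^ Suc (n - k))" by simp
    then have "\<bar>\<lfloor>2 ^ n * x\<rfloor>\<bar> \<le> 2 ^ Suc (n - k)" by (simp only: of_int_le_iff)
    from absval_int_bound[OF two this]
    have "absval (dyadic n x :: 'a) \<le> ?A / (?A - 1) * ?A ^ Suc (n - k) / ?A ^ n"
      unfolding dyadic_def absval_divide absval_power using two by (intro divide_right_mono) auto
    also have "\<dots> = ?A\<^sup>2 / (?A - 1) / ?A ^ k"
      using two n by (simp add: power_diff power2_eq_square)
    finally show ?thesis .
  qed
  then show "\<exists>N. \<forall>n\<ge>N. absval (dyadic n x :: 'a) \<le> ?A\<^sup>2 / (?A - 1) / ?A ^ k" by blast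
qed

lemma dyadic_lim_continuous:
  assumes two: "absval (2::'a::local_field) > 1"
  shows "continuous_on UNIV (dyadic_lim :: real \<Rightarrow> 'a)"
proof (rule continuous_onI)
  fix x e :: real assume "e > 0"
  let ?A = "absval (2::'a)"
  let ?c = "?A\<^sup>2 / (?A - 1)"
  obtain k where k: "?c / e < ?A ^ k" using real_arch_pow[OF two] by blast
  have "dist (dyadic_lim y) (dyadic_lim x :: 'a) \<le> e" if "dist y x < 1 / 2 ^ k" for y
  proof -
    have "dyadic_lim y = (dyadic_lim (y - x) + dyadic_lim x :: 'a)"
      using dyadic_lim_add[OF two, of "y - x" x] by simp
    then have "dist (dyadic_lim y) (dyadic_lim x :: 'a) = absval (dyadic_lim (y - x) :: 'a)"
      by (simp add: dist_absval)
    also have "\<dots> \<le> ?c / ?A ^ k"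
      using that by (intro dyadic_lim_bound two) (simp add: dist_real_def)
    also have "\<dots> \<le> e" using k \<open>e > 0\<close> two by (simp add: field_simps)
    finally show ?thesis .
  qed
  then show "\<exists>d>0. \<forall>x'\<in>UNIV. dist x' x < d \<longrightarrow> dist (dyadic_lim x') (dyadic_lim x :: 'a) \<le> e"
    by (intro exI[of _ "1 / 2 ^ k"]) auto
qed

text \<open>
  Multiplicativity of \<open>dyadic_lim\<close> and uniqueness of the embedding both follow from this rigidity:
  additive maps that agree at \<open>1\<close> agree on the dyadic rationals, which are dense.
\<close>

lemma additive_continuous_eq:
  fixes f g :: "real \<Rightarrow> 'a::local_field"
  assumes "continuous_on UNIV f" "continuous_on UNIV g" "\<And>x y. f (x + y) = f x + f y"
    "\<And>x y. g (x + y) = g x + g y" "f 1 = g 1"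
  shows "f = g"
proof
  fix x
  define h where "h = (\<lambda>x. f x - g x)"
  have cont: "continuous_on UNIV h" unfolding h_def by (intro continuous_intros assms)
  have add: "h (x + y) = h x + h y" for x y by (simp add: h_def assms(3,4))
  have h1: "h 1 = 0" by (simp add: h_def assms(5))
  have h0: "h 0 = 0" using add[of 0 0] by simp
  have hm: "h (- x) = - h x" for x using add[of x "- x"] h0 by (simp add: add_eq_0_iff)
  have hn: "h (of_nat n) = 0" for n by (induct n) (simp_all add: h0 h1 add)
  have hi: "h (of_int k) = 0" for k by (cases k rule: int_cases2) (simp_all add: hn hm)
  have hp: "h (2 ^ n * x) = 2 ^ n * h x" for n x
  proof (induct n)
    case (Suc n)
    then show ?case using add[of "2 ^ n * x" "2 ^ n * x"] by (simp add: algebra_simps flip: mult_2)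
  qed simp
  have dyadic_0: "h (of_int k / 2 ^ n) = 0" for k n
    using hp[of n "of_int k / 2 ^ n"] hi[of k] by simp
  have "(\<lambda>n. real_of_int \<lfloor>2 ^ n * x\<rfloor> / 2 ^ n) \<longlonglongrightarrow> x"
  proof (rule tendsto_sandwich[OF _ _ _ tendsto_const])
    have "(\<lambda>n. x - inverse (2 ^ n)) \<longlonglongrightarrow> x - 0"
      by (intro tendsto_intros LIMSEQ_inverse_realpow_zero) auto
    then show "(\<lambda>n. x - inverse (2 ^ n)) \<longlonglongrightarrow> x" by simp
    have "x - inverse (2 ^ n) \<le> of_int \<lfloor>2 ^ n * x\<rfloor> / 2 ^ n" for n
    proof -
      have "x - inverse (2 ^ n) = (2 ^ n * x - 1) / 2 ^ n" by (simp add: field_simps)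
      also have "\<dots> \<le> of_int \<lfloor>2 ^ n * x\<rfloor> / 2 ^ n" by (intro divide_right_mono) (linarith, simp)
      finally show ?thesis .
    qed
    then show "\<forall>\<^sub>F n in sequentially. x - inverse (2 ^ n) \<le> of_int \<lfloor>2 ^ n * x\<rfloor> / 2 ^ n" by simp
    have "of_int \<lfloor>2 ^ n * x\<rfloor> / 2 ^ n \<le> x" for n
      using floor_correct[of "2 ^ n * x"] by (simp add: field_simps)
    then show "\<forall>\<^sub>F n in sequentially. of_int \<lfloor>2 ^ n * x\<rfloor> / 2 ^ n \<le> x" by simp
  qed
  then have "(\<lambda>n. h (of_int \<lfloor>2 ^ n * x\<rfloor> / 2 ^ n)) \<longlonglongrightarrow> h x"
    using cont by (auto simp: continuous_on_eq_continuous_at intro: isCont_tendsto_compose)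
  then have "h x = 0" unfolding dyadic_0 by (simp add: LIMSEQ_const_iff)
  then show "f x = g x" by (simp add: h_def)
qed

lemma dyadic_lim_mult:
  assumes two: "absval (2::'a::local_field) > 1"
  shows "dyadic_lim (x * y) = (dyadic_lim x * dyadic_lim y :: 'a)"
proof -
  have "(\<lambda>x. dyadic_lim (x * y)) = (\<lambda>x. dyadic_lim x * dyadic_lim y :: 'a)"
  proof (rule additive_continuous_eq)
    show "continuous_on UNIV (\<lambda>x. dyadic_lim (x * y) :: 'a)"
      by (rule continuous_on_compose2[OF dyadic_lim_continuous[OF two]]) (auto intro!: continuous_intros)
    show "continuous_on UNIV (\<lambda>x. dyadic_lim x * dyadic_lim y :: 'a)"
      by (intro continuous_intros dyadic_lim_continuous two)
  qed (simp_all add: distrib_right dyadic_lim_add[OF two] dyadic_lim_1[OF two])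
  then show ?thesis by (rule fun_cong)
qed

lemma real_emb_eq_dyadic_lim:
  assumes two: "absval (2::'a::local_field) > 1"
  shows "real_emb = (dyadic_lim :: real \<Rightarrow> 'a)"
  unfolding real_emb_def
proof (rule the_equality)
  show "continuous_on UNIV (dyadic_lim :: real \<Rightarrow> 'a) \<and> dyadic_lim 1 = (1 :: 'a) \<and>
      (\<forall>x y. dyadic_lim (x + y) = (dyadic_lim x + dyadic_lim y :: 'a)) \<and>
      (\<forall>x y. dyadic_lim (x * y) = (dyadic_lim x * dyadic_lim y :: 'a))"
    using two by (simp add: dyadic_lim_continuous dyadic_lim_1 dyadic_lim_add dyadic_lim_mult)
  then show "f = dyadic_lim" if "continuous_on UNIV f \<and> f 1 = 1 \<and> (\<forall>x y. f (x + y) = f x + f y) \<and>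
      (\<forall>x y. f (x * y) = f x * f y)" for f :: "real \<Rightarrow> 'a"
    using that by (intro additive_continuous_eq) auto
qed

lemma
  assumes "archimedean TYPE('a::local_field)"
  shows real_emb_continuous: "continuous_on UNIV (real_emb :: real \<Rightarrow> 'a)"
    and real_emb_1: "real_emb 1 = (1::'a)"
    and real_emb_add: "real_emb (x + y) = (real_emb x + real_emb y :: 'a)"
    and real_emb_mult: "real_emb (x * y) = (real_emb x * real_emb y :: 'a)"
  using archimedean_absval_2[OF assms]
  by (simp_all add: real_emb_eq_dyadic_lim dyadic_lim_continuous dyadic_lim_1 dyadic_lim_add dyadic_lim_mult)

section \<open>Archimedean local fields are the real or the complex numbers\<close>

lemma
  assumes "archimedean TYPE('a::local_field)"
  shows real_emb_0: "real_emb 0 = (0::'a)"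
    and real_emb_minus: "real_emb (- x) = (- real_emb x :: 'a)"
    and real_emb_diff: "real_emb (x - y) = (real_emb x - real_emb y :: 'a)"
    and real_emb_eq_0: "real_emb x = (0::'a) \<longleftrightarrow> x = 0"
    and real_emb_power: "real_emb (x ^ n) = (real_emb x ^ n :: 'a)"
    and real_emb_2: "real_emb 2 = (2::'a)"
proof -
  show 0: "real_emb 0 = (0::'a)"
    using real_emb_add[OF assms, of 0 0] by simp
  show m: "real_emb (- x) = (- real_emb x :: 'a)" for x
    using real_emb_add[OF assms, of x "- x"] 0 by (simp add: add_eq_0_iff)
  show "real_emb (x - y) = (real_emb x - real_emb y :: 'a)"
    using real_emb_add[OF assms, of x "- y"] m by simp
  show "real_emb x = (0::'a) \<longleftrightarrow> x = 0"
    using real_emb_mult[OF assms, of x "inverse x"] real_emb_1[OF assms] 0 by (cases "x = 0") auto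
  show "real_emb (x ^ n) = (real_emb x ^ n :: 'a)"
    by (induct n) (simp_all add: real_emb_1[OF assms] real_emb_mult[OF assms])
  show "real_emb 2 = (2::'a)"
    using real_emb_add[OF assms, of 1 1] real_emb_1[OF assms] by simp
qed

lemma continuous_on_real_emb:
  assumes "archimedean TYPE('a::local_field)" "continuous_on S f"
  shows "continuous_on S (\<lambda>x. real_emb (f x) :: 'a)"
  using continuous_on_compose2[OF real_emb_continuous[OF assms(1)] assms(2)] by simp

text \<open>
  A continuous map that is equivariant under doubling and vanishes only at \<open>0\<close> is proper: it is
  bounded away from \<open>0\<close> on the compact annulus \<open>1 \<le> \<parallel>z\<parallel> \<le> 2\<close>, and \<open>\<bar>2\<bar> > 1\<close>.
\<close>

lemma doubling_equivariant_proper: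
  fixes E :: "'b::{real_normed_vector,heine_borel} \<Rightarrow> 'a::local_field"
  assumes arch: "archimedean TYPE('a)" and cont: "continuous_on UNIV E"
    and dbl: "\<And>z. E (2 *\<^sub>R z) = 2 * E z" and inj0: "\<And>z. E z = 0 \<Longrightarrow> z = 0"
  shows "\<exists>r. \<forall>z. absval (E z) \<le> R \<longrightarrow> norm z \<le> r"
proof -
  let ?A = "absval (2::'a)"
  let ?K = "{z::'b. 1 \<le> norm z \<and> norm z \<le> 2}"
  have A: "?A > 1" by (rule archimedean_absval_2[OF arch])
  have K: "compact ?K"
  proof -
    have "?K = cball 0 2 \<inter> {z. 1 \<le> norm z}" by auto
    moreover have "closed {z::'b. 1 \<le> norm z}" by (intro closed_Collect_le continuous_intros)
    ultimately show ?thesis by (metis compact_cball compact_Int_closed)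
  qed
  have "\<exists>c>0. \<forall>z\<in>?K. c \<le> absval (E z)"
  proof (cases "?K = {}")
    case False
    have "continuous_on ?K (\<lambda>z. absval (E z))"
      by (intro continuous_intros continuous_on_subset[OF cont]) auto
    from continuous_attains_inf[OF K False this] obtain w where w: "w \<in> ?K"
      and le: "\<forall>z\<in>?K. absval (E w) \<le> absval (E z)" by blast
    have "E w \<noteq> 0" using w inj0[of w] by auto
    then show ?thesis using le by (intro exI[of _ "absval (E w)"]) auto
  qed (auto intro: exI[of _ 1])
  then obtain c where c: "c > 0" and cK: "\<And>z. z \<in> ?K \<Longrightarrow> c \<le> absval (E z)" by blast
  have dbln: "E (2 ^ k *\<^sub>R z) = 2 ^ k * E z" for k z
    by (induct k) (simp_all add: mult.assoc dbl flip: scaleR_scaleR)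
  have grow: "c * ?A ^ k \<le> absval (E z)" if z: "2 ^ k \<le> norm z" for k z
  proof -
    have "\<exists>j\<ge>k. 2 ^ j \<le> norm z \<and> norm z < 2 ^ Suc j"
    proof -
      obtain N where N: "norm z < 2 ^ N" using real_arch_pow[of 2] by auto
      define j where "j = Max {j. 2 ^ j \<le> norm z}"
      have fin: "finite {j. 2 ^ j \<le> norm z}"
      proof (rule finite_subset)
        show "{j. 2 ^ j \<le> norm z} \<subseteq> {..N}"
        proof
          fix j :: nat assume "j \<in> {j. 2 ^ j \<le> norm z}"
          then have "(2::real) ^ j < 2 ^ N" using N by (intro le_less_trans[OF _ N]) simp
          then have "j < N" by (rule power_less_imp_less_exp[rotated]) simp
          then show "j \<in> {..N}" by simp
        qed
      qed simp
      have "j \<in> {j. 2 ^ j \<le> norm z}" unfolding j_def using fin z by (intro Max_in) auto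
      moreover have "j \<ge> k" unfolding j_def using fin z by (intro Max_ge) auto
      moreover have "Suc j \<notin> {j. 2 ^ j \<le> norm z}"
        using Max_ge[OF fin, of "Suc j"] unfolding j_def by auto
      ultimately show ?thesis by auto
    qed
    then obtain j where j: "j \<ge> k" "2 ^ j \<le> norm z" "norm z < 2 ^ Suc j" by blast
    define w where "w = inverse (2 ^ j) *\<^sub>R z"
    have "w \<in> ?K" unfolding w_def using j by (simp add: field_simps)
    have "E z = 2 ^ j * E w" unfolding dbln[symmetric] w_def by simp
    then have "absval (E z) = ?A ^ j * absval (E w)" by (simp add: absval_mult absval_power)
    also have "\<dots> \<ge> ?A ^ k * c"
      using A c j cK[OF \<open>w \<in> ?K\<close>] by (intro mult_mono power_increasing) auto
    finally show ?thesis by (simp add: mult.commute)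
  qed
  obtain k where k: "R / c < ?A ^ k" using real_arch_pow[OF A] by blast
  have "norm z \<le> 2 ^ k" if "absval (E z) \<le> R" for z
  proof (rule ccontr)
    assume "\<not> norm z \<le> 2 ^ k"
    then have "c * ?A ^ k \<le> R" using grow[of k z] that by simp
    then show False using k c by (simp add: field_simps)
  qed
  then show ?thesis by blast
qed

text \<open>
  For an element \<open>a\<close> of \<open>F\<close> and a complex number \<open>z\<close>, this is \<open>(a - z) (a - \<close> conjugate of \<open>z)\<close>.
\<close>

definition quad :: "'a::local_field \<Rightarrow> complex \<Rightarrow> 'a" where
  "quad a z = (a - real_emb (Re z))\<^sup>2 + (real_emb (Im z))\<^sup>2"

text \<open>
  The polynomial is proper as a function of \<open>z\<close>, so its absolute value has a minimum.  Choosing a minimum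
  point of largest modulus is what Ostrowski's argument contradicts unless the minimum is \<open>0\<close>.
\<close>

lemma quad_attains_inf:
  assumes arch: "archimedean TYPE('a::local_field)"
  shows "\<exists>z0. (\<forall>z. absval (quad a z0) \<le> absval (quad (a::'a) z)) \<and>
     (\<forall>z. absval (quad a z) = absval (quad a z0) \<longrightarrow> cmod z \<le> cmod z0)"
proof -
  let ?f = "\<lambda>z. absval (quad a z)"
  let ?e = "real_emb :: real \<Rightarrow> 'a"
  note e = real_emb_0[OF arch] real_emb_minus[OF arch] real_emb_diff[OF arch] real_emb_eq_0[OF arch]
    real_emb_power[OF arch] real_emb_2[OF arch] real_emb_add[OF arch] real_emb_mult[OF arch] real_emb_1[OF arch]
  have cont: "continuous_on UNIV ?f"
    unfolding quad_def power2_eq_square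
    by (intro continuous_intros continuous_on_real_emb arch)
  have e_prop: "\<exists>r. \<forall>t. absval (?e t) \<le> R \<longrightarrow> norm t \<le> r" for R
    by (intro doubling_equivariant_proper arch real_emb_continuous) (simp_all add: e)
  have "compact (?e ` {-1..1})"
    by (intro compact_continuous_image continuous_on_subset[OF real_emb_continuous[OF arch]]) auto
  then have "bounded (?e ` {-1..1})" by (rule compact_imp_bounded)
  then obtain C where "\<And>y. y \<in> ?e ` {-1..1} \<Longrightarrow> dist 0 y \<le> C"
    unfolding bounded_any_center[where a=0] by blast
  then have C: "absval (?e t) \<le> C" if "\<bar>t\<bar> \<le> 1" for t
    using that by (auto simp: dist_absval abs_le_iff)
  have C1: "C \<ge> 1" using C[of 1] by (simp add: e)
  define m where "m = ?f 0"
  \<comment> \<open>Sublevel sets are bounded, since \<open>\<bar>z\<bar>\<^sup>2\<close> dominates the other terms of the expanded polynomial.\<close>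
  have "bounded {z. ?f z \<le> m}"
  proof -
    define M where "M = absval (2::'a) * C * absval a + absval a ^ 2 + m + 1"
    have "absval (?e (cmod z)) \<le> M" if z: "?f z \<le> m" for z
    proof (rule ccontr)
      let ?t = "absval (?e (cmod z))"
      assume "\<not> ?t \<le> M"
      then have t: "?t > M" by simp
      have m0: "m \<ge> 0" by (simp add: m_def)
      have nn: "absval (2::'a) * C * absval a \<ge> 0" "absval a ^ 2 \<ge> 0" using C1 by simp_all
      have t1: "?t > 1" using t m0 nn unfolding M_def by linarith
      have z0: "cmod z \<noteq> 0" using t1 by (auto simp: e)
      have "\<bar>Re z / cmod z\<bar> \<le> 1" using abs_Re_le_cmod[of z] z0 by (simp add: abs_mult)
      from C[OF this] have "absval (?e (Re z / cmod z)) \<le> C" .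
      moreover have "?e (Re z) = ?e (cmod z) * ?e (Re z / cmod z)" using z0 by (simp flip: e)
      ultimately have ReC: "absval (?e (Re z)) \<le> ?t * C" by (simp add: absval_mult mult_left_mono)
      have "?e (cmod z) ^ 2 = quad a z + (2 * ?e (Re z) * a - a ^ 2)"
        unfolding e(5)[symmetric] cmod_power2 quad_def by (simp add: e power2_eq_square algebra_simps)
      then have "?t ^ 2 \<le> ?f z + (absval (2 * ?e (Re z) * a) + absval (a ^ 2))"
        using absval_triangle[of "quad a z" "2 * ?e (Re z) * a - a ^ 2"]
          absval_triangle_diff[of "2 * ?e (Re z) * a" "a ^ 2"]
        unfolding absval_power[symmetric] by simp
      also have "\<dots> \<le> m + (absval (2::'a) * (?t * C) * absval a + absval a ^ 2)"
        unfolding absval_mult absval_power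
        using z ReC by (intro add_mono mult_mono order_refl mult_nonneg_nonneg) (use C1 in auto)
      also have "\<dots> \<le> (m + absval a ^ 2) * ?t + absval (2::'a) * C * absval a * ?t"
      proof -
        have "(m + absval a ^ 2) * 1 \<le> (m + absval a ^ 2) * ?t"
          using t1 m0 nn by (intro mult_left_mono) auto
        then show ?thesis by (simp add: algebra_simps)
      qed
      also have "\<dots> = (M - 1) * ?t" unfolding M_def by (simp add: algebra_simps)
      also have "\<dots> < ?t * ?t" using t t1 by (intro mult_strict_right_mono) auto
      finally show False by (simp add: power2_eq_square)
    qed
    then obtain r where "\<And>z. ?f z \<le> m \<Longrightarrow> norm (cmod z) \<le> r" using e_prop by meson
    then show ?thesis unfolding bounded_iff by auto
  qed
  moreover have "closed {z. ?f z \<le> m}" by (intro closed_Collect_le cont continuous_intros)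
  ultimately have K: "compact {z. ?f z \<le> m}" by (simp add: compact_eq_bounded_closed)
  have ne: "{z. ?f z \<le> m} \<noteq> {}" by (auto simp: m_def)
  from continuous_attains_inf[OF K ne continuous_on_subset[OF cont]] obtain z1
    where z1: "?f z1 \<le> m" "\<And>z. ?f z \<le> m \<Longrightarrow> ?f z1 \<le> ?f z" by auto
  have inf: "?f z1 \<le> ?f z" for z using z1 by (cases "?f z \<le> m") (auto intro: z1(2))
  let ?S = "{z. ?f z \<le> ?f z1}"
  have S: "compact ?S"
  proof -
    have "?S = {z. ?f z \<le> m} \<inter> ?S" using z1 by auto
    moreover have "closed ?S" by (intro closed_Collect_le cont continuous_intros)
    ultimately show ?thesis using K by (metis compact_Int_closed)
  qed
  have "continuous_on ?S cmod" by (intro continuous_intros)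
  from continuous_attains_sup[OF S _ this] obtain z0 where z0: "z0 \<in> ?S" "\<And>z. z \<in> ?S \<Longrightarrow> cmod z \<le> cmod z0"
    by auto
  have "?f z0 = ?f z1" using z0(1) inf[of z0] by auto
  then show ?thesis using inf z0(2) by (intro exI[of _ z0]) auto
qed


lemma quad_square:
  assumes arch: "archimedean TYPE('a::local_field)"
  shows "quad (u\<^sup>2) (w\<^sup>2) = quad u w * quad (u::'a) (- w)"
proof -
  have eqs: "real_emb (Re (w\<^sup>2)) = (real_emb (Re w) ^ 2 - real_emb (Im w) ^ 2 :: 'a)"
    "real_emb (Im (w\<^sup>2)) = (2 * real_emb (Re w) * real_emb (Im w) :: 'a)"
    by (simp_all add: power2_eq_square real_emb_diff[OF arch] real_emb_add[OF arch] real_emb_mult[OF arch] real_emb_2[OF arch])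
  show ?thesis
    unfolding quad_def eqs uminus_complex.sel real_emb_minus[OF arch] by algebra
qed

lemma quad_shift:
  assumes arch: "archimedean TYPE('a::local_field)"
  shows "quad (u + real_emb t) z = quad (u::'a) (z - of_real t)"
  unfolding quad_def by (simp add: real_emb_diff[OF arch] diff_diff_eq2)

text \<open>
  The value \<open>quad u z\<close> is the norm of \<open>u - z\<close> from \<open>F[X]/(X\<^sup>2 + 1)\<close> to \<open>F\<close>, hence multiplicative in
  \<open>u - z\<close>.  With complex \<open>p\<close> and \<open>q\<close> one has \<open>quad a z0 - z = (a - p) (a - q)\<close>, which starts the induction, and
  \<open>u\<^sup>2 - w\<^sup>2 = (u - w) (u + w)\<close> gives its step.
\<close>

lemma quad_powers_ge:
  assumes arch: "archimedean TYPE('a::local_field)" and m0: "m \<ge> 0"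
    and inf: "\<And>z. m \<le> absval (quad (a::'a) z)"
  shows "m ^ (2 * 2 ^ i) \<le> absval (quad (quad a z0 ^ 2 ^ i) z)"
proof (induct i arbitrary: z)
  case 0
  define s where "s = csqrt (z - of_real ((Im z0)\<^sup>2))"
  let ?b = "a - real_emb (Re z0)"
  have b: "?b = a + real_emb (- Re z0)" by (simp add: real_emb_minus[OF arch])
  have "quad (quad a z0) z = quad (?b\<^sup>2 + real_emb ((Im z0)\<^sup>2)) z"
    by (simp add: quad_def[of a z0] real_emb_power[OF arch])
  also have "\<dots> = quad (?b\<^sup>2) (s\<^sup>2)" unfolding quad_shift[OF arch] s_def by simp
  also have "\<dots> = quad a (s + of_real (Re z0)) * quad a (- s + of_real (Re z0))"
    unfolding quad_square[OF arch] unfolding b quad_shift[OF arch] by simp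
  finally show ?case
    using mult_mono[OF inf inf, of "s + of_real (Re z0)" "- s + of_real (Re z0)"] m0
    by (simp add: absval_mult power2_eq_square)
next
  case (Suc i)
  have "quad (quad a z0 ^ 2 ^ Suc i) z = quad ((quad a z0 ^ 2 ^ i)\<^sup>2) ((csqrt z)\<^sup>2)"
    by (simp add: power_mult[symmetric] mult.commute)
  also have "\<dots> = quad (quad a z0 ^ 2 ^ i) (csqrt z) * quad (quad a z0 ^ 2 ^ i) (- csqrt z)"
    by (rule quad_square[OF arch])
  finally have "absval (quad (quad a z0 ^ 2 ^ Suc i) z) \<ge> m ^ (2 * 2 ^ i) * m ^ (2 * 2 ^ i)"
    using mult_mono[OF Suc Suc, of "csqrt z" "- csqrt z"] m0 by (simp add: absval_mult)
  then show ?case by (simp add: power_add[symmetric] mult_2)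
qed

text \<open>
  Ostrowski's argument. Let \<open>\<bar>(a - z)(a - z\<^sup>*)\<bar>\<close> be minimal, equal to \<open>m > 0\<close>, at a \<open>z\<^sub>0\<close> of
  maximal modulus, and put \<open>u = (a - z\<^sub>0)(a - z\<^sub>0\<^sup>*)\<close>.  The factorization
  \<open>u\<^sup>N - \<epsilon>\<^sup>N = (u - \<epsilon>) (u + \<epsilon>) (u\<^sup>2 + \<epsilon>\<^sup>2) \<cdots>\<close>, for \<open>N\<close> a power of \<open>2\<close>, bounds
  \<open>\<bar>u - \<epsilon>\<bar>\<close> by \<open>m\<close>, because all factors but the first have absolute value at least that
  of the corresponding power of \<open>m\<close>.  For small \<open>\<epsilon> < 0\<close> this yields another minimum, of larger modulus.
\<close>

lemma quad_root:
  assumes arch: "archimedean TYPE('a::local_field)"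
  shows "\<exists>z. quad (a::'a) z = 0"
proof -
  obtain z0 where inf: "\<And>z. absval (quad a z0) \<le> absval (quad a z)"
    and max: "\<And>z. absval (quad a z) = absval (quad a z0) \<Longrightarrow> cmod z \<le> cmod z0"
    using quad_attains_inf[OF arch, of a] by blast
  define u m where "u = quad a z0" and "m = absval u"
  have m: "m \<le> absval (quad a z)" for z unfolding m_def u_def by (rule inf)
  have "m = 0"
  proof (rule ccontr)
    assume "m \<noteq> 0"
    then have m0: "m > 0" unfolding m_def using absval_nonneg[of u] by linarith
    have "isCont (\<lambda>t. absval (real_emb t :: 'a)) 0"
      using continuous_on_absval[OF real_emb_continuous[OF arch]] by (simp add: continuous_on_eq_continuous_at)
    then have "\<exists>d>0. \<forall>t. dist t 0 < d \<longrightarrow> dist (absval (real_emb t :: 'a)) (absval (real_emb 0 :: 'a)) < m"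
      using m0 unfolding continuous_at_eps_delta by blast
    then obtain d where d: "d > 0" "\<And>t. dist t 0 < d \<Longrightarrow> absval (real_emb t :: 'a) < m"
      by (auto simp: real_emb_0[OF arch] dist_real_def)
    define t where "t = d / 2"
    define \<epsilon> where "\<epsilon> = (real_emb (- t) :: 'a)"
    have t: "t > 0" and \<epsilon>: "absval \<epsilon> < m" using d by (auto simp: t_def \<epsilon>_def dist_real_def)
    have plus: "m ^ 2 ^ i \<le> absval (u ^ 2 ^ i + \<epsilon> ^ 2 ^ i)" for i
    proof -
      have "quad (u ^ 2 ^ i) (of_real (- ((- t) ^ 2 ^ i))) = (u ^ 2 ^ i + \<epsilon> ^ 2 ^ i)\<^sup>2"
        by (simp add: quad_def \<epsilon>_def real_emb_minus[OF arch, of "_ ^ _"] real_emb_power[OF arch] real_emb_0[OF arch])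
      then have "(m ^ 2 ^ i)\<^sup>2 \<le> (absval (u ^ 2 ^ i + \<epsilon> ^ 2 ^ i))\<^sup>2"
        using quad_powers_ge[OF arch less_imp_le[OF m0] m, where i=i and ?z0.0=z0 and z="of_real (- ((- t) ^ 2 ^ i))"]
        unfolding u_def[symmetric] absval_power[symmetric] by (simp add: power_mult[symmetric] mult.commute)
      then show ?thesis by (rule power2_le_imp_le) simp
    qed
    have tele: "absval (u - \<epsilon>) * m ^ 2 ^ j \<le> m * absval (u ^ 2 ^ j - \<epsilon> ^ 2 ^ j)" for j
    proof (induct j)
      case (Suc j)
      have "x ^ 2 ^ Suc j = (x ^ 2 ^ j)\<^sup>2" for x :: 'a by (simp add: power_mult[symmetric] mult.commute)
      then have "u ^ 2 ^ Suc j - \<epsilon> ^ 2 ^ Suc j = (u ^ 2 ^ j - \<epsilon> ^ 2 ^ j) * (u ^ 2 ^ j + \<epsilon> ^ 2 ^ j)"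
        by (simp only:) (simp add: power2_eq_square algebra_simps)
      then have "m * absval (u ^ 2 ^ Suc j - \<epsilon> ^ 2 ^ Suc j)
          = (m * absval (u ^ 2 ^ j - \<epsilon> ^ 2 ^ j)) * absval (u ^ 2 ^ j + \<epsilon> ^ 2 ^ j)"
        by (simp add: absval_mult)
      moreover have "\<dots> \<ge> (absval (u - \<epsilon>) * m ^ 2 ^ j) * m ^ 2 ^ j"
        using m0 by (intro mult_mono Suc plus) auto
      moreover have "m ^ 2 ^ Suc j = m ^ 2 ^ j * m ^ 2 ^ j" by (simp add: mult_2 power_add)
      ultimately show ?case by (simp only: mult.assoc)
    qed (simp add: mult.commute)
    have le: "absval (u - \<epsilon>) \<le> m + m * (absval \<epsilon> / m) ^ 2 ^ j" for j
    proof -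
      have "absval (u - \<epsilon>) * m ^ 2 ^ j \<le> m * (m ^ 2 ^ j + absval \<epsilon> ^ 2 ^ j)"
        using tele[of j] mult_left_mono[OF absval_triangle_diff[of "u ^ 2 ^ j" "\<epsilon> ^ 2 ^ j"], of m] m0
        unfolding absval_power m_def[symmetric] by linarith
      then have "absval (u - \<epsilon>) \<le> m * (m ^ 2 ^ j + absval \<epsilon> ^ 2 ^ j) / m ^ 2 ^ j"
        using m0 by (simp add: pos_le_divide_eq)
      also have "\<dots> = m + m * (absval \<epsilon> / m) ^ 2 ^ j"
        using m0 by (simp add: power_divide field_simps)
      finally show ?thesis .
    qed
    have "(\<lambda>j. (absval \<epsilon> / m) ^ 2 ^ j) \<longlonglongrightarrow> 0"
    proof -
      have "(\<lambda>k. (absval \<epsilon> / m) ^ k) \<longlonglongrightarrow> 0" using \<epsilon> m0 by (intro LIMSEQ_realpow_zero) auto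
      from LIMSEQ_subseq_LIMSEQ[OF this, of "\<lambda>j. 2 ^ j"] show ?thesis
        by (simp add: o_def strict_mono_def)
    qed
    then have "(\<lambda>j. m + m * (absval \<epsilon> / m) ^ 2 ^ j) \<longlonglongrightarrow> m + m * 0" by (intro tendsto_intros)
    then have "absval (u - \<epsilon>) \<le> m" using le by (intro LIMSEQ_le_const[where x=m]) auto
    define z1 where "z1 = Complex (Re z0) (sqrt ((Im z0)\<^sup>2 + t))"
    have "real_emb (sqrt ((Im z0)\<^sup>2 + t)) ^ 2 = (real_emb (Im z0) ^ 2 + real_emb t :: 'a)"
      using t by (simp flip: real_emb_power[OF arch] real_emb_add[OF arch])
    then have "u - \<epsilon> = quad a z1"
      unfolding u_def quad_def z1_def \<epsilon>_def by (simp add: real_emb_minus[OF arch])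
    then have "absval (quad a z1) = absval (quad a z0)"
      using \<open>absval (u - \<epsilon>) \<le> m\<close> m[of z1] by (simp add: m_def u_def)
    from max[OF this] have "(cmod z1)\<^sup>2 \<le> (cmod z0)\<^sup>2" by (intro power_mono) auto
    then show False using t unfolding cmod_power2 z1_def by simp
  qed
  then show ?thesis unfolding m_def u_def by auto
qed

lemma continuous_on_inverse_of_proper:
  fixes E :: "'b::{real_normed_vector,heine_borel} \<Rightarrow> 'a::local_field"
  assumes arch: "archimedean TYPE('a)" and cont: "continuous_on UNIV E"
    and add: "\<And>x y. E (x + y) = E x + E y" and inj0: "\<And>z. E z = 0 \<Longrightarrow> z = 0"
    and inv: "\<And>y. E (\<sigma> y) = y"
  shows "continuous_on UNIV \<sigma>"
proof -
  have E0: "E 0 = 0" using add[of 0 0] by simp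
  have inj: "x = y" if "E x = E y" for x y
    using add[of "x - y" y] inj0[of "x - y"] that by simp
  have dbl: "E (2 *\<^sub>R z) = 2 * E z" for z by (simp only: scaleR_2 add mult_2)
  have "closed (\<sigma> -` S)" if S: "closed S" for S
    unfolding closed_sequential_limits
  proof (intro allI impI, elim conjE)
    fix x l assume x: "\<forall>n. x n \<in> \<sigma> -` S" and l: "x \<longlonglongrightarrow> l"
    have "bounded (range x)" using l by (rule convergent_imp_bounded)
    then obtain R where R: "\<And>n. absval (x n) \<le> R"
      unfolding bounded_any_center[where a=0] by (auto simp: dist_absval)
    obtain r where r: "\<And>z. absval (E z) \<le> R \<Longrightarrow> norm z \<le> r"
      using doubling_equivariant_proper[OF arch cont dbl inj0] by blast
    have "compact (E ` (cball 0 r \<inter> S))"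
      by (intro compact_continuous_image continuous_on_subset[OF cont] compact_Int_closed S) auto
    moreover have "x n \<in> E ` (cball 0 r \<inter> S)" for n
      using x r[of "\<sigma> (x n)"] R[of n] inv by (intro image_eqI[of _ _ "\<sigma> (x n)"]) auto
    ultimately have "l \<in> E ` (cball 0 r \<inter> S)"
      using l by (meson closed_sequentially compact_imp_closed)
    then obtain s where "l = E s" "s \<in> S" by auto
    moreover then have "\<sigma> l = s" using inv inj by blast
    ultimately show "l \<in> \<sigma> -` S" by simp
  qed
  then show ?thesis by (simp add: continuous_on_closed_vimage)
qed

text \<open>
  A root of the polynomial in \<open>quad_root\<close> shows that \<open>(a - x)\<^sup>2 = - y\<^sup>2\<close> for some real \<open>x\<close> and \<open>y\<close>.  If
  some \<open>a\<close> is not real, this yields a square root \<open>\<iota>\<close> of \<open>-1\<close>, and then every element is \<open>x \<plusminus> y \<iota>\<close>.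
  So \<open>\<sigma>\<close> identifies \<open>F\<close> with the complex numbers, or with the reals, and then \<open>\<iota> = 0\<close> is taken.
\<close>

theorem archimedean_structure:
  assumes arch: "archimedean TYPE('a::local_field)"
  obtains \<sigma> :: "'a::local_field \<Rightarrow> complex" and \<iota> :: 'a where
    "continuous_on UNIV \<sigma>" "\<And>x y. \<sigma> (x + y) = \<sigma> x + \<sigma> y" "\<And>x y. \<sigma> (x * y) = \<sigma> x * \<sigma> y"
    "\<And>t. \<sigma> (real_emb t) = of_real t" "\<And>z. z = real_emb (Re (\<sigma> z)) + real_emb (Im (\<sigma> z)) * \<iota>"
proof -
  let ?e = "real_emb :: real \<Rightarrow> 'a"
  note e = real_emb_0[OF arch] real_emb_minus[OF arch] real_emb_diff[OF arch] real_emb_eq_0[OF arch]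
    real_emb_power[OF arch] real_emb_add[OF arch] real_emb_mult[OF arch] real_emb_1[OF arch]
  have einj: "x = y" if "?e x = ?e y" for x y
    using that real_emb_eq_0[OF arch, of "x - y"] by (simp add: e)
  have root: "\<exists>x y. (a - ?e x)\<^sup>2 = - ((?e y)\<^sup>2)" for a
    using quad_root[OF arch, of a] unfolding quad_def eq_neg_iff_add_eq_0 by blast
  show thesis
  proof (cases "\<forall>a. \<exists>x. a = ?e x")
    case True
    then obtain \<rho> where \<rho>: "\<And>a. ?e (\<rho> a) = a" by metis
    have \<rho>e: "\<rho> (?e t) = t" for t using einj \<rho> by blast
    have cont: "continuous_on UNIV \<rho>"
      by (rule continuous_on_inverse_of_proper[OF arch real_emb_continuous[OF arch]]) (simp_all add: e \<rho>)
    show thesis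
    proof (rule that[of "\<lambda>z. of_real (\<rho> z)" 0])
      show "continuous_on UNIV (\<lambda>z. complex_of_real (\<rho> z))" by (intro continuous_intros cont)
      show "complex_of_real (\<rho> (x + y)) = of_real (\<rho> x) + of_real (\<rho> y)" for x y
      proof -
        have "\<rho> (?e (\<rho> x + \<rho> y)) = \<rho> x + \<rho> y" by (rule \<rho>e)
        then show ?thesis by (simp add: e \<rho>)
      qed
      show "complex_of_real (\<rho> (x * y)) = of_real (\<rho> x) * of_real (\<rho> y)" for x y
      proof -
        have "\<rho> (?e (\<rho> x * \<rho> y)) = \<rho> x * \<rho> y" by (rule \<rho>e)
        then show ?thesis by (simp add: e \<rho>)
      qed
    qed (simp_all add: \<rho> \<rho>e)
  next
    case False
    then obtain a where a: "\<And>x. a \<noteq> ?e x" by auto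
    obtain x y where xy: "(a - ?e x)\<^sup>2 = - ((?e y)\<^sup>2)" using root by blast
    have y: "?e y \<noteq> 0" using xy a[of x] by auto
    define \<iota> where "\<iota> = (a - ?e x) / ?e y"
    have \<iota>: "\<iota> * \<iota> = -1"
      using xy y unfolding \<iota>_def by (simp add: power2_eq_square field_simps)
    define E where "E = (\<lambda>z. ?e (Re z) + ?e (Im z) * \<iota>)"
    have Eadd: "E (z + w) = E z + E w" for z w by (simp add: E_def e algebra_simps)
    have Emult: "E (z * w) = E z * E w" for z w
    proof -
      have "E z * E w = ?e (Re z) * ?e (Re w) + ?e (Im z) * ?e (Im w) * (\<iota> * \<iota>)
          + (?e (Re z) * ?e (Im w) + ?e (Im z) * ?e (Re w)) * \<iota>"
        unfolding E_def by (simp add: algebra_simps)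
      then show ?thesis unfolding \<iota> by (simp add: E_def e algebra_simps)
    qed
    have E0: "z = 0" if "E z = 0" for z
    proof -
      have "?e ((cmod z)\<^sup>2) = E (z * cnj z)" unfolding complex_mult_cnj cmod_power2 by (simp add: E_def e)
      also have "\<dots> = 0" unfolding Emult that by simp
      finally show ?thesis by (simp add: e)
    qed
    have Einj: "z = w" if "E z = E w" for z w using Eadd[of "z - w" w] E0[of "z - w"] that by simp
    have Econt: "continuous_on UNIV E"
      unfolding E_def by (intro continuous_intros continuous_on_real_emb arch)
    have "\<exists>z. E z = b" for b
    proof -
      obtain x y where "(b - ?e x)\<^sup>2 = - ((?e y)\<^sup>2)" using root by blast
      also have "\<dots> = (?e y * \<iota>)\<^sup>2" by (simp add: power_mult_distrib power2_eq_square[of \<iota>] \<iota>)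
      finally have "b - ?e x = ?e y * \<iota> \<or> b - ?e x = - (?e y * \<iota>)" by (simp add: power2_eq_iff)
      then have "b = E (Complex x y) \<or> b = E (Complex x (- y))"
        by (auto simp: E_def e algebra_simps)
      then show ?thesis by auto
    qed
    then obtain \<sigma> where \<sigma>: "\<And>b. E (\<sigma> b) = b" by metis
    have \<sigma>E: "\<sigma> (E z) = z" for z using Einj \<sigma> by blast
    show thesis
    proof (rule that[of \<sigma> \<iota>])
      show "continuous_on UNIV \<sigma>"
        by (rule continuous_on_inverse_of_proper[OF arch Econt Eadd E0 \<sigma>])
      show "\<sigma> (x + y) = \<sigma> x + \<sigma> y" for x y using \<sigma>E[of "\<sigma> x + \<sigma> y"] by (simp add: Eadd \<sigma>)
      show "\<sigma> (x * y) = \<sigma> x * \<sigma> y" for x y using \<sigma>E[of "\<sigma> x * \<sigma> y"] by (simp add: Emult \<sigma>)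
      show "\<sigma> (?e t) = of_real t" for t using \<sigma>E[of "of_real t"] by (simp add: E_def e)
      show "z = ?e (Re (\<sigma> z)) + ?e (Im (\<sigma> z)) * \<iota>" for z using \<sigma>[of z] by (simp add: E_def)
    qed
  qed
qed


section \<open>Calculus of iterated directional derivatives\<close>

text \<open>
  The domains of interest are \<open>F\<close> and the space of matrices over \<open>F\<close>.  Derivatives are taken along real
  lines, so they reduce to vector derivatives of functions of one real variable.
\<close>

locale smooth_domain =
  fixes s :: "'a::local_field \<Rightarrow> 'x \<Rightarrow> 'x::{metric_space,ab_group_add}"
  assumes arch: "archimedean TYPE('a)"
    and s_add_left: "s (a + b) v = s a v + s b v"
    and s_add_right: "s a (v + w) = s a v + s a w"
    and s_assoc: "s a (s b v) = s (a * b) v"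
    and s_continuous: "continuous_on UNIV (\<lambda>p. fst p + s (snd p) v)"
begin

definition line :: "'x \<Rightarrow> 'x \<Rightarrow> real \<Rightarrow> 'x" where
  "line x v t = x + s (real_emb t) v"

definition has_dd :: "('x \<Rightarrow> complex) \<Rightarrow> complex \<Rightarrow> 'x \<Rightarrow> 'x \<Rightarrow> bool" where
  "has_dd f d x v \<longleftrightarrow> ((\<lambda>t. f (line x v t)) has_vector_derivative d) (at 0)"

lemma s_0 [simp]: "s 0 v = 0" "s a 0 = 0"
  using s_add_left[of 0 0 v] s_add_right[of a 0 0] by simp_all

lemma line_0 [simp]: "line x v 0 = x"
  unfolding line_def by (simp add: real_emb_0[OF arch])

lemma line_add: "line x v (t + r) = line (line x v t) v r"
  unfolding line_def by (simp add: real_emb_add[OF arch] s_add_left add.assoc)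

lemma continuous_line:
  assumes "continuous_on S f" "continuous_on S g"
  shows "continuous_on S (\<lambda>p. line (f p) v (g p))"
  unfolding line_def
  using continuous_on_compose2[OF s_continuous[of v],
      of S "\<lambda>p. (f p, real_emb (g p))"] assms
  by (simp add: continuous_on_Pair continuous_on_real_emb[OF arch])

lemma eventually_line:
  assumes "open U" "x \<in> U"
  shows "\<forall>\<^sub>F t in nhds 0. line x v t \<in> U"
proof -
  have "continuous_on UNIV (line x v)"
    using continuous_line[of UNIV "\<lambda>_. x" "\<lambda>t. t" v] by simp
  then have "open (line x v -` U)" using assms(1) by (rule open_vimage[rotated])
  then show ?thesis unfolding eventually_nhds using assms(2) by (intro exI[of _ "line x v -` U"]) auto
qed

lemma has_dd_at:
  assumes "has_dd f d (line x v t) v"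
  shows "((\<lambda>t. f (line x v t)) has_vector_derivative d) (at t)"
proof -
  have "((\<lambda>r. f (line x v (t + r))) has_vector_derivative d) (at 0)"
    using assms unfolding has_dd_def line_add .
  then have "(((\<lambda>r. f (line x v (t + r))) \<circ> (\<lambda>u. u - t)) has_vector_derivative (1 *\<^sub>R d)) (at t)"
    by (intro vector_diff_chain_at) (auto intro!: derivative_eq_intros)
  then show ?thesis by (simp add: o_def)
qed

lemma has_dd_iff_limit:
  "has_dd f d x v \<longleftrightarrow>
     ((\<lambda>t. complex_of_real (1 / t) * (f (x + s (real_emb t) v) - f x)) \<longlongrightarrow> d) (at 0)"
proof -
  have "has_dd f d x v \<longleftrightarrow>
     ((\<lambda>t. (1 / norm (t - 0)) *\<^sub>R (f (line x v t) - (f (line x v 0) + (t - 0) *\<^sub>R d))) \<longlongrightarrow> 0) (at 0)"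
    unfolding has_dd_def has_vector_derivative_def has_derivative_within
    by (simp add: bounded_linear_scaleR_left)
  also have "\<dots> \<longleftrightarrow> ((\<lambda>t. complex_of_real (1 / t) * (f (line x v t) - f x) - d) \<longlongrightarrow> 0) (at 0)"
  proof -
    have "norm ((1 / norm (t - 0)) *\<^sub>R (f (line x v t) - (f (line x v 0) + (t - 0) *\<^sub>R d)))
      = norm (complex_of_real (1 / t) * (f (line x v t) - f x) - d)" if "t \<noteq> 0" for t
    proof -
      have "complex_of_real (1 / t) * (f (line x v t) - f x) - d
        = complex_of_real (1 / t) * (f (line x v t) - (f (line x v 0) + (t - 0) *\<^sub>R d))"
        using that by (simp add: scaleR_conv_of_real field_simps)
      then show ?thesis by (simp add: norm_mult norm_divide)
    qed
    then have "\<forall>\<^sub>F t in at 0. norm ((1 / norm (t - 0)) *\<^sub>R (f (line x v t) - (f (line x v 0) + (t - 0) *\<^sub>R d)))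
      = norm (complex_of_real (1 / t) * (f (line x v t) - f x) - d)"
      by (auto simp: eventually_at_filter)
    from tendsto_cong[OF this] show ?thesis by (subst (1 2) tendsto_norm_zero_iff[symmetric])
  qed
  also have "\<dots> \<longleftrightarrow> ((\<lambda>t. complex_of_real (1 / t) * (f (x + s (real_emb t) v) - f x)) \<longlongrightarrow> d) (at 0)"
    unfolding line_def by (rule LIM_zero_iff)
  finally show ?thesis .
qed

abbreviation Ck :: "nat \<Rightarrow> 'x set \<Rightarrow> ('x \<Rightarrow> complex) \<Rightarrow> bool" where
  "Ck k U f \<equiv> Ck_on s (*) euclidean k U f"

lemma Ck_0: "Ck 0 U f \<longleftrightarrow> continuous_on U f"
  by simp

lemma Ck_Suc:
  "Ck (Suc k) U f \<longleftrightarrow> continuous_on U f \<and> (\<forall>v. \<exists>f'. (\<forall>x\<in>U. has_dd f (f' x) x v) \<and> Ck k U f')"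
  by (simp add: has_dd_iff_limit)

declare Ck_on.simps [simp del]

lemma Ck_SucI:
  assumes "continuous_on U f" "\<And>v x. x \<in> U \<Longrightarrow> has_dd f (D v x) x v" "\<And>v. Ck k U (D v)"
  shows "Ck (Suc k) U f"
  unfolding Ck_Suc using assms by blast

lemma Ck_SucE:
  assumes "Ck (Suc k) U f"
  obtains D where "\<And>v x. x \<in> U \<Longrightarrow> has_dd f (D v x) x v" "\<And>v. Ck k U (D v)"
  using assms unfolding Ck_Suc by metis

lemma Ck_continuous: "Ck k U f \<Longrightarrow> continuous_on U f"
  by (cases k) (auto simp: Ck_0 Ck_Suc)

lemma Ck_decrease: "Ck (Suc k) U f \<Longrightarrow> Ck k U f"
proof (induct k arbitrary: f)
  case (Suc k)
  then show ?case by (subst Ck_Suc) (subst (asm) Ck_Suc, blast)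
qed (simp add: Ck_0 Ck_Suc)

lemma Ck_subset: "Ck k U f \<Longrightarrow> V \<subseteq> U \<Longrightarrow> Ck k V f"
proof (induct k arbitrary: f)
  case (Suc k)
  then show ?case unfolding Ck_Suc by (meson continuous_on_subset in_mono)
qed (auto simp: Ck_0 intro: continuous_on_subset)

lemma has_dd_unique: "has_dd f d x v \<Longrightarrow> has_dd f d' x v \<Longrightarrow> d = d'"
  unfolding has_dd_def by (rule vector_derivative_unique_at)

lemma has_dd_cong:
  assumes "open U" "x \<in> U" "\<And>y. y \<in> U \<Longrightarrow> f y = g y" "has_dd f d x v"
  shows "has_dd g d x v"
proof -
  have "\<forall>\<^sub>F t in nhds 0. f (line x v t) = g (line x v t)"
    using eventually_line[OF assms(1,2)] by eventually_elim (rule assms(3))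
  then show ?thesis
    using assms(2-4) unfolding has_dd_def
    by (subst has_vector_derivative_cong_ev[where g="\<lambda>t. f (line x v t)"])
       (auto elim!: eventually_mono)
qed

lemma Ck_cong:
  assumes "open U" "\<And>y. y \<in> U \<Longrightarrow> f y = g y" "Ck k U f"
  shows "Ck k U g"
proof (cases k)
  case 0
  then show ?thesis using assms continuous_on_cong[of U U f g] by (simp add: Ck_0)
next
  case (Suc j)
  then show ?thesis
    using assms continuous_on_cong[of U U f g] has_dd_cong[of U _ f g]
    unfolding Ck_Suc Suc by metis
qed

lemma Ck_Un:
  assumes "open U" "open V" "Ck k U f" "Ck k V f"
  shows "Ck k (U \<union> V) f"
  using assms(3,4)
proof (induct k arbitrary: f)
  case 0
  then show ?case using assms by (simp add: Ck_0 continuous_on_open_Un)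
next
  case (Suc k)
  obtain D where D: "\<And>v x. x \<in> U \<Longrightarrow> has_dd f (D v x) x v" "\<And>v. Ck k U (D v)"
    using Suc.prems(1) by (rule Ck_SucE) blast
  obtain E where E: "\<And>v x. x \<in> V \<Longrightarrow> has_dd f (E v x) x v" "\<And>v. Ck k V (E v)"
    using Suc.prems(2) by (rule Ck_SucE) blast
  let ?G = "\<lambda>v x. if x \<in> U then D v x else E v x"
  have GE: "E v x = ?G v x" if "x \<in> V" for v x
  proof (cases "x \<in> U")
    case True
    then show ?thesis using has_dd_unique[OF E(1)[OF that, of v] D(1)[OF True, of v]] by simp
  qed simp
  show ?case
  proof (rule Ck_SucI[where D="?G"])
    show "continuous_on (U \<union> V) f"
      using Suc.prems assms by (intro continuous_on_open_Un) (auto dest: Ck_continuous)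
    show "has_dd f (?G v x) x v" if "x \<in> U \<union> V" for v x
      using that D E by auto
    show "Ck k (U \<union> V) (?G v)" for v
    proof (rule Suc.hyps)
      show "Ck k U (?G v)" by (rule Ck_cong[OF assms(1) _ D(2)]) auto
      show "Ck k V (?G v)" by (rule Ck_cong[OF assms(2) GE E(2)])
    qed
  qed
qed

lemma Ck_const: "Ck k U (\<lambda>_. c)"
  by (induct k arbitrary: c)
     (auto simp: Ck_0 has_dd_def intro!: Ck_SucI[where D="\<lambda>_ _. 0"] derivative_eq_intros)

lemma Ck_add: "Ck k U f \<Longrightarrow> Ck k U g \<Longrightarrow> Ck k U (\<lambda>x. f x + g x)"
proof (induct k arbitrary: f g)
  case (Suc k)
  obtain D where D: "\<And>v x. x \<in> U \<Longrightarrow> has_dd f (D v x) x v" "\<And>v. Ck k U (D v)"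
    using Suc.prems(1) by (rule Ck_SucE) blast
  obtain E where E: "\<And>v x. x \<in> U \<Longrightarrow> has_dd g (E v x) x v" "\<And>v. Ck k U (E v)"
    using Suc.prems(2) by (rule Ck_SucE) blast
  show ?case
    by (rule Ck_SucI[where D="\<lambda>v x. D v x + E v x"])
       (use D E Suc in \<open>auto simp: has_dd_def intro!: derivative_intros continuous_intros dest: Ck_continuous\<close>)
qed (auto simp: Ck_0 intro: continuous_intros)

lemma Ck_mult: "Ck k U f \<Longrightarrow> Ck k U g \<Longrightarrow> Ck k U (\<lambda>x. f x * g x)"
proof (induct k arbitrary: f g)
  case (Suc k)
  obtain D where D: "\<And>v x. x \<in> U \<Longrightarrow> has_dd f (D v x) x v" "\<And>v. Ck k U (D v)"
    using Suc.prems(1) by (rule Ck_SucE) blast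
  obtain E where E: "\<And>v x. x \<in> U \<Longrightarrow> has_dd g (E v x) x v" "\<And>v. Ck k U (E v)"
    using Suc.prems(2) by (rule Ck_SucE) blast
  show ?case
  proof (rule Ck_SucI[where D="\<lambda>v x. f x * E v x + D v x * g x"])
    show "continuous_on U (\<lambda>x. f x * g x)"
      using Suc.prems by (auto intro!: continuous_intros dest: Ck_continuous)
    show "has_dd (\<lambda>x. f x * g x) (f x * E v x + D v x * g x) x v" if "x \<in> U" for v x
      using has_vector_derivative_mult[OF D(1)[OF that, of v, unfolded has_dd_def] E(1)[OF that, of v, unfolded has_dd_def]]
      unfolding has_dd_def by simp
    show "Ck k U (\<lambda>x. f x * E v x + D v x * g x)" for v
      using Suc.prems D E by (intro Ck_add Suc.hyps) (auto intro: Ck_decrease)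
  qed
qed (auto simp: Ck_0 intro: continuous_intros)

lemma Ck_linear:
  assumes L: "bounded_linear (L :: complex \<Rightarrow> complex)"
  shows "Ck k U f \<Longrightarrow> Ck k U (\<lambda>x. L (f x))"
proof (induct k arbitrary: f)
  case 0
  then show ?case by (simp add: Ck_0 bounded_linear.continuous_on[OF L])
next
  case (Suc k)
  obtain D where D: "\<And>v x. x \<in> U \<Longrightarrow> has_dd f (D v x) x v" "\<And>v. Ck k U (D v)"
    using Suc.prems(1) by (rule Ck_SucE) blast
  show ?case
  proof (rule Ck_SucI[where D="\<lambda>v x. L (D v x)"])
    show "continuous_on U (\<lambda>x. L (f x))"
      using Suc.prems by (intro bounded_linear.continuous_on[OF L]) (rule Ck_continuous)
    show "has_dd (\<lambda>x. L (f x)) (L (D v x)) x v" if "x \<in> U" for v x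
      using D(1)[OF that, of v] unfolding has_dd_def by (rule bounded_linear.has_vector_derivative[OF L])
    show "Ck k U (\<lambda>x. L (D v x))" for v by (intro Suc.hyps D)
  qed
qed

lemma Ck_inverse:
  assumes nz: "\<And>x. x \<in> U \<Longrightarrow> f x \<noteq> 0"
  shows "Ck k U f \<Longrightarrow> Ck k U (\<lambda>x. inverse (f x))"
proof (induct k)
  case 0
  then show ?case using nz by (simp add: Ck_0 continuous_on_inverse)
next
  case (Suc k)
  obtain D where D: "\<And>v x. x \<in> U \<Longrightarrow> has_dd f (D v x) x v" "\<And>v. Ck k U (D v)"
    using Suc.prems(1) by (rule Ck_SucE) blast
  have IH: "Ck k U (\<lambda>x. inverse (f x))" using Suc by (auto intro: Ck_decrease)
  show ?case
  proof (rule Ck_SucI[where D="\<lambda>v x. (-1) * D v x * (inverse (f x) * inverse (f x))"])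
    show "continuous_on U (\<lambda>x. inverse (f x))" using IH by (rule Ck_continuous)
    show "has_dd (\<lambda>x. inverse (f x)) ((-1) * D v x * (inverse (f x) * inverse (f x))) x v" if "x \<in> U" for v x
    proof -
      have "(inverse has_field_derivative - (inverse (f x) * inverse (f x))) (at (f (line x v 0)))"
        using nz[OF that] by (auto intro!: derivative_eq_intros simp: power2_eq_square field_simps)
      from field_vector_diff_chain_at[OF D(1)[OF that, of v, unfolded has_dd_def] this]
      show ?thesis unfolding has_dd_def o_def by simp
    qed
    show "Ck k U (\<lambda>x. (-1) * D v x * (inverse (f x) * inverse (f x)))" for v
      by (intro Ck_mult Ck_const D IH)
  qed
qed

lemma Ck_sum: "finite I \<Longrightarrow> (\<And>i. i \<in> I \<Longrightarrow> Ck k U (f i)) \<Longrightarrow> Ck k U (\<lambda>x. \<Sum>i\<in>I. f i x)"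
  by (induct I rule: finite_induct) (auto intro: Ck_const Ck_add)

lemma Ck_prod: "finite I \<Longrightarrow> (\<And>i. i \<in> I \<Longrightarrow> Ck k U (f i)) \<Longrightarrow> Ck k U (\<lambda>x. \<Prod>i\<in>I. f i x)"
  by (induct I rule: finite_induct) (auto intro: Ck_const Ck_mult)

lemma has_dd_zero: "has_dd f 0 x 0"
  unfolding has_dd_def line_def by (simp add: has_vector_derivative_const)

lemma has_dd_scale:
  assumes "has_dd f d x v"
  shows "has_dd f (of_real c * d) x (s (real_emb c) v)"
proof -
  have l: "line x (s (real_emb c) v) t = line x v (c * t)" for t
    unfolding line_def by (simp add: s_assoc real_emb_mult[OF arch] mult.commute)
  have "((\<lambda>t. f (line x v t)) has_vector_derivative d) (at (c * 0))"
    using assms unfolding has_dd_def by simp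
  moreover have "((\<lambda>t. c * t) has_vector_derivative c) (at 0)"
    by (auto intro!: derivative_eq_intros)
  ultimately have "(((\<lambda>t. f (line x v t)) \<circ> (\<lambda>t. c * t)) has_vector_derivative c *\<^sub>R d) (at 0)"
    by (rule vector_diff_chain_at[rotated])
  then show ?thesis unfolding has_dd_def l by (simp add: o_def scaleR_conv_of_real)
qed

text \<open>
  Directional derivatives are additive in the direction as soon as one of them is continuous: by the
  mean value inequality, \<open>f (y + t w) - f y\<close> is close to \<open>t\<close> times the derivative at \<open>x\<close>, for
  \<open>y = x + t v\<close>.
\<close>

lemma has_dd_add:
  assumes U: "open U" "x \<in> U" and v: "has_dd f d x v"
    and w: "\<And>y. y \<in> U \<Longrightarrow> has_dd f (f' y) y w" and cont: "continuous_on U f'"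
  shows "has_dd f (d + f' x) x (v + w)"
proof -
  let ?y = "\<lambda>t. line x v t"
  have l: "line x (v + w) t = line (?y t) w t" for t
    unfolding line_def by (simp add: s_add_right add.assoc)
  have diag: "((\<lambda>t. f (line (?y t) w t) - f (?y t)) has_vector_derivative f' x) (at 0)"
    unfolding has_vector_derivative_def has_derivative_at_alt
  proof (intro conjI allI impI bounded_linear_scaleR_left)
    fix e :: real assume e: "e > 0"
    obtain W where W: "open W" "f' -` ball (f' x) e \<inter> U = W \<inter> U"
      using continuous_on_open_invariant[THEN iffD1, OF cont, rule_format, OF open_ball] by metis
    have "open (W \<inter> U)" using W U by blast
    moreover have "x \<in> W \<inter> U" unfolding W(2)[symmetric] using U e by simp
    moreover have "continuous_on UNIV (\<lambda>p. line (?y (fst p)) w (snd p))"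
      by (intro continuous_line continuous_intros)
    ultimately have "open ((\<lambda>p. line (?y (fst p)) w (snd p)) -` (W \<inter> U))"
      "(0, 0) \<in> (\<lambda>p. line (?y (fst p)) w (snd p)) -` (W \<inter> U)"
      by (blast intro: open_vimage, simp)
    then obtain A B where AB: "open A" "open B" "0 \<in> A" "0 \<in> B"
      "A \<times> B \<subseteq> (\<lambda>p. line (?y (fst p)) w (snd p)) -` (W \<inter> U)"
      by (rule open_prod_elim) blast
    obtain \<eta> where \<eta>: "\<eta> > 0" "ball 0 \<eta> \<subseteq> A \<inter> B"
      using AB open_contains_ball[of "A \<inter> B"] by blast
    have in_U: "line (?y t) w r \<in> W \<inter> U" if "\<bar>t\<bar> < \<eta>" "\<bar>r\<bar> < \<eta>" for t r
    proof -
      have "t \<in> A" "r \<in> B" using \<eta>(2) that by (auto simp: subset_iff dist_real_def)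
      then show ?thesis using AB(5) by auto
    qed
    show "\<exists>d>0. \<forall>t. norm (t - 0) < d \<longrightarrow>
        norm (f (line (?y t) w t) - f (?y t) - (f (line (?y 0) w 0) - f (?y 0)) - (t - 0) *\<^sub>R f' x)
          \<le> e * norm (t - 0)"
    proof (intro exI[of _ \<eta>] conjI \<eta>(1) allI impI)
      fix t :: real assume "norm (t - 0) < \<eta>"
      then have t: "\<bar>t\<bar> < \<eta>" by simp
      let ?S = "{-\<bar>t\<bar>..\<bar>t\<bar>}"
      let ?g = "\<lambda>r. f (line (?y t) w r) - r *\<^sub>R f' x"
      have "norm (?g t - ?g 0) \<le> e * norm (t - 0)"
      proof (rule differentiable_bound[where S="?S"])
        show "(?g has_derivative (\<lambda>h. h *\<^sub>R (f' (line (?y t) w r) - f' x))) (at r within ?S)" if "r \<in> ?S" for r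
        proof -
          have "line (?y t) w r \<in> W \<inter> U" using that t by (intro in_U) auto
          then have "((\<lambda>r. f (line (?y t) w r)) has_vector_derivative f' (line (?y t) w r)) (at r)"
            by (intro has_dd_at w) auto
          then have "(?g has_vector_derivative f' (line (?y t) w r) - 1 *\<^sub>R f' x) (at r)"
            by (intro has_vector_derivative_diff) (auto intro!: derivative_eq_intros)
          then show ?thesis unfolding has_vector_derivative_def
            by (auto intro: has_derivative_at_withinI)
        qed
        show "onorm (\<lambda>h. h *\<^sub>R (f' (line (?y t) w r) - f' x)) \<le> e" if "r \<in> ?S" for r
        proof -
          have "line (?y t) w r \<in> W \<inter> U" using that t by (intro in_U) auto
          then have "norm (f' (line (?y t) w r) - f' x) \<le> e"
            unfolding W(2)[symmetric] by (auto simp: dist_norm norm_minus_commute)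
          then show ?thesis
            using e by (intro onorm_le) (simp add: mult.commute[of e] mult_left_mono)
        qed
      qed auto
      then show "norm (f (line (?y t) w t) - f (?y t) - (f (line (?y 0) w 0) - f (?y 0)) - (t - 0) *\<^sub>R f' x)
          \<le> e * norm (t - 0)" by (simp add: algebra_simps)
    qed
  qed
  have "((\<lambda>t. (f (line (?y t) w t) - f (?y t)) + f (?y t)) has_vector_derivative f' x + d) (at 0)"
    using v unfolding has_dd_def by (intro derivative_intros diag)
  then show ?thesis unfolding has_dd_def l by (simp add: add.commute)
qed

text \<open>The directions in which \<open>f\<close> has a derivative of class \<open>C\<^sup>k\<close> form a real subspace.\<close>

definition good_dir :: "nat \<Rightarrow> 'x set \<Rightarrow> ('x \<Rightarrow> complex) \<Rightarrow> 'x \<Rightarrow> bool" where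
  "good_dir k U f v \<longleftrightarrow> (\<exists>f'. (\<forall>x\<in>U. has_dd f (f' x) x v) \<and> Ck k U f')"

lemma Ck_Suc_iff_good_dir: "Ck (Suc k) U f \<longleftrightarrow> continuous_on U f \<and> (\<forall>v. good_dir k U f v)"
  unfolding good_dir_def Ck_Suc ..

lemma good_dir_0: "good_dir k U f 0"
  unfolding good_dir_def by (intro exI[of _ "\<lambda>_. 0"] conjI ballI has_dd_zero Ck_const)

lemma good_dir_scale: "good_dir k U f v \<Longrightarrow> good_dir k U f (s (real_emb c) v)"
  unfolding good_dir_def
proof (elim exE conjE)
  fix f' assume "\<forall>x\<in>U. has_dd f (f' x) x v" "Ck k U f'"
  then show "\<exists>f'. (\<forall>x\<in>U. has_dd f (f' x) x (s (real_emb c) v)) \<and> Ck k U f'"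
    by (intro exI[of _ "\<lambda>x. of_real c * f' x"] conjI Ck_mult Ck_const) (auto intro: has_dd_scale)
qed

lemma good_dir_add:
  assumes U: "open U" and "good_dir k U f v" "good_dir k U f w"
  shows "good_dir k U f (v + w)"
proof -
  obtain f1 f2 where 1: "\<forall>x\<in>U. has_dd f (f1 x) x v" "Ck k U f1"
    and 2: "\<forall>x\<in>U. has_dd f (f2 x) x w" "Ck k U f2"
    using assms(2,3) unfolding good_dir_def by blast
  show ?thesis unfolding good_dir_def
  proof (intro exI[of _ "\<lambda>x. f1 x + f2 x"] conjI Ck_add 1 2 ballI)
    fix x assume "x \<in> U"
    then show "has_dd f (f1 x + f2 x) x (v + w)"
      using 1(1) 2(1) by (intro has_dd_add[OF U _ _ _ Ck_continuous[OF 2(2)]]) auto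
  qed
qed

lemma good_dir_sum:
  assumes "open U" "finite I" "\<And>i. i \<in> I \<Longrightarrow> good_dir k U f (v i)"
  shows "good_dir k U f (\<Sum>i\<in>I. v i)"
  using assms(2,3) by (induct I rule: finite_induct) (auto intro: good_dir_0 good_dir_add[OF assms(1)])

lemma has_dd_sum:
  assumes U: "open U" "x \<in> U" and I: "finite I"
    and D: "\<And>i y. i \<in> I \<Longrightarrow> y \<in> U \<Longrightarrow> has_dd f (D i y) y (v i)"
    and cont: "\<And>i. i \<in> I \<Longrightarrow> continuous_on U (D i)"
  shows "has_dd f (\<Sum>i\<in>I. of_real (c i) * D i x) x (\<Sum>i\<in>I. s (real_emb (c i)) (v i))"
  using I D cont
proof (induct I rule: finite_induct)
  case (insert i I)
  have "has_dd f ((\<Sum>i\<in>I. of_real (c i) * D i x) + of_real (c i) * D i x) x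
      ((\<Sum>i\<in>I. s (real_emb (c i)) (v i)) + s (real_emb (c i)) (v i))"
    using insert by (intro has_dd_add[OF U, where f'="\<lambda>y. of_real (c i) * D i y"] has_dd_scale continuous_intros) auto
  then show ?case using insert by (simp add: add.commute)
qed (simp add: has_dd_zero)

end

lemma Ck_affine:
  fixes s :: "'a::local_field \<Rightarrow> 'x \<Rightarrow> 'x::{metric_space,ab_group_add}"
    and s' :: "'a \<Rightarrow> 'y \<Rightarrow> 'y::{metric_space,ab_group_add}"
  assumes "smooth_domain s" "smooth_domain s'"
    and A: "continuous_on UNIV A" "\<And>y a v. A (y + s' a v) = A y + s a (L v)"
  shows "Ck_on s (*) euclidean k UNIV f \<Longrightarrow> Ck_on s' (*) euclidean k UNIV (\<lambda>y. f (A y))"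
proof (induct k arbitrary: f)
  case 0
  then show ?case
    using A(1) by (auto simp: smooth_domain.Ck_0[OF assms(1)] smooth_domain.Ck_0[OF assms(2)]
        intro: continuous_on_compose2)
next
  case (Suc k)
  interpret X: smooth_domain s by fact
  interpret Y: smooth_domain s' by fact
  obtain D where D: "\<And>v x. X.has_dd f (D v x) x v" "\<And>v. X.Ck k UNIV (D v)"
    using X.Ck_SucE[OF Suc.prems] by (metis UNIV_I)
  show ?case
  proof (rule Y.Ck_SucI[where D="\<lambda>v y. D (L v) (A y)"])
    show "continuous_on UNIV (\<lambda>y. f (A y))"
      using A(1) X.Ck_continuous[OF Suc.prems] by (auto intro: continuous_on_compose2)
    show "Y.has_dd (\<lambda>y. f (A y)) (D (L v) (A x)) x v" for v x
      using D(1)[where x="A x" and v="L v"] unfolding X.has_dd_def Y.has_dd_def X.line_def Y.line_def A(2) .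
    show "Y.Ck k UNIV (\<lambda>y. D (L v) (A y))" for v by (intro Suc.hyps D)
  qed
qed

lemma smooth_domain_field:
  assumes "archimedean TYPE('a::local_field)"
  shows "smooth_domain ((*) :: 'a \<Rightarrow> 'a \<Rightarrow> 'a)"
proof
  show "continuous_on UNIV (\<lambda>p. fst p + snd p * v)" for v :: 'a by (intro continuous_intros)
qed (simp_all add: assms algebra_simps)

lemma smooth_domain_matrix:
  assumes "archimedean TYPE('a::local_field)"
  shows "smooth_domain (mat_scale :: 'a \<Rightarrow> 'a^'n^'n \<Rightarrow> 'a^'n^'n)"
proof
  show "continuous_on UNIV (\<lambda>p. fst p + mat_scale (snd p) v)" for v :: "'a^'n^'n"
  proof -
    have eq: "(\<lambda>p. fst p + mat_scale (snd p) v) = (\<lambda>p. \<chi> i j. fst p $ i $ j + snd p * v $ i $ j)"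
      by (auto simp: vec_eq_iff mat_scale_def)
    show ?thesis unfolding eq by (intro continuous_intros)
  qed
qed (simp_all add: assms mat_scale_def vec_eq_iff algebra_simps)


section \<open>Smooth functions of the determinant\<close>

definition mat_unit :: "'n \<Rightarrow> 'n \<Rightarrow> 'a::local_field \<Rightarrow> 'a^'n^'n" where
  "mat_unit i j b = (\<chi> k l. if k = i \<and> l = j then b else 0)"

definition cofac :: "'a::local_field^'n^'n \<Rightarrow> 'n \<Rightarrow> 'n \<Rightarrow> 'a" where
  "cofac g i j = det (\<chi> k. if k = i then axis j 1 else g $ k)"

lemma mat_scale_unit: "mat_scale a (mat_unit i j b) = mat_unit i j (a * b)"
  by (simp add: mat_scale_def mat_unit_def vec_eq_iff)

lemma det_add_mat_unit: "det (g + mat_unit i j b) = det g + b * cofac g i j"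
proof -
  have "g + mat_unit i j b = (\<chi> k. if k = i then g $ k + b *s axis j 1 else g $ k)"
    by (auto simp: vec_eq_iff mat_unit_def axis_def)
  then have "det (g + mat_unit i j b) = det (\<chi> k. if k = i then g $ k else g $ k)
      + det (\<chi> k. if k = i then b *s axis j 1 else g $ k)"
    by (simp only: det_row_add)
  then show ?thesis unfolding cofac_def det_row_mul by simp
qed

lemma continuous_on_det:
  "continuous_on S f \<Longrightarrow> continuous_on S (\<lambda>x. det (f x :: 'a::local_field^'n^'n))"
  unfolding det_def
  by (intro continuous_intros)

lemma continuous_on_matrixI:
  assumes "\<And>i j. continuous_on S (\<lambda>x. f x $ i $ j)"
  shows "continuous_on S (f :: _ \<Rightarrow> 'a::topological_space^'n^'m)"
proof -
  have "continuous_on S (\<lambda>x. \<chi> i j. f x $ i $ j)" by (intro continuous_on_vec_lambda assms)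
  moreover have "(\<lambda>x. \<chi> i j. f x $ i $ j) = f" by (rule ext) (simp add: vec_eq_iff)
  ultimately show ?thesis by simp
qed

text \<open>
  By \<open>\<sigma>_coord\<close>, the real and imaginary parts of \<open>\<sigma>\<close> are coordinates with respect to the directions \<open>1\<close>
  and \<open>\<iota>\<close>; as \<open>\<sigma>\<close> is multiplicative, coordinates of polynomials are smooth.
\<close>

locale arch_field =
  fixes \<sigma> :: "'a::local_field \<Rightarrow> complex" and \<iota> :: 'a
  assumes arch: "archimedean TYPE('a)"
    and \<sigma>_continuous: "continuous_on UNIV \<sigma>"
    and \<sigma>_add: "\<sigma> (x + y) = \<sigma> x + \<sigma> y"
    and \<sigma>_mult: "\<sigma> (x * y) = \<sigma> x * \<sigma> y"
    and \<sigma>_emb: "\<sigma> (real_emb t) = of_real t"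
    and \<sigma>_coord: "z = real_emb (Re (\<sigma> z)) + real_emb (Im (\<sigma> z)) * \<iota>"
begin

sublocale F: smooth_domain "(*) :: 'a \<Rightarrow> 'a \<Rightarrow> 'a"
  by (rule smooth_domain_field[OF arch])

lemma \<sigma>_0: "\<sigma> 0 = 0" using \<sigma>_add[of 0 0] by simp

lemma \<sigma>_1: "\<sigma> 1 = 1" using \<sigma>_emb[of 1] by (simp add: real_emb_1[OF arch])

lemma \<sigma>_minus: "\<sigma> (- x) = - \<sigma> x" using \<sigma>_add[of x "- x"] \<sigma>_0 by (simp add: add_eq_0_iff)

lemma \<sigma>_of_int: "\<sigma> (of_int k) = of_int k"
proof -
  have "\<sigma> (of_nat n) = of_nat n" for n by (induct n) (simp_all add: \<sigma>_0 \<sigma>_1 \<sigma>_add)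
  then show ?thesis by (cases k rule: int_cases2) (simp_all add: \<sigma>_minus)
qed

lemma \<sigma>_sum: "\<sigma> (sum f I) = (\<Sum>i\<in>I. \<sigma> (f i))"
  by (induct I rule: infinite_finite_induct) (simp_all add: \<sigma>_0 \<sigma>_add)

lemma \<sigma>_prod: "\<sigma> (prod f I) = (\<Prod>i\<in>I. \<sigma> (f i))"
  by (induct I rule: infinite_finite_induct) (simp_all add: \<sigma>_1 \<sigma>_mult)

lemma \<sigma>_eq_0: "\<sigma> x = 0 \<longleftrightarrow> x = 0"
  using \<sigma>_coord[of x] by (auto simp: \<sigma>_0 real_emb_0[OF arch])

lemma \<sigma>_inverse: "\<sigma> (inverse x) = inverse (\<sigma> x)"
  using \<sigma>_mult[of x "inverse x"] by (cases "x = 0") (auto simp: \<sigma>_0 \<sigma>_1 intro: inverse_unique[symmetric])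

lemma Ck_\<sigma>: "F.Ck k UNIV \<sigma>"
proof (cases k)
  case 0
  then show ?thesis by (simp add: F.Ck_0 \<sigma>_continuous)
next
  case (Suc j)
  show ?thesis unfolding Suc
  proof (rule F.Ck_SucI[where D="\<lambda>v _. \<sigma> v"])
    show "F.has_dd \<sigma> (\<sigma> v) x v" for v x
      unfolding F.has_dd_def F.line_def \<sigma>_add \<sigma>_mult \<sigma>_emb
      by (auto intro!: derivative_eq_intros)
  qed (auto intro: \<sigma>_continuous F.Ck_const)
qed

lemma has_dd_coord:
  assumes "open U" "x \<in> U" "\<And>v y. y \<in> U \<Longrightarrow> F.has_dd f (D v y) y v" "\<And>v. continuous_on U (D v)"
  shows "F.has_dd f (of_real (Re (\<sigma> v)) * D 1 x + of_real (Im (\<sigma> v)) * D \<iota> x) x v"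
proof -
  have "F.has_dd f (of_real (Re (\<sigma> v)) * D 1 x + of_real (Im (\<sigma> v)) * D \<iota> x) x
      (real_emb (Re (\<sigma> v)) * 1 + real_emb (Im (\<sigma> v)) * \<iota>)"
    by (rule F.has_dd_add[OF assms(1,2), where f'="\<lambda>y. of_real (Im (\<sigma> v)) * D \<iota> y"])
       (intro F.has_dd_scale assms continuous_intros | assumption)+
  then show ?thesis using \<sigma>_coord[of v] by simp
qed

end

locale arch_matrix = arch_field \<sigma> \<iota> for \<sigma> :: "'a::local_field \<Rightarrow> complex" and \<iota> +
  fixes n :: "'n::finite itself"
begin

sublocale M: smooth_domain "mat_scale :: 'a \<Rightarrow> 'a^'n^'n \<Rightarrow> 'a^'n^'n"
  by (rule smooth_domain_matrix[OF arch])

lemma matrix_coord: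
  "(A :: 'a^'n^'n) = (\<Sum>i\<in>UNIV. \<Sum>j\<in>UNIV. mat_scale (real_emb (Re (\<sigma> (A $ i $ j)))) (mat_unit i j 1)
      + mat_scale (real_emb (Im (\<sigma> (A $ i $ j)))) (mat_unit i j \<iota>))"
proof -
  have "(\<Sum>i\<in>UNIV. \<Sum>j\<in>UNIV. mat_scale (real_emb (Re (\<sigma> (A $ i $ j)))) (mat_unit i j 1)
      + mat_scale (real_emb (Im (\<sigma> (A $ i $ j)))) (mat_unit i j \<iota>)) $ k $ l = A $ k $ l" for k l
  proof -
    have "(\<Sum>i\<in>UNIV. \<Sum>j\<in>UNIV. mat_scale (real_emb (Re (\<sigma> (A $ i $ j)))) (mat_unit i j 1)
      + mat_scale (real_emb (Im (\<sigma> (A $ i $ j)))) (mat_unit i j \<iota>)) $ k $ l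
      = (\<Sum>i\<in>UNIV. \<Sum>j\<in>UNIV. if k = i \<and> l = j then A $ i $ j else 0)"
      unfolding sum_component
      by (intro sum.cong refl) (use \<sigma>_coord in \<open>auto simp: mat_scale_def mat_unit_def\<close>)
    also have "\<dots> = (\<Sum>i\<in>UNIV. if k = i then (\<Sum>j\<in>UNIV. if l = j then A $ i $ j else 0) else 0)"
      by (intro sum.cong refl) (auto intro!: sum.neutral)
    also have "\<dots> = A $ k $ l" by simp
    finally show ?thesis .
  qed
  then show ?thesis by (simp add: vec_eq_iff)
qed

lemma Ck_Suc_matrixI:
  assumes "open U" "continuous_on U f" "\<And>i j b. M.good_dir k U f (mat_unit i j b)"
  shows "M.Ck (Suc k) U f"
  unfolding M.Ck_Suc_iff_good_dir
proof (intro conjI allI assms)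
  fix A :: "'a^'n^'n"
  show "M.good_dir k U f A"
    by (subst matrix_coord, intro M.good_dir_sum M.good_dir_add M.good_dir_scale assms finite)
qed

lemma Ck_entry: "M.Ck k UNIV (\<lambda>g. \<sigma> (g $ i $ j))"
proof (rule Ck_affine[OF F.smooth_domain_axioms M.smooth_domain_axioms _ _ Ck_\<sigma>, where L="\<lambda>v. v $ i $ j"])
  show "continuous_on UNIV (\<lambda>g::'a^'n^'n. g $ i $ j)" by (intro continuous_intros)
qed (simp add: mat_scale_def)

lemma Ck_\<sigma>_det: "M.Ck k UNIV (\<lambda>g. \<sigma> (det g))"
  unfolding det_def \<sigma>_sum \<sigma>_mult \<sigma>_prod \<sigma>_of_int
  by (intro M.Ck_sum M.Ck_mult M.Ck_prod M.Ck_const Ck_entry) (auto simp: finite_permutations)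

lemma Ck_\<sigma>_cofac: "M.Ck k UNIV (\<lambda>g. \<sigma> (cofac g i j))"
proof -
  have "M.Ck k UNIV (\<lambda>g. \<sigma> (det (g + mat_unit i j 1)))"
  proof (rule Ck_affine[OF M.smooth_domain_axioms M.smooth_domain_axioms _ _ Ck_\<sigma>_det, where L="\<lambda>v. v"])
    show "continuous_on UNIV (\<lambda>g::'a^'n^'n. g + mat_unit i j 1)"
      unfolding continuous_on_def
      by (intro ballI vec_tendstoI) (auto intro!: tendsto_intros)
  qed (simp add: algebra_simps)
  then have "M.Ck k UNIV (\<lambda>g. \<sigma> (det (g + mat_unit i j 1)) + (-1) * \<sigma> (det g))"
    by (intro M.Ck_add M.Ck_mult M.Ck_const Ck_\<sigma>_det)
  moreover have "\<sigma> (cofac g i j) = \<sigma> (det (g + mat_unit i j 1)) + (-1) * \<sigma> (det g)" for g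
    by (simp add: det_add_mat_unit \<sigma>_add)
  ultimately show ?thesis by simp
qed

text \<open>
  Along an elementary matrix the determinant is affine, so there the chain rule is a restriction to a
  line; additivity in the direction takes care of the other matrices.
\<close>

lemma Ck_det: "F.Ck k UNIV p \<Longrightarrow> M.Ck k UNIV (\<lambda>g. p (det g))"
proof (induct k arbitrary: p)
  case 0
  then show ?case
    unfolding F.Ck_0 M.Ck_0 using continuous_on_compose2[OF _ continuous_on_det[OF continuous_on_id]] by auto
next
  case (Suc k)
  obtain D where D: "\<And>v x. F.has_dd p (D v x) x v" "\<And>v. F.Ck k UNIV (D v)"
    using F.Ck_SucE[OF Suc.prems] by (metis UNIV_I)
  show ?case
  proof (rule Ck_Suc_matrixI)
    show "continuous_on UNIV (\<lambda>g::'a^'n^'n. p (det g))"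
      using continuous_on_compose2[OF F.Ck_continuous[OF Suc.prems] continuous_on_det[OF continuous_on_id]] by auto
    fix i j :: 'n and b
    let ?D = "\<lambda>g::'a^'n^'n. of_real (Re (\<sigma> b * \<sigma> (cofac g i j))) * D 1 (det g)
      + of_real (Im (\<sigma> b * \<sigma> (cofac g i j))) * D \<iota> (det g)"
    have "M.has_dd (\<lambda>g. p (det g)) (?D g) g (mat_unit i j b)" for g
    proof -
      have "F.has_dd p (?D g) (det g) (b * cofac g i j)"
        unfolding \<sigma>_mult[symmetric] by (rule has_dd_coord[OF open_UNIV]) (auto intro: D F.Ck_continuous)
      moreover have "det (M.line g (mat_unit i j b) t) = F.line (det g) (b * cofac g i j) t" for t
        unfolding M.line_def F.line_def by (simp add: mat_scale_unit det_add_mat_unit mult.assoc)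
      ultimately show ?thesis unfolding M.has_dd_def F.has_dd_def by simp
    qed
    moreover have "M.Ck k UNIV ?D"
      by (intro M.Ck_add M.Ck_mult Suc.hyps D M.Ck_const Ck_\<sigma>_cofac
          M.Ck_linear[of "\<lambda>z. complex_of_real (Re z)"] M.Ck_linear[of "\<lambda>z. complex_of_real (Im z)"]
          bounded_linear_compose[OF bounded_linear_of_real] bounded_linear_Re bounded_linear_Im)
    ultimately show "M.good_dir k UNIV (\<lambda>g. p (det g)) (mat_unit i j b)"
      unfolding M.good_dir_def by (intro exI[of _ ?D]) auto
  qed simp
qed

end

lemma arch_matrixE:
  assumes "archimedean TYPE('a::local_field)"
  obtains \<sigma> :: "'a::local_field \<Rightarrow> complex" and \<iota> where "arch_matrix \<sigma> \<iota>"
proof (rule archimedean_structure[OF assms])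
  fix \<sigma> :: "'a \<Rightarrow> complex" and \<iota> :: 'a
  assume "continuous_on UNIV \<sigma>" "\<And>x y. \<sigma> (x + y) = \<sigma> x + \<sigma> y" "\<And>x y. \<sigma> (x * y) = \<sigma> x * \<sigma> y"
    "\<And>t. \<sigma> (real_emb t) = of_real t" "\<And>z. z = real_emb (Re (\<sigma> z)) + real_emb (Im (\<sigma> z)) * \<iota>"
  then show thesis by (intro that[of \<sigma> \<iota>] arch_matrix.intro arch_field.intro assms)
qed

section \<open>Smooth functions over a local field\<close>

lemma smooth_on_arch:
  "archimedean TYPE('a) \<Longrightarrow> smooth_on (s::'a::local_field \<Rightarrow> _) U f \<longleftrightarrow> (\<forall>k. Ck_on s (*) euclidean k U f)"
  by (simp add: smooth_on_def)

lemma smooth_on_nonarch: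
  "\<not> archimedean TYPE('a) \<Longrightarrow> smooth_on (s::'a::local_field \<Rightarrow> _) U f
     \<longleftrightarrow> (\<forall>x\<in>U. \<forall>\<^sub>F y in at x within U. f y = f x)"
  by (simp add: smooth_on_def)

lemma eventually_const2:
  assumes "\<forall>x\<in>U. \<forall>\<^sub>F y in G x. f y = f x" "\<forall>x\<in>U. \<forall>\<^sub>F y in G x. g y = g x" "x \<in> U"
  shows "\<forall>\<^sub>F y in G x. h (f y) (g y) = h (f x) (g x)"
  using assms(1)[rule_format, OF assms(3)] assms(2)[rule_format, OF assms(3)]
  by eventually_elim simp

text \<open>
  Closure properties shared by the two meanings of smoothness, so that later arguments need not
  distinguish them.
\<close>

locale domain_of_smoothness =
  fixes s :: "'a::local_field \<Rightarrow> 'x \<Rightarrow> 'x::{metric_space,ab_group_add}"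
  assumes smooth_domain: "archimedean TYPE('a) \<Longrightarrow> smooth_domain s"
begin

lemma smooth_const: "smooth_on s U (\<lambda>_. c)"
  by (cases "archimedean TYPE('a)")
     (auto simp: smooth_on_arch smooth_on_nonarch smooth_domain.Ck_const[OF smooth_domain])

lemma smooth_add: "smooth_on s U f \<Longrightarrow> smooth_on s U g \<Longrightarrow> smooth_on s U (\<lambda>x. f x + g x)"
  by (cases "archimedean TYPE('a)")
     (auto simp: smooth_on_arch smooth_on_nonarch intro: smooth_domain.Ck_add[OF smooth_domain]
       dest: eventually_const2[where h="(+)"])

lemma smooth_mult: "smooth_on s U f \<Longrightarrow> smooth_on s U g \<Longrightarrow> smooth_on s U (\<lambda>x. f x * g x)"
  by (cases "archimedean TYPE('a)")
     (auto simp: smooth_on_arch smooth_on_nonarch intro: smooth_domain.Ck_mult[OF smooth_domain]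
       dest: eventually_const2[where h="(*)"])

lemma smooth_cnj: "smooth_on s U f \<Longrightarrow> smooth_on s U (\<lambda>x. cnj (f x))"
  by (cases "archimedean TYPE('a)")
     (auto simp: smooth_on_arch smooth_on_nonarch
       intro: smooth_domain.Ck_linear[OF smooth_domain bounded_linear_cnj] elim: eventually_mono)

lemma smooth_inverse: "smooth_on s U f \<Longrightarrow> (\<And>x. x \<in> U \<Longrightarrow> f x \<noteq> 0) \<Longrightarrow> smooth_on s U (\<lambda>x. inverse (f x))"
  by (cases "archimedean TYPE('a)")
     (auto simp: smooth_on_arch smooth_on_nonarch intro: smooth_domain.Ck_inverse[OF smooth_domain]
       elim: eventually_mono)

lemma smooth_sum: "finite I \<Longrightarrow> (\<And>i. i \<in> I \<Longrightarrow> smooth_on s U (f i)) \<Longrightarrow> smooth_on s U (\<lambda>x. \<Sum>i\<in>I. f i x)"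
  by (induct I rule: finite_induct) (auto intro: smooth_const smooth_add)

lemma smooth_prod: "finite I \<Longrightarrow> (\<And>i. i \<in> I \<Longrightarrow> smooth_on s U (f i)) \<Longrightarrow> smooth_on s U (\<lambda>x. \<Prod>i\<in>I. f i x)"
  by (induct I rule: finite_induct) (auto intro: smooth_const smooth_mult)

lemma smooth_subset: "smooth_on s U f \<Longrightarrow> V \<subseteq> U \<Longrightarrow> smooth_on s V f"
  by (cases "archimedean TYPE('a)")
     (auto simp: smooth_on_arch smooth_on_nonarch intro: smooth_domain.Ck_subset[OF smooth_domain]
       elim: eventually_mono dest: filter_leD[OF at_le])

lemma smooth_cong:
  assumes "open U" "\<And>x. x \<in> U \<Longrightarrow> f x = g x" "smooth_on s U f"
  shows "smooth_on s U g"
proof (cases "archimedean TYPE('a)")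
  case True
  show ?thesis unfolding smooth_on_arch[OF True]
  proof
    fix k
    have "Ck_on s (*) euclidean k U f" using assms(3) True by (simp add: smooth_on_arch)
    then show "Ck_on s (*) euclidean k U g"
      using smooth_domain.Ck_cong[OF smooth_domain[OF True] assms(1), of f g k] assms(2) by blast
  qed
next
  case False
  show ?thesis unfolding smooth_on_nonarch[OF False]
  proof
    fix x assume x: "x \<in> U"
    have "\<forall>\<^sub>F y in at x within U. y \<in> U" by (simp add: eventually_at_filter)
    moreover have "\<forall>\<^sub>F y in at x within U. f y = f x" using assms(3) False x by (simp add: smooth_on_nonarch)
    ultimately show "\<forall>\<^sub>F y in at x within U. g y = g x"
      by eventually_elim (use assms(2) x in simp)
  qed
qed

lemma smooth_Un:
  assumes "open U" "open V" "smooth_on s U f" "smooth_on s V f"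
  shows "smooth_on s (U \<union> V) f"
proof (cases "archimedean TYPE('a)")
  case True
  show ?thesis unfolding smooth_on_arch[OF True]
    using smooth_domain.Ck_Un[OF smooth_domain[OF True] assms(1,2)] assms(3,4) True
    by (simp add: smooth_on_arch)
next
  case False
  then show ?thesis using assms
    by (auto simp: smooth_on_nonarch at_within_open[of _ U] at_within_open[of _ V]
        at_within_open[of _ "U \<union> V"] open_Un)
qed

lemma smooth_continuous:
  assumes "smooth_on s U f"
  shows "continuous_on U f"
proof (cases "archimedean TYPE('a)")
  case True
  then show ?thesis using assms smooth_domain.Ck_continuous[OF smooth_domain, OF True] by (auto simp: smooth_on_arch)
next
  case False
  show ?thesis unfolding continuous_on_def
  proof
    fix x assume "x \<in> U"
    then have "\<forall>\<^sub>F y in at x within U. f y = f x" using assms False by (auto simp: smooth_on_nonarch)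
    then show "(f \<longlongrightarrow> f x) (at x within U)" by (rule tendsto_eventually)
  qed
qed

lemma smooth_extend_0:
  assumes "open U" "smooth_on s U f" "compact C" "C \<subseteq> U" "\<And>x. x \<notin> C \<Longrightarrow> f x = 0"
  shows "smooth_on s UNIV f"
proof -
  have C: "open (- C)" using assms(3) by (simp add: compact_imp_closed open_Compl)
  have "smooth_on s (- C) f"
    by (rule smooth_cong[OF C _ smooth_const[of _ 0]]) (use assms(5) in auto)
  then have "smooth_on s (U \<union> - C) f" by (rule smooth_Un[OF assms(1) C assms(2)])
  moreover have "U \<union> - C = UNIV" using assms(4) by blast
  ultimately show ?thesis by simp
qed

lemma Cc_smooth_iff:
  assumes "open U"
  shows "f \<in> Cc_smooth s U \<longleftrightarrow>
    smooth_on s UNIV f \<and> (\<exists>C. compact C \<and> C \<subseteq> U \<and> (\<forall>x. x \<notin> C \<longrightarrow> f x = 0))"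
  unfolding Cc_smooth_def using smooth_extend_0[OF assms, of f] smooth_subset[of UNIV f U] by auto

end

lemma smooth_affine:
  assumes "domain_of_smoothness (s::'a::local_field \<Rightarrow> _)" "domain_of_smoothness s'"
    and A: "continuous_on UNIV A" "\<And>y a v. A (y + s' a v) = A y + s a (L v)"
    and f: "smooth_on s UNIV f"
  shows "smooth_on s' UNIV (\<lambda>y. f (A y))"
proof (cases "archimedean TYPE('a)")
  case True
  then show ?thesis using f A
      Ck_affine[OF domain_of_smoothness.smooth_domain[OF assms(1) True] domain_of_smoothness.smooth_domain[OF assms(2) True]]
    by (auto simp: smooth_on_arch)
next
  case False
  have "\<forall>\<^sub>F y in at x. f (A y) = f (A x)" for x
  proof -
    have "\<forall>\<^sub>F y in nhds (A x). f y = f (A x)"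
      using f False by (auto simp: smooth_on_nonarch eventually_at_filter elim: eventually_mono)
    moreover have "filterlim A (nhds (A x)) (at x)" using A(1) by (auto simp: continuous_on_def)
    ultimately show ?thesis by (rule eventually_compose_filterlim)
  qed
  then show ?thesis using False by (simp add: smooth_on_nonarch)
qed

lemma field_domain: "domain_of_smoothness ((*) :: 'a::local_field \<Rightarrow> 'a \<Rightarrow> 'a)"
  by (rule domain_of_smoothness.intro) (rule smooth_domain_field)

lemma matrix_domain: "domain_of_smoothness (mat_scale :: 'a::local_field \<Rightarrow> 'a^'n^'n \<Rightarrow> 'a^'n^'n)"
  by (rule domain_of_smoothness.intro) (rule smooth_domain_matrix)

lemma smooth_det:
  assumes "smooth_on (*) UNIV (p :: 'a::local_field \<Rightarrow> complex)"
  shows "smooth_on mat_scale UNIV (\<lambda>g::'a^'n^'n. p (det g))"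
proof (cases "archimedean TYPE('a)")
  case True
  obtain \<sigma> :: "'a \<Rightarrow> complex" and \<iota> where "arch_matrix \<sigma> \<iota>" by (rule arch_matrixE[OF True])
  then show ?thesis using True assms by (auto simp: smooth_on_arch intro!: arch_matrix.Ck_det)
next
  case False
  have "\<forall>\<^sub>F y in at x. p (det y) = p (det x)" for x :: "'a^'n^'n"
  proof -
    have "\<forall>\<^sub>F y in nhds (det x). p y = p (det x)"
      using assms False by (auto simp: smooth_on_nonarch eventually_at_filter elim: eventually_mono)
    moreover have "filterlim det (nhds (det x)) (at x)"
    proof -
      have "continuous_on UNIV (\<lambda>g::'a^'n^'n. det g)" by (intro continuous_on_det continuous_on_id)
      then show ?thesis by (auto simp: continuous_on_def)
    qed
    ultimately show ?thesis by (rule eventually_compose_filterlim)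
  qed
  then show ?thesis using False by (simp add: smooth_on_nonarch)
qed


section \<open>Integration along the fibres of the determinant\<close>

text \<open>
  Left multiplication by the diagonal matrix with entry \<open>x\<close> in row \<open>i\<close>, which has determinant \<open>x\<close> and
  depends on \<open>x\<close> in an affine way.
\<close>

definition row_scale :: "'n \<Rightarrow> 'a::local_field \<Rightarrow> 'a^'n^'n \<Rightarrow> 'a^'n^'n" where
  "row_scale i x h = (\<chi> k l. (if k = i then x else 1) * h $ k $ l)"

lemma row_scale_as_product: "row_scale i x h = row_scale i x (mat 1) ** h"
proof -
  have "(\<Sum>m\<in>UNIV. (if k = i then x else 1) * mat 1 $ k $ m * h $ m $ l) = (if k = i then x else 1) * h $ k $ l"
    for k l
    by (simp add: mat_def if_distrib[where f="\<lambda>u. _ * u"] if_distrib[where f="\<lambda>u. u * _"] cong: if_cong)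
  then show ?thesis by (simp add: row_scale_def matrix_matrix_mult_def vec_eq_iff)
qed

lemma det_row_scale [simp]: "det (row_scale i x h) = x * det h"
proof -
  have "row_scale i x h = (\<chi> k. if k = i then x *s h $ k else h $ k)"
    by (simp add: row_scale_def vec_eq_iff)
  then show ?thesis by (simp add: det_row_mul)
qed

lemma row_scale_row_scale [simp]: "row_scale i x (row_scale i y h) = row_scale i (x * y) h"
  by (simp add: row_scale_def vec_eq_iff)

lemma row_scale_1 [simp]: "row_scale i 1 h = h"
  by (simp add: row_scale_def vec_eq_iff)

lemma continuous_on_row_scale:
  assumes "continuous_on S f" "continuous_on S g"
  shows "continuous_on S (\<lambda>p. row_scale i (f p) (g p))"
proof (rule continuous_on_matrixI)
  fix k l
  have "continuous_on S (\<lambda>p. g p $ k $ l)" by (intro continuous_intros assms)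
  then show "continuous_on S (\<lambda>p. row_scale i (f p) (g p) $ k $ l)"
    using assms by (cases "k = i") (auto simp: row_scale_def intro!: continuous_intros)
qed

lemma continuous_on_matrix_mult:
  "continuous_on S f \<Longrightarrow> continuous_on S g \<Longrightarrow> continuous_on S (\<lambda>x. f x ** g x :: 'a::local_field^'n^'n)"
  by (rule continuous_on_matrixI) (auto simp: matrix_matrix_mult_def intro!: continuous_intros)

lemma
  assumes "invertible (A :: 'a::semiring_1^'n^'n)"
  shows matrix_inv_right: "A ** matrix_inv A = mat 1"
    and matrix_inv_left: "matrix_inv A ** A = mat 1"
  using someI_ex[OF assms[unfolded invertible_def]] unfolding matrix_inv_def by blast+

lemma GL_det: "GL = {g :: 'a::local_field^'n^'n. det g \<noteq> 0}"
  by (auto simp: GL_def invertible_det_nz)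

lemma open_GL: "open (GL :: ('a::local_field^'n^'n) set)"
proof -
  have eq: "GL = (\<lambda>g::'a^'n^'n. det g) -` (- {0})" by (auto simp: GL_det)
  show ?thesis unfolding eq
    by (intro open_vimage open_Compl closed_singleton continuous_on_det continuous_on_id)
qed

lemma closed_SL: "closed (SL :: ('a::local_field^'n^'n) set)"
proof -
  have eq: "SL = (\<lambda>g::'a^'n^'n. det g) -` {1}" by (auto simp: SL_def)
  show ?thesis unfolding eq
    by (intro closed_vimage closed_singleton continuous_on_det continuous_on_id)
qed

locale haar_measure =
  fixes G :: "('a::local_field^'n^'n) set" and \<mu> :: "('a^'n^'n) measure"
  assumes haar: "haar_measure_on G \<mu>" and borel_G: "G \<in> sets borel"
begin

lemma sets_\<mu>: "sets \<mu> = sets (restrict_space borel G)"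
  using haar unfolding haar_measure_on_def by (rule conjunct1)

lemma space_\<mu>: "space \<mu> = G"
  using sets_eq_imp_space_eq[OF sets_\<mu>] by (simp add: space_restrict_space)

lemma compact_finite: "compact C \<Longrightarrow> C \<subseteq> G \<Longrightarrow> emeasure \<mu> C < \<infinity>"
  using haar unfolding haar_measure_on_def by simp

lemma open_positive: "open U \<Longrightarrow> U \<inter> G \<noteq> {} \<Longrightarrow> emeasure \<mu> (U \<inter> G) > 0"
  using haar unfolding haar_measure_on_def by simp

lemma left_invariant: "k \<in> G \<Longrightarrow> distr \<mu> \<mu> (\<lambda>h. k ** h) = \<mu>"
  using haar unfolding haar_measure_on_def by simp

lemma compact_sets: "compact C \<Longrightarrow> C \<subseteq> G \<Longrightarrow> C \<in> sets \<mu>"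
  unfolding sets_\<mu> sets_restrict_space_iff[of G borel, simplified, OF borel_G]
  by (auto intro: borel_compact)

lemma continuous_measurable:
  "continuous_on G (f :: _ \<Rightarrow> 'c::topological_space) \<Longrightarrow> f \<in> borel_measurable \<mu>"
  unfolding measurable_cong_sets[OF sets_\<mu> refl] by (rule borel_measurable_continuous_on_restrict)

lemma integrable_compact_support:
  fixes f :: "_ \<Rightarrow> complex"
  assumes "continuous_on G f" "compact C" "C \<subseteq> G" "\<And>g. g \<in> G \<Longrightarrow> g \<notin> C \<Longrightarrow> f g = 0"
  shows "integrable \<mu> f"
proof -
  have "compact (f ` C)" using assms by (intro compact_continuous_image) (auto intro: continuous_on_subset)
  then obtain B where B: "\<And>g. g \<in> C \<Longrightarrow> norm (f g) \<le> B"
    using compact_imp_bounded[of "f ` C"] unfolding bounded_iff by auto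
  show ?thesis
  proof (rule Bochner_Integration.integrable_bound)
    show "integrable \<mu> (\<lambda>g. B * indicator C g :: real)"
      using compact_sets compact_finite assms by (intro integrable_mult_right integrable_real_indicator) auto
    show "AE g in \<mu>. norm (f g) \<le> norm (B * indicator C g :: real)"
    proof (rule AE_I2)
      fix g assume "g \<in> space \<mu>"
      then show "norm (f g) \<le> norm (B * indicator C g :: real)"
        using B[of g] assms(4)[of g] by (cases "g \<in> C") (auto simp: space_\<mu>)
    qed
  qed (rule continuous_measurable[OF assms(1)])
qed

lemma dominated_compact_support:
  fixes f :: "nat \<Rightarrow> _ \<Rightarrow> complex"
  assumes "\<And>n. continuous_on G (f n)" "continuous_on G F" "compact C" "C \<subseteq> G"
    "\<And>n g. g \<in> G \<Longrightarrow> g \<notin> C \<Longrightarrow> f n g = 0" "\<And>n g. g \<in> C \<Longrightarrow> norm (f n g) \<le> B"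
    "\<And>g. g \<in> G \<Longrightarrow> (\<lambda>n. f n g) \<longlonglongrightarrow> F g"
  shows "(\<lambda>n. LINT g|\<mu>. f n g) \<longlonglongrightarrow> (LINT g|\<mu>. F g)"
proof (rule integral_dominated_convergence[where w="\<lambda>g. B * indicator C g"])
  show "integrable \<mu> (\<lambda>g. B * indicator C g :: real)"
    using compact_sets compact_finite assms by (intro integrable_mult_right integrable_real_indicator) auto
  show "AE g in \<mu>. (\<lambda>n. f n g) \<longlonglongrightarrow> F g"
    using assms(7) by (intro AE_I2) (simp add: space_\<mu>)
  show "AE g in \<mu>. norm (f n g) \<le> B * indicator C g" for n
  proof (rule AE_I2)
    fix g assume "g \<in> space \<mu>"
    then show "norm (f n g) \<le> B * indicator C g"
      using assms(5,6)[of g n] by (cases "g \<in> C") (auto simp: space_\<mu>)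
  qed
qed (intro continuous_measurable assms)+

lemma integral_pos:
  fixes f :: "_ \<Rightarrow> real"
  assumes "continuous_on G f" "integrable \<mu> f" "\<And>g. g \<in> G \<Longrightarrow> f g \<ge> 0" "g0 \<in> G" "f g0 > 0"
  shows "(LINT g|\<mu>. f g) > 0"
proof -
  obtain U where U: "open U" "U \<inter> G = f -` {0<..} \<inter> G"
    using continuous_on_open_invariant[THEN iffD1, OF assms(1), rule_format, OF open_greaterThan] by metis
  then have "emeasure \<mu> (U \<inter> G) > 0"
    using assms(4,5) by (intro open_positive) auto
  moreover have "U \<inter> G \<in> sets \<mu>"
    using U(1) borel_G by (auto simp: sets_\<mu> sets_restrict_space_iff)
  moreover have "{g \<in> space \<mu>. f g \<noteq> 0} = U \<inter> G"
    using U(2) assms(3) by (force simp: space_\<mu>)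
  ultimately have "\<not> (AE g in \<mu>. f g = 0)"
    using continuous_measurable[OF assms(1)] by (subst AE_iff_measurable[OF _ refl]) auto
  moreover have "AE g in \<mu>. 0 \<le> f g" using assms(3) by (intro AE_I2) (simp add: space_\<mu>)
  ultimately show ?thesis
    using integral_nonneg_eq_0_iff_AE[OF assms(2)] integral_nonneg_AE[of f \<mu>] by fastforce
qed

lemma integral_left_translate:
  fixes f :: "_ \<Rightarrow> complex"
  assumes "k \<in> G" "\<And>h. h \<in> G \<Longrightarrow> k ** h \<in> G" "continuous_on G f"
  shows "(LINT h|\<mu>. f (k ** h)) = (LINT h|\<mu>. f h)"
proof -
  have "(\<lambda>h. k ** h) \<in> measurable \<mu> \<mu>"
  proof -
    have "(\<lambda>h. k ** h) \<in> measurable \<mu> borel"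
      by (intro continuous_measurable continuous_on_matrix_mult continuous_intros)
    then have "(\<lambda>h. k ** h) \<in> measurable \<mu> (restrict_space borel G)"
      using assms(2) by (intro measurable_restrict_space2) (auto simp: space_\<mu>)
    then show ?thesis unfolding measurable_cong_sets[OF refl sets_\<mu>] .
  qed
  then have "(LINT h|distr \<mu> \<mu> (\<lambda>h. k ** h). f h) = (LINT h|\<mu>. f (k ** h))"
    by (intro integral_distr continuous_measurable assms)
  moreover have "distr \<mu> \<mu> (\<lambda>h. k ** h) = \<mu>" using assms(1) by (rule left_invariant)
  ultimately show ?thesis by simp
qed

end

locale haar_SL = haar_measure SL \<mu> for \<mu> :: "('a::local_field^'n^'n) measure"
begin

definition fibre_int :: "'n \<Rightarrow> ('a^'n^'n \<Rightarrow> complex) \<Rightarrow> 'a \<Rightarrow> complex" where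
  "fibre_int i F x = (LINT h|\<mu>. F (row_scale i x h))"

text \<open>
  The representative chosen in the definition of the fibre measure and the diagonal one differ by an
  element of \<open>SL\<close>, which left invariance absorbs.
\<close>

lemma integral_fibre_measure:
  assumes F: "continuous_on UNIV F" and x: "x \<noteq> 0"
  shows "(LINT g|fibre_measure \<mu> x. F g) = fibre_int i F x"
proof -
  define d where "d = row_scale i x (mat 1 :: 'a^'n^'n)"
  have d: "det d = x" by (simp add: d_def det_I)
  define s where "s = (SOME s :: 'a^'n^'n. det s = x)"
  have s: "det s = x" unfolding s_def using d by (rule someI)
  define k where "k = matrix_inv s ** d"
  have inv: "invertible s" using s x by (simp add: invertible_det_nz)
  have sk: "s ** k = d" unfolding k_def matrix_mul_assoc matrix_inv_right[OF inv] by simp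
  have "det s * det k = x" unfolding det_mul[symmetric] sk d ..
  then have k: "k \<in> SL" using s x by (simp add: SL_def)
  have "(LINT g|fibre_measure \<mu> x. F g) = (LINT h|\<mu>. F (s ** h))"
    unfolding fibre_measure_def s_def[symmetric]
    by (intro integral_distr continuous_measurable borel_measurable_continuous_onI F
        continuous_on_matrix_mult continuous_intros)
  also have "\<dots> = (LINT h|\<mu>. F (s ** (k ** h)))"
    using k by (intro integral_left_translate[symmetric] continuous_on_compose2[OF F]
        continuous_on_matrix_mult continuous_intros) (auto simp: SL_def det_mul)
  also have "\<dots> = fibre_int i F x"
    unfolding fibre_int_def matrix_mul_assoc sk d_def row_scale_as_product[symmetric] ..
  finally show ?thesis .
qed

text \<open>
  When \<open>x\<close> stays in a compact set of nonzero elements, the integrands over \<open>SL\<close> have a common compact support.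
\<close>

lemma common_support:
  fixes C :: "('a^'n^'n) set"
  assumes C: "compact C" and K: "compact K" "0 \<notin> K"
  obtains S where "compact S" "S \<subseteq> SL"
    "\<And>x h. x \<in> K \<Longrightarrow> h \<in> SL \<Longrightarrow> h \<notin> S \<Longrightarrow> row_scale i x h \<notin> C"
proof -
  let ?S = "(\<lambda>p. row_scale i (inverse (fst p)) (snd p)) ` (K \<times> C) \<inter> SL"
  show thesis
  proof (rule that[of ?S])
    have "continuous_on (K \<times> C) (\<lambda>p. row_scale i (inverse (fst p)) (snd p))"
      using K(2) by (intro continuous_on_row_scale continuous_on_inverse_field continuous_intros) auto
    then show "compact ?S"
      by (intro compact_Int_closed closed_SL compact_continuous_image compact_Times C K)
    fix x h assume x: "x \<in> K" and h: "h \<in> SL" "h \<notin> ?S"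
    have "x \<noteq> 0" using x K(2) by auto
    then have "h = row_scale i (inverse x) (row_scale i x h)" by simp
    then show "row_scale i x h \<notin> C" using x h by force
  qed simp
qed

lemma continuous_on_fibre_integrand:
  fixes F :: "'a^'n^'n \<Rightarrow> complex"
  shows "continuous_on UNIV F \<Longrightarrow> continuous_on S (\<lambda>h. F (row_scale i x h))"
  by (rule continuous_on_compose2[of UNIV F]) (auto intro!: continuous_on_row_scale continuous_intros)

lemma fibre_integrable:
  fixes F :: "'a^'n^'n \<Rightarrow> complex"
  assumes F: "continuous_on UNIV F" "compact C" "\<And>g. g \<notin> C \<Longrightarrow> F g = 0" and x: "x \<noteq> 0"
  shows "integrable \<mu> (\<lambda>h. F (row_scale i x h))"
proof -
  obtain S where S: "compact S" "S \<subseteq> SL"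
    "\<And>y h. y \<in> {x} \<Longrightarrow> h \<in> SL \<Longrightarrow> h \<notin> S \<Longrightarrow> row_scale i y h \<notin> C"
    by (rule common_support[OF F(2), where K="{x}"]) (use x in auto)
  show ?thesis
    by (rule integrable_compact_support[OF continuous_on_fibre_integrand[OF F(1)] S(1,2)])
       (use S(3) F(3) in auto)
qed

lemma compact_support_bound:
  assumes "continuous_on UNIV F" "compact C" "\<And>g. g \<notin> C \<Longrightarrow> F g = (0::complex)"
  obtains B where "B \<ge> 0" "\<And>g. norm (F g) \<le> B"
proof -
  have "compact (F ` C)" using assms by (intro compact_continuous_image) (auto intro: continuous_on_subset)
  then obtain B where B: "\<And>g. g \<in> C \<Longrightarrow> norm (F g) \<le> B"
    using compact_imp_bounded[of "F ` C"] unfolding bounded_iff by auto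
  have "norm (F g) \<le> max B 0" for g using B[of g] assms(3)[of g] by (cases "g \<in> C") auto
  then show thesis by (intro that[of "max B 0"]) auto
qed

lemma fibre_int_continuous:
  assumes F: "continuous_on UNIV F" "compact C" "\<And>g. g \<notin> C \<Longrightarrow> F g = 0"
  shows "continuous_on (UNIV - {0}) (fibre_int i F)"
  unfolding continuous_on_sequentially
proof (intro allI ballI impI, elim conjE)
  fix u and x :: 'a assume x: "x \<in> UNIV - {0}" and u: "\<forall>n. u n \<in> UNIV - {0}" "u \<longlonglongrightarrow> x"
  have K: "compact (insert x (range u))" using u(2) by (rule compact_sequence_with_limit)
  obtain S where S: "compact S" "S \<subseteq> SL"
    "\<And>y h. y \<in> insert x (range u) \<Longrightarrow> h \<in> SL \<Longrightarrow> h \<notin> S \<Longrightarrow> row_scale i y h \<notin> C"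
    by (rule common_support[OF F(2) K]) (use x u(1) in auto)
  obtain B where B: "\<And>g. norm (F g) \<le> B" using compact_support_bound[OF F] by blast
  show "(fibre_int i F \<circ> u) \<longlonglongrightarrow> fibre_int i F x"
    unfolding fibre_int_def o_def
  proof (rule dominated_compact_support[OF _ _ S(1,2), where B=B])
    show "(\<lambda>n. F (row_scale i (u n) h)) \<longlonglongrightarrow> F (row_scale i x h)" for h
    proof -
      have "continuous_on UNIV (\<lambda>y. F (row_scale i y h))"
        by (rule continuous_on_compose2[OF F(1)]) (auto intro!: continuous_on_row_scale continuous_intros)
      then show ?thesis using u(2) unfolding continuous_on_sequentially by (auto simp: o_def)
    qed
  qed (use S(3) F(3) B in \<open>auto intro: continuous_on_fibre_integrand[OF F(1)]\<close>)
qed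

text \<open>
  Suppose the integrands for \<open>u n \<longlonglongrightarrow> x\<close> and for \<open>x\<close> differ at \<open>h n\<close> for infinitely many \<open>n\<close>.  A subsequence
  of the \<open>h n\<close> converges, say to \<open>l\<close>, and both arguments of \<open>F\<close> converge to \<open>row_scale i x l\<close>, near
  which \<open>F\<close> is constant.
\<close>

lemma fibre_int_locally_constant:
  assumes C: "compact C" "\<And>g. g \<notin> C \<Longrightarrow> F g = 0"
    and lc: "\<And>g. \<forall>\<^sub>F g' in nhds g. F g' = F g" and x: "x \<noteq> 0"
  shows "\<forall>\<^sub>F y in at x within (UNIV - {0}). fibre_int i F y = fibre_int i F x"
proof (rule sequentially_imp_eventually_within, intro allI impI, elim conjE)
  fix u assume u: "\<forall>n. u n \<in> UNIV - {0} \<and> u n \<noteq> x" "u \<longlonglongrightarrow> x"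
  have K: "compact (insert x (range u))" using u(2) by (rule compact_sequence_with_limit)
  obtain S where S: "compact S" "S \<subseteq> SL"
    "\<And>y h. y \<in> insert x (range u) \<Longrightarrow> h \<in> SL \<Longrightarrow> h \<notin> S \<Longrightarrow> row_scale i y h \<notin> C"
    by (rule common_support[OF C(1) K]) (use x u(1) in auto)
  have "\<forall>\<^sub>F n in sequentially. \<forall>h\<in>SL. F (row_scale i (u n) h) = F (row_scale i x h)"
  proof (rule ccontr)
    assume "\<not> ?thesis"
    then have "\<exists>\<^sub>F n in sequentially. \<exists>h\<in>SL. F (row_scale i (u n) h) \<noteq> F (row_scale i x h)"
      by (simp add: not_eventually)
    then obtain r :: "nat \<Rightarrow> nat" where r: "strict_mono r"
      "\<And>n. \<exists>h\<in>SL. F (row_scale i (u (r n)) h) \<noteq> F (row_scale i x h)"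
      using infinite_enumerate[of "{n. \<exists>h\<in>SL. F (row_scale i (u n) h) \<noteq> F (row_scale i x h)}"]
      by (auto simp: frequently_cofinite[symmetric] cofinite_eq_sequentially)
    then obtain h where h: "\<And>n. h n \<in> SL" "\<And>n. F (row_scale i (u (r n)) (h n)) \<noteq> F (row_scale i x (h n))"
      by metis
    have "h n \<in> S" for n
      using h[of n] C(2)[of "row_scale i (u (r n)) (h n)"] C(2)[of "row_scale i x (h n)"]
        S(3)[of "u (r n)" "h n"] S(3)[of x "h n"] by fastforce
    then obtain l q where q: "strict_mono (q :: nat \<Rightarrow> nat)" "(h \<circ> q) \<longlonglongrightarrow> l"
      using S(1) unfolding compact_eq_seq_compact_metric seq_compact_def by metis
    have uq: "(u \<circ> (r \<circ> q)) \<longlonglongrightarrow> x"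
      by (intro LIMSEQ_subseq_LIMSEQ u strict_mono_o r q)
    have "(\<lambda>n. row_scale i (u (r (q n))) (h (q n))) \<longlonglongrightarrow> row_scale i x l"
    proof -
      have "continuous_on UNIV (\<lambda>p. row_scale i (fst p) (snd p))"
        by (intro continuous_on_row_scale continuous_intros)
      moreover have "(\<lambda>n. (u (r (q n)), h (q n))) \<longlonglongrightarrow> (x, l)"
        using uq q(2) by (intro tendsto_Pair) (auto simp: o_def)
      ultimately have "(\<lambda>n. row_scale i (fst (u (r (q n)), h (q n))) (snd (u (r (q n)), h (q n))))
          \<longlonglongrightarrow> row_scale i (fst (x, l)) (snd (x, l))"
        by (rule continuous_on_tendsto_compose) auto
      then show ?thesis by simp
    qed
    moreover have "(\<lambda>n. row_scale i x (h (q n))) \<longlonglongrightarrow> row_scale i x l"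
    proof -
      have "continuous_on UNIV (\<lambda>p. row_scale i x p)"
        by (intro continuous_on_row_scale continuous_intros)
      then show ?thesis using q(2) unfolding continuous_on_sequentially by (auto simp: o_def)
    qed
    ultimately have "\<forall>\<^sub>F n in sequentially. F (row_scale i (u (r (q n))) (h (q n))) = F (row_scale i x l)"
      "\<forall>\<^sub>F n in sequentially. F (row_scale i x (h (q n))) = F (row_scale i x l)"
      using lc[of "row_scale i x l"] by (auto elim: eventually_compose_filterlim)
    then have "\<forall>\<^sub>F n in sequentially. False"
      by eventually_elim (use h(2) in metis)
    then show False by simp
  qed
  then show "\<forall>\<^sub>F n in sequentially. fibre_int i F (u n) = fibre_int i F x"
  proof eventually_elim
    case (elim n)
    then show ?case unfolding fibre_int_def by (intro Bochner_Integration.integral_cong) (auto simp: space_\<mu>)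
  qed
qed

end


section \<open>Fibre integrals of smooth functions are smooth\<close>

context arch_matrix
begin

text \<open>
  If \<open>D A\<close> is the derivative along \<open>A\<close>, this is the derivative along the matrix whose row \<open>i\<close> has the
  entries with complex coordinates \<open>a\<close> and whose other rows vanish, expanded in elementary directions.
\<close>

definition row_deriv ::
  "'n \<Rightarrow> ('a^'n^'n \<Rightarrow> 'a^'n^'n \<Rightarrow> complex) \<Rightarrow> ('n \<Rightarrow> complex) \<Rightarrow> 'a^'n^'n \<Rightarrow> complex" where
  "row_deriv i D a g = (\<Sum>j\<in>UNIV. of_real (Re (a j)) * D (mat_unit i j 1) g)
     + (\<Sum>j\<in>UNIV. of_real (Im (a j)) * D (mat_unit i j \<iota>) g)"

lemma has_dd_row:
  assumes "\<And>A g. M.has_dd F (D A g) g A" "\<And>A. continuous_on UNIV (D A)"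
  shows "M.has_dd F (row_deriv i D (\<lambda>j. \<sigma> (a j)) g) g (\<Sum>j\<in>UNIV. mat_unit i j (a j))"
proof -
  have "M.has_dd F (row_deriv i D (\<lambda>j. \<sigma> (a j)) g) g
    ((\<Sum>j\<in>UNIV. mat_scale (real_emb (Re (\<sigma> (a j)))) (mat_unit i j 1))
     + (\<Sum>j\<in>UNIV. mat_scale (real_emb (Im (\<sigma> (a j)))) (mat_unit i j \<iota>)))"
    unfolding row_deriv_def
    by (rule M.has_dd_add[OF open_UNIV UNIV_I, where f'="\<lambda>g. \<Sum>j\<in>UNIV. of_real (Im (\<sigma> (a j))) * D (mat_unit i j \<iota>) g"])
       (intro M.has_dd_sum[OF open_UNIV UNIV_I finite] assms continuous_intros)+
  moreover have "(\<Sum>j\<in>UNIV. mat_scale (real_emb (Re (\<sigma> (a j)))) (mat_unit i j 1))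
     + (\<Sum>j\<in>UNIV. mat_scale (real_emb (Im (\<sigma> (a j)))) (mat_unit i j \<iota>)) = (\<Sum>j\<in>UNIV. mat_unit i j (a j))"
    unfolding sum.distrib[symmetric]
  proof (intro sum.cong refl)
    fix j
    have "mat_scale (real_emb (Re (\<sigma> (a j)))) (mat_unit i j 1)
        + mat_scale (real_emb (Im (\<sigma> (a j)))) (mat_unit i j \<iota>)
        = mat_unit i j (real_emb (Re (\<sigma> (a j))) + real_emb (Im (\<sigma> (a j))) * \<iota>)"
      by (auto simp: mat_unit_def mat_scale_def vec_eq_iff)
    also have "\<dots> = mat_unit i j (a j)" by (rule arg_cong[OF \<sigma>_coord[symmetric]])
    finally show "mat_scale (real_emb (Re (\<sigma> (a j)))) (mat_unit i j 1)
        + mat_scale (real_emb (Im (\<sigma> (a j)))) (mat_unit i j \<iota>) = mat_unit i j (a j)" .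
  qed
  ultimately show ?thesis by simp
qed

lemma row_deriv_linear:
  "row_deriv i D (\<lambda>j. of_real r * a j + of_real s * b j) g
     = of_real r * row_deriv i D a g + of_real s * row_deriv i D b g"
  by (simp add: row_deriv_def algebra_simps sum.distrib sum_distrib_left)

lemma Ck_row_deriv:
  assumes "\<And>A. M.Ck k UNIV (D A)"
  shows "M.Ck k UNIV (\<lambda>g. row_deriv i D (\<lambda>j. c * \<sigma> (g $ i $ j)) g)"
  unfolding row_deriv_def
  by (intro M.Ck_add M.Ck_sum M.Ck_mult finite assms M.Ck_const Ck_entry
      M.Ck_linear[of "\<lambda>z. complex_of_real (Re z)"] M.Ck_linear[of "\<lambda>z. complex_of_real (Im z)"]
      bounded_linear_compose[OF bounded_linear_of_real] bounded_linear_Re bounded_linear_Im)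

lemma row_scale_line:
  "row_scale i (F.line x v t) h = M.line (row_scale i x h) (\<Sum>j\<in>UNIV. mat_unit i j (v * h $ i $ j)) t"
proof -
  have "(\<Sum>j\<in>UNIV. mat_unit i j (v * h $ i $ j)) $ k $ l = (if k = i then v * h $ i $ l else 0)" for k l
    by (simp add: mat_unit_def sum_component cong: if_cong)
  then show ?thesis
    by (auto simp: vec_eq_iff row_scale_def M.line_def F.line_def mat_scale_def algebra_simps)
qed

text \<open>
  The derivative of \<open>x \<mapsto> F (row_scale i x h)\<close> at \<open>x\<close> along \<open>v\<close> is that of \<open>F\<close> at \<open>g\<close> along the
  matrix whose only nonzero row is \<open>v / x\<close> times row \<open>i\<close> of \<open>g\<close>, for \<open>g = row_scale i x h\<close>.  Expressed
  by \<open>g\<close> alone, it is a combination of two functions of \<open>g\<close>, with coefficients depending on \<open>x\<close>.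
\<close>

lemma has_dd_row_scale:
  fixes F :: "'a^'n^'n \<Rightarrow> complex" and i :: 'n and D
  assumes D: "\<And>A g. M.has_dd F (D A g) g A" "\<And>A. continuous_on UNIV (D A)" and x: "x \<noteq> 0"
  defines "F1 \<equiv> \<lambda>g. row_deriv i D (\<lambda>j. 1 * \<sigma> (g $ i $ j)) g"
    and "F2 \<equiv> \<lambda>g. row_deriv i D (\<lambda>j. \<sigma> \<iota> * \<sigma> (g $ i $ j)) g"
  shows "F.has_dd (\<lambda>x. F (row_scale i x h))
    (of_real (Re (\<sigma> (v / x))) * F1 (row_scale i x h) + of_real (Im (\<sigma> (v / x))) * F2 (row_scale i x h)) x v"
proof -
  let ?g = "row_scale i x h"
  have "\<sigma> (v * h $ i $ j) = of_real (Re (\<sigma> (v / x))) * (1 * \<sigma> (?g $ i $ j))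
      + of_real (Im (\<sigma> (v / x))) * (\<sigma> \<iota> * \<sigma> (?g $ i $ j))" for j
  proof -
    have "v * h $ i $ j = (v / x) * ?g $ i $ j" using x by (simp add: row_scale_def)
    also have "\<dots> = (real_emb (Re (\<sigma> (v / x))) + real_emb (Im (\<sigma> (v / x))) * \<iota>) * ?g $ i $ j"
      using \<sigma>_coord[of "v / x"] by simp
    finally show ?thesis by (simp add: \<sigma>_mult \<sigma>_add \<sigma>_emb algebra_simps)
  qed
  then have "row_deriv i D (\<lambda>j. \<sigma> (v * h $ i $ j)) ?g
      = of_real (Re (\<sigma> (v / x))) * F1 ?g + of_real (Im (\<sigma> (v / x))) * F2 ?g"
    unfolding F1_def F2_def row_deriv_linear[symmetric] by presburger
  moreover have "M.has_dd F (row_deriv i D (\<lambda>j. \<sigma> (v * h $ i $ j)) ?g) ?g (\<Sum>j\<in>UNIV. mat_unit i j (v * h $ i $ j))"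
    by (rule has_dd_row[OF D])
  ultimately show ?thesis unfolding F.has_dd_def M.has_dd_def row_scale_line by simp
qed

end

locale arch_SL = arch_matrix \<sigma> \<iota> n + haar_SL \<mu>
  for \<sigma> :: "'a::local_field \<Rightarrow> complex" and \<iota> and n :: "'n::finite itself" and \<mu> :: "('a^'n^'n) measure"
begin

text \<open>
  By the mean value inequality the difference quotients of the integrand are bounded on the common
  support, so that dominated convergence allows differentiation under the integral sign.
\<close>

lemma has_dd_fibre_int:
  fixes F :: "'a^'n^'n \<Rightarrow> complex"
  assumes F: "continuous_on UNIV F" "compact C" "\<And>g. g \<notin> C \<Longrightarrow> F g = 0"
    and F1: "continuous_on UNIV F1" "\<And>g. g \<notin> C \<Longrightarrow> F1 g = 0"
    and F2: "continuous_on UNIV F2" "\<And>g. g \<notin> C \<Longrightarrow> F2 g = 0"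
    and dd: "\<And>x h. x \<noteq> 0 \<Longrightarrow> F.has_dd (\<lambda>x. F (row_scale i x h))
      (of_real (Re (\<sigma> (v / x))) * F1 (row_scale i x h) + of_real (Im (\<sigma> (v / x))) * F2 (row_scale i x h)) x v"
    and x: "x \<noteq> 0"
  shows "F.has_dd (fibre_int i F)
    (of_real (Re (\<sigma> (v / x))) * fibre_int i F1 x + of_real (Im (\<sigma> (v / x))) * fibre_int i F2 x) x v"
    (is "F.has_dd _ ?d x v")
proof -
  obtain \<delta> where \<delta>: "\<delta> > 0" "\<And>t. \<bar>t\<bar> \<le> \<delta> \<Longrightarrow> F.line x v t \<noteq> 0"
  proof -
    have "\<forall>\<^sub>F t in nhds 0. F.line x v t \<in> - {0}" using x by (intro F.eventually_line) auto
    then obtain d where "d > 0" "\<And>t. dist t 0 < d \<Longrightarrow> F.line x v t \<noteq> 0"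
      unfolding eventually_nhds_metric by auto
    then show thesis by (intro that[of "d / 2"]) (auto simp: dist_real_def)
  qed
  let ?T = "{-\<delta>..\<delta>}"
  let ?K = "F.line x v ` ?T"
  have line_cont: "continuous_on S (F.line x v)" for S
    by (intro F.continuous_line continuous_intros)
  have K: "compact ?K" "0 \<notin> ?K"
    using \<delta> by (auto intro!: compact_continuous_image line_cont simp: abs_le_iff)
  obtain S where S: "compact S" "S \<subseteq> SL"
    "\<And>y h. y \<in> ?K \<Longrightarrow> h \<in> SL \<Longrightarrow> h \<notin> S \<Longrightarrow> row_scale i y h \<notin> C"
    by (rule common_support[OF F(2) K, where i=i]) blast
  obtain B1 where B1: "B1 \<ge> 0" "\<And>g. norm (F1 g) \<le> B1" using compact_support_bound[OF F1(1) F(2) F1(2)] by blast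
  obtain B2 where B2: "B2 \<ge> 0" "\<And>g. norm (F2 g) \<le> B2" using compact_support_bound[OF F2(1) F(2) F2(2)] by blast
  have "continuous_on ?K (\<lambda>y. \<sigma> (v / y))"
    using K(2) by (intro continuous_on_compose2[OF \<sigma>_continuous] continuous_on_divide_field continuous_intros) auto
  then have "compact ((\<lambda>y. \<sigma> (v / y)) ` ?K)" using K(1) by (rule compact_continuous_image)
  then have "bounded ((\<lambda>y. \<sigma> (v / y)) ` ?K)" by (rule compact_imp_bounded)
  then obtain R where "\<forall>z\<in>(\<lambda>y. \<sigma> (v / y)) ` ?K. norm z \<le> R" unfolding bounded_iff ..
  then have R: "norm (\<sigma> (v / y)) \<le> R" if "y \<in> ?K" for y using that by blast
  define B where "B = R * B1 + R * B2"
  let ?d' = "\<lambda>y h. of_real (Re (\<sigma> (v / y))) * F1 (row_scale i y h) + of_real (Im (\<sigma> (v / y))) * F2 (row_scale i y h)"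
  have d'_bound: "norm (?d' y h) \<le> B" if "y \<in> ?K" for y h
  proof -
    have R0: "R \<ge> 0" using R[OF that] norm_ge_zero[of "\<sigma> (v / y)"] by linarith
    have "norm (of_real (Re (\<sigma> (v / y))) * F1 (row_scale i y h)) \<le> R * B1"
      unfolding norm_mult norm_of_real
      using R[OF that] abs_Re_le_cmod[of "\<sigma> (v / y)"] R0 by (intro mult_mono B1) auto
    moreover have "norm (of_real (Im (\<sigma> (v / y))) * F2 (row_scale i y h)) \<le> R * B2"
      unfolding norm_mult norm_of_real
      using R[OF that] abs_Im_le_cmod[of "\<sigma> (v / y)"] R0 by (intro mult_mono B2) auto
    ultimately show ?thesis unfolding B_def by (intro norm_triangle_le add_mono)
  qed
  have bound: "norm (F (row_scale i (F.line x v t) h) - F (row_scale i x h)) \<le> B * \<bar>t\<bar>" if t: "t \<in> ?T" for t h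
  proof -
    have "norm (F (row_scale i (F.line x v t) h) - F (row_scale i (F.line x v 0) h)) \<le> B * norm (t - 0)"
    proof (rule differentiable_bound[where S="?T"])
      fix r assume r: "r \<in> ?T"
      then have "F.line x v r \<noteq> 0" using \<delta>(2)[of r] by (auto simp: abs_le_iff)
      then have "((\<lambda>t. F (row_scale i (F.line x v t) h)) has_vector_derivative ?d' (F.line x v r) h) (at r)"
        by (intro F.has_dd_at dd)
      then show "((\<lambda>t. F (row_scale i (F.line x v t) h)) has_derivative (\<lambda>s. s *\<^sub>R ?d' (F.line x v r) h)) (at r within ?T)"
        unfolding has_vector_derivative_def by (rule has_derivative_at_withinI)
      show "onorm (\<lambda>s. s *\<^sub>R ?d' (F.line x v r) h) \<le> B"
      proof (rule onorm_le)
        fix s :: real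
        have "F.line x v r \<in> ?K" using r by blast
        from mult_left_mono[OF d'_bound[OF this, of h] abs_ge_zero[of s]]
        show "norm (s *\<^sub>R ?d' (F.line x v r) h) \<le> B * norm s" by (simp add: mult.commute[of B])
      qed
    qed (use t \<delta>(1) in auto)
    then show ?thesis by simp
  qed
  have integrable: "integrable \<mu> (\<lambda>h. F (row_scale i (F.line x v t) h))" if "t \<in> ?T" for t
    using that \<delta>(2)[of t] by (intro fibre_integrable[OF F]) (auto simp: abs_le_iff)
  have int_d: "(LINT h|\<mu>. ?d' x h) = ?d"
    unfolding fibre_int_def
    using fibre_integrable[OF F1(1) F(2) F1(2) x] fibre_integrable[OF F2(1) F(2) F2(2) x] by simp
  have "((\<lambda>t. complex_of_real (1 / t) * (fibre_int i F (F.line x v t) - fibre_int i F x)) \<longlongrightarrow> ?d) (at 0 within ?T)"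
    unfolding tendsto_at_iff_sequentially
  proof (intro allI impI)
    fix u :: "nat \<Rightarrow> real" assume u: "\<forall>n. u n \<in> ?T - {0}" "u \<longlonglongrightarrow> 0"
    let ?\<Phi> = "\<lambda>n h. complex_of_real (1 / u n) * (F (row_scale i (F.line x v (u n)) h) - F (row_scale i x h))"
    have "(\<lambda>n. LINT h|\<mu>. ?\<Phi> n h) \<longlonglongrightarrow> (LINT h|\<mu>. ?d' x h)"
    proof (rule dominated_compact_support[OF _ _ S(1,2), where B=B])
      show "continuous_on SL (?\<Phi> n)" for n
        by (intro continuous_intros continuous_on_fibre_integrand F)
      show "continuous_on SL (?d' x)"
        by (intro continuous_intros continuous_on_fibre_integrand F1 F2)
      show "?\<Phi> n h = 0" if h: "h \<in> SL" "h \<notin> S" for n h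
      proof -
        have "F.line x v 0 \<in> ?K" "F.line x v (u n) \<in> ?K" using u(1) \<delta>(1) by (auto simp del: F.line_0)
        then show ?thesis using S(3)[OF _ h] F(3) by simp
      qed
      show "norm (?\<Phi> n h) \<le> B" for n h
        using bound[of "u n" h] u(1) by (auto simp: norm_mult norm_divide divide_le_eq)
      show "(\<lambda>n. ?\<Phi> n h) \<longlonglongrightarrow> ?d' x h" for h
      proof -
        have "((\<lambda>t. complex_of_real (1 / t) * (F (row_scale i (F.line x v t) h) - F (row_scale i x h))) \<longlongrightarrow> ?d' x h) (at 0)"
          using dd[OF x, of h] unfolding F.has_dd_iff_limit F.line_def .
        then show ?thesis using u unfolding tendsto_at_iff_sequentially by (auto simp: o_def)
      qed
    qed
    moreover have "(LINT h|\<mu>. ?\<Phi> n h) = complex_of_real (1 / u n) * (fibre_int i F (F.line x v (u n)) - fibre_int i F x)" for n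
      unfolding fibre_int_def
      using integrable[of "u n"] integrable[of 0] u(1) \<delta>(1) by simp
    ultimately show "((\<lambda>t. complex_of_real (1 / t) * (fibre_int i F (F.line x v t) - fibre_int i F x)) \<circ> u) \<longlonglongrightarrow> ?d"
      unfolding int_d o_def by (simp only:)
  qed
  moreover have "at 0 within ?T = at (0::real)" using \<delta>(1) by (intro at_within_interior) auto
  ultimately show ?thesis unfolding F.has_dd_iff_limit F.line_def by simp
qed

text \<open>
  The derivative of a fibre integral is a combination, with smooth coefficients, of fibre integrals of
  two functions with one derivative less and the same support; hence induction on \<open>k\<close>.
\<close>

lemma Ck_fibre_int:
  fixes F :: "'a^'n^'n \<Rightarrow> complex"
  assumes "compact C" "\<And>g. g \<notin> C \<Longrightarrow> F g = 0"
  shows "M.Ck k UNIV F \<Longrightarrow> F.Ck k (UNIV - {0}) (fibre_int i F)"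
  using assms(2)
proof (induct k arbitrary: F)
  case 0
  then show ?case unfolding F.Ck_0 M.Ck_0 by (intro fibre_int_continuous[OF _ assms(1)])
next
  case (Suc k)
  note F = M.Ck_continuous[OF Suc.prems(1)]
  obtain D where D: "\<And>A g. M.has_dd F (D A g) g A" "\<And>A. M.Ck k UNIV (D A)"
    using M.Ck_SucE[OF Suc.prems(1)] by (metis UNIV_I)
  note Dc = M.Ck_continuous[OF D(2)]
  have D0: "D A g = 0" if "g \<notin> C" for A g
  proof -
    have "M.has_dd F 0 g A"
      by (rule M.has_dd_cong[of "- C" g "\<lambda>_. 0"])
         (use that assms(1) Suc.prems(2) in
           \<open>auto simp: M.has_dd_def has_vector_derivative_const compact_imp_closed open_Compl\<close>)
    then show ?thesis using M.has_dd_unique D(1) by blast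
  qed
  define F1 where "F1 = (\<lambda>g. row_deriv i D (\<lambda>j. 1 * \<sigma> (g $ i $ j)) g)"
  define F2 where "F2 = (\<lambda>g. row_deriv i D (\<lambda>j. \<sigma> \<iota> * \<sigma> (g $ i $ j)) g)"
  have 1: "M.Ck k UNIV F1" "\<And>g. g \<notin> C \<Longrightarrow> F1 g = 0"
    unfolding F1_def by (intro Ck_row_deriv D) (simp add: row_deriv_def D0)
  have 2: "M.Ck k UNIV F2" "\<And>g. g \<notin> C \<Longrightarrow> F2 g = 0"
    unfolding F2_def by (intro Ck_row_deriv D) (simp add: row_deriv_def D0)
  show ?case
  proof (rule F.Ck_SucI)
    show "continuous_on (UNIV - {0}) (fibre_int i F)"
      by (rule fibre_int_continuous[OF F assms(1) Suc.prems(2)])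
    show "F.has_dd (fibre_int i F)
        (of_real (Re (\<sigma> (v / x))) * fibre_int i F1 x + of_real (Im (\<sigma> (v / x))) * fibre_int i F2 x) x v"
      if "x \<in> UNIV - {0}" for v x
    proof (rule has_dd_fibre_int[OF F assms(1) Suc.prems(2) M.Ck_continuous[OF 1(1)] 1(2) M.Ck_continuous[OF 2(1)] 2(2)])
      show "F.has_dd (\<lambda>x. F (row_scale i x h)) (of_real (Re (\<sigma> (v / x))) * F1 (row_scale i x h)
          + of_real (Im (\<sigma> (v / x))) * F2 (row_scale i x h)) x v" if "x \<noteq> 0" for x h
        unfolding F1_def F2_def by (rule has_dd_row_scale[OF D(1) Dc that])
    qed (use that in auto)
    fix v
    have "F.Ck k (UNIV - {0}) (\<lambda>x. \<sigma> v * inverse (\<sigma> x))"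
      by (intro F.Ck_mult F.Ck_const F.Ck_inverse F.Ck_subset[OF Ck_\<sigma>]) (auto simp: \<sigma>_eq_0)
    moreover have "\<sigma> v * inverse (\<sigma> x) = \<sigma> (v / x)" for x
      by (simp add: divide_inverse \<sigma>_mult \<sigma>_inverse)
    ultimately have q: "F.Ck k (UNIV - {0}) (\<lambda>x. \<sigma> (v / x))" by simp
    show "F.Ck k (UNIV - {0}) (\<lambda>x. of_real (Re (\<sigma> (v / x))) * fibre_int i F1 x
        + of_real (Im (\<sigma> (v / x))) * fibre_int i F2 x)"
      by (intro F.Ck_add F.Ck_mult Suc.hyps 1 2 q
          F.Ck_linear[of "\<lambda>z. complex_of_real (Re z)"] F.Ck_linear[of "\<lambda>z. complex_of_real (Im z)"]
          bounded_linear_compose[OF bounded_linear_of_real] bounded_linear_Re bounded_linear_Im)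
  qed
qed

end

context haar_SL
begin

lemma fibre_int_smooth:
  fixes F :: "'a^'n^'n \<Rightarrow> complex"
  assumes F: "F \<in> Cc_smooth mat_scale GL"
  shows "fibre_int i F \<in> Cc_smooth (*) (UNIV - {0})"
proof -
  have sm: "smooth_on mat_scale UNIV F" and "\<exists>C. compact C \<and> C \<subseteq> GL \<and> (\<forall>g. g \<notin> C \<longrightarrow> F g = 0)"
    using F domain_of_smoothness.Cc_smooth_iff[OF matrix_domain open_GL] by blast+
  then obtain C where C: "compact C" "C \<subseteq> GL" "\<And>g. g \<notin> C \<Longrightarrow> F g = 0" by blast
  have "smooth_on (*) (UNIV - {0}) (fibre_int i F)"
  proof (cases "archimedean TYPE('a)")
    case True
    obtain \<sigma> :: "'a \<Rightarrow> complex" and \<iota> where "arch_matrix \<sigma> \<iota>" by (rule arch_matrixE[OF True])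
    then interpret arch_SL \<sigma> \<iota> "TYPE('n)" \<mu>
      by (intro arch_SL.intro haar_SL_axioms) 
    show ?thesis using sm True Ck_fibre_int[OF C(1,3)] by (auto simp: smooth_on_arch)
  next
    case False
    have "\<forall>\<^sub>F g' in nhds g. F g' = F g" for g
      using sm False by (auto simp: smooth_on_nonarch eventually_at_filter elim: eventually_mono)
    then show ?thesis
      using False by (auto simp: smooth_on_nonarch intro!: fibre_int_locally_constant[OF C(1,3)])
  qed
  moreover have "fibre_int i F x = 0" if "x \<notin> det ` C" for x
  proof -
    have "F (row_scale i x h) = 0" if "h \<in> SL" for h
      using that \<open>x \<notin> det ` C\<close> by (intro C(3)) (auto simp: SL_def image_iff)
    then show ?thesis
      unfolding fibre_int_def by (subst Bochner_Integration.integral_cong[where g="\<lambda>_. 0"]) (auto simp: space_\<mu>)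
  qed
  moreover have "compact (det ` C)" "det ` C \<subseteq> UNIV - {0}"
    using C(1,2) by (auto intro!: compact_continuous_image continuous_on_det continuous_on_id simp: GL_det)
  ultimately show ?thesis unfolding Cc_smooth_def by blast
qed

end


section \<open>Continuous functionals on a seminormed space\<close>

definition sublinear :: "(complex \<Rightarrow> 'v \<Rightarrow> 'v) \<Rightarrow> ('v::ab_group_add \<Rightarrow> real) \<Rightarrow> bool" where
  "sublinear sc q \<longleftrightarrow> (\<forall>v w. q (v + w) \<le> q v + q w) \<and> (\<forall>t v. t \<ge> 0 \<longrightarrow> q (sc (of_real t) v) \<le> t * q v)"

locale complex_space = vector_space sc for sc :: "complex \<Rightarrow> 'v::ab_group_add \<Rightarrow> 'v"
begin

lemma sublinear_0: "sublinear sc q \<Longrightarrow> q 0 = 0"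
proof -
  assume q: "sublinear sc q"
  then have "q (0 + 0) \<le> q 0 + q 0" unfolding sublinear_def by blast
  moreover have "q (sc (of_real 0) 0) \<le> 0 * q 0" using q unfolding sublinear_def by blast
  ultimately show ?thesis by simp
qed

lemma sublinear_scale:
  assumes q: "sublinear sc q" and t: "t \<ge> 0"
  shows "q (sc (of_real t) v) = t * q v"
proof (cases "t = 0")
  case True
  then show ?thesis using sublinear_0[OF q] by simp
next
  case False
  have "q (sc (of_real (1 / t)) (sc (of_real t) v)) \<le> 1 / t * q (sc (of_real t) v)"
    using q t unfolding sublinear_def by (meson divide_nonneg_nonneg zero_le_one)
  moreover have "sc (of_real (1 / t)) (sc (of_real t) v) = v"
    using False by (simp flip: of_real_mult)
  ultimately have "t * q v \<le> q (sc (of_real t) v)" using t False by (simp add: field_simps)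
  moreover have "q (sc (of_real t) v) \<le> t * q v" using q t unfolding sublinear_def by blast
  ultimately show ?thesis by simp
qed

lemma sublinear_minus: "sublinear sc q \<Longrightarrow> - q (- v) \<le> q v"
  using sublinear_0[of q] unfolding sublinear_def by (metis add.right_inverse add.commute minus_le_iff le_minus_iff diff_0 diff_le_eq)

text \<open>
  Among the sublinear functionals \<open>q' \<le> q\<close> with \<open>q' (- w) \<le> - q w\<close>, that is, linear on the line of
  \<open>w\<close> with the value \<open>q w\<close> at \<open>w\<close>, this is the largest.
\<close>

definition straighten :: "('v \<Rightarrow> real) \<Rightarrow> 'v \<Rightarrow> 'v \<Rightarrow> real" where
  "straighten q w v = (INF t\<in>{0..}. q (v + sc (of_real t) w) - t * q w)"

lemma straighten_bdd:
  assumes q: "sublinear sc q"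
  shows "bdd_below ((\<lambda>t. q (v + sc (of_real t) w) - t * q w) ` {0..})"
proof (rule bdd_belowI2)
  fix t :: real assume t: "t \<in> {0..}"
  have "q ((v + sc (of_real t) w) + - v) \<le> q (v + sc (of_real t) w) + q (- v)"
    using q unfolding sublinear_def by blast
  then show "- q (- v) \<le> q (v + sc (of_real t) w) - t * q w"
    using t sublinear_scale[OF q, of t w] by simp
qed

lemma straighten_le:
  assumes q: "sublinear sc q" and t: "t \<ge> 0"
  shows "straighten q w v \<le> q (v + sc (of_real t) w) - t * q w"
  unfolding straighten_def using t by (intro cINF_lower straighten_bdd q) auto

lemma straighten_greatest:
  assumes "\<And>t. t \<ge> 0 \<Longrightarrow> c \<le> q (v + sc (of_real t) w) - t * q w"
  shows "c \<le> straighten q w v"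
  unfolding straighten_def by (rule cINF_greatest) (use assms in auto)

lemma straighten_below: "sublinear sc q \<Longrightarrow> straighten q w v \<le> q v"
  using straighten_le[of q 0 w v] by simp

lemma straighten_neg: "sublinear sc q \<Longrightarrow> straighten q w (- w) \<le> - q w"
  using straighten_le[of q 1 w "- w"] sublinear_0[of q] by simp

lemma straighten_sublinear:
  assumes q: "sublinear sc q"
  shows "sublinear sc (straighten q w)"
  unfolding sublinear_def
proof (intro conjI allI impI)
  fix v v'
  have "straighten q w (v + v') - (q (v + sc (of_real t) w) - t * q w) \<le> q (v' + sc (of_real s) w) - s * q w"
    if "t \<ge> 0" "s \<ge> 0" for t s
  proof -
    have "straighten q w (v + v') \<le> q ((v + v') + sc (of_real (t + s)) w) - (t + s) * q w"
      using that by (intro straighten_le q) simp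
    moreover have "(v + v') + sc (of_real (t + s)) w = (v + sc (of_real t) w) + (v' + sc (of_real s) w)"
      by (simp add: scale_left_distrib)
    moreover have "q ((v + sc (of_real t) w) + (v' + sc (of_real s) w)) \<le> q (v + sc (of_real t) w) + q (v' + sc (of_real s) w)"
      using q unfolding sublinear_def by blast
    ultimately show ?thesis by (simp add: algebra_simps)
  qed
  then have "straighten q w (v + v') - (q (v + sc (of_real t) w) - t * q w) \<le> straighten q w v'" if "t \<ge> 0" for t
    using that by (intro straighten_greatest) auto
  then have "straighten q w (v + v') - straighten q w v' \<le> straighten q w v"
    by (intro straighten_greatest) (simp add: algebra_simps)
  then show "straighten q w (v + v') \<le> straighten q w v + straighten q w v'" by simp
next
  fix s :: real and v assume s: "s \<ge> 0"
  show "straighten q w (sc (of_real s) v) \<le> s * straighten q w v"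
  proof (cases "s = 0")
    case True
    then show ?thesis using straighten_below[OF q, of w 0] sublinear_0[OF q] by simp
  next
    case False
    have "straighten q w (sc (of_real s) v) / s \<le> q (v + sc (of_real t) w) - t * q w" if t: "t \<ge> 0" for t
    proof -
      have "straighten q w (sc (of_real s) v) \<le> q (sc (of_real s) v + sc (of_real (s * t)) w) - (s * t) * q w"
        using s t by (intro straighten_le q) simp
      also have "sc (of_real s) v + sc (of_real (s * t)) w = sc (of_real s) (v + sc (of_real t) w)"
        by (simp add: scale_right_distrib)
      also have "q \<dots> = s * q (v + sc (of_real t) w)" by (rule sublinear_scale[OF q s])
      finally show ?thesis using s False by (simp add: field_simps)
    qed
    then have "straighten q w (sc (of_real s) v) / s \<le> straighten q w v" by (rule straighten_greatest)
    then show ?thesis using s False by (simp add: field_simps)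
  qed
qed

text \<open>Zorn's lemma applies because the pointwise infimum of a chain is again sublinear.\<close>

lemma minimal_sublinear_exists:
  assumes p: "sublinear sc p"
  shows "\<exists>q. sublinear sc q \<and> (\<forall>v. q v \<le> p v) \<and>
    (\<forall>q'. sublinear sc q' \<and> (\<forall>v. q' v \<le> q v) \<longrightarrow> q' = q)"
proof -
  define A where "A = {q. sublinear sc q \<and> (\<forall>v. q v \<le> p v)}"
  let ?P = "\<lambda>q q'. \<forall>v. q' v \<le> (q v :: real)"
  have "\<exists>m\<in>A. \<forall>a\<in>A. ?P m a \<longrightarrow> a = m"
  proof (rule predicate_Zorn)
    show "partial_order_on A (relation_of ?P A)"
      by (rule partial_order_on_relation_ofI) (auto simp: fun_eq_iff order_eq_iff intro: order_trans)
    fix C assume C: "C \<in> Chains (relation_of ?P A)"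
    have CA: "q \<in> A" if "q \<in> C" for q using C that by (auto simp: Chains_def relation_of_def)
    have tot: "?P q q' \<or> ?P q' q" if "q \<in> C" "q' \<in> C" for q q'
      using C that by (auto simp: Chains_def relation_of_def)
    show "\<exists>u\<in>A. \<forall>q\<in>C. ?P q u"
    proof (cases "C = {}")
      case True
      then show ?thesis using p by (auto simp: A_def)
    next
      case False
      define u where "u v = (INF q\<in>C. q v)" for v
      have low: "- p (- v) \<le> q v" if "q \<in> C" for q v
      proof -
        have "sublinear sc q" "q (- v) \<le> p (- v)" using CA[OF that] by (simp_all add: A_def)
        then show ?thesis using sublinear_minus[of q v] by linarith
      qed
      have u_le: "u v \<le> q v" if "q \<in> C" for q v
        unfolding u_def using that low by (intro cINF_lower bdd_belowI2[where m="- p (- v)"]) auto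
      have u_ge: "c \<le> u v" if "\<And>q. q \<in> C \<Longrightarrow> c \<le> q v" for c v
        unfolding u_def using that False by (intro cINF_greatest)
      have "sublinear sc u" unfolding sublinear_def
      proof (intro conjI allI impI)
        fix v w
        have "u (v + w) - q v \<le> q' w" if qq: "q \<in> C" "q' \<in> C" for q q'
        proof -
          obtain r where r: "r \<in> C" "r v \<le> q v" "r w \<le> q' w" using tot[OF qq] qq by blast
          have "u (v + w) \<le> r (v + w)" by (rule u_le[OF r(1)])
          also have "\<dots> \<le> r v + r w" using CA[OF r(1)] unfolding A_def sublinear_def by blast
          finally show ?thesis using r by linarith
        qed
        then have "u (v + w) - q v \<le> u w" if "q \<in> C" for q using that by (intro u_ge)
        then have "u (v + w) - u w \<le> u v" by (intro u_ge) (simp add: algebra_simps)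
        then show "u (v + w) \<le> u v + u w" by simp
      next
        fix t :: real and v assume t: "t \<ge> 0"
        show "u (sc (of_real t) v) \<le> t * u v"
        proof (cases "t = 0")
          case True
          obtain q where "q \<in> C" using False by blast
          then show ?thesis using u_le[of q 0] CA[of q] sublinear_0[of q] True by (auto simp: A_def)
        next
          case t0: False
          have "u (sc (of_real t) v) / t \<le> q v" if "q \<in> C" for q
            using u_le[OF that, of "sc (of_real t) v"] CA[OF that] sublinear_scale[of q t v] t t0
            by (auto simp: A_def field_simps)
          then have "u (sc (of_real t) v) / t \<le> u v" by (rule u_ge)
          then show ?thesis using t t0 by (simp add: field_simps)
        qed
      qed
      moreover have "u v \<le> p v" for v
        using False u_le CA unfolding A_def by (metis (mono_tags, lifting) ex_in_conv mem_Collect_eq order_trans)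
      ultimately show ?thesis using u_le by (auto simp: A_def)
    qed
  qed
  then obtain m where "m \<in> A" "\<And>a. a \<in> A \<Longrightarrow> ?P m a \<Longrightarrow> a = m" by blast
  then show ?thesis unfolding A_def by (intro exI[of _ m]) (auto intro: order_trans)
qed

text \<open>
  A minimal sublinear functional \<open>q\<close> is real linear: it equals each \<open>straighten q w\<close>, so that
  \<open>q (- w) \<le> - q w\<close>.  Straightening \<open>p\<close> at \<open>v0\<close> beforehand makes \<open>q v0\<close> at
  least \<open>p v0\<close>.
\<close>

lemma real_functional_exists:
  assumes p: "sublinear sc p"
  shows "\<exists>u. (\<forall>v w. u (v + w) = u v + u w) \<and> (\<forall>t v. u (sc (of_real t) v) = t * u v) \<and>
    (\<forall>v. u v \<le> p v) \<and> p v0 \<le> u v0"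
proof -
  obtain q where q: "sublinear sc q" and le: "\<And>v. q v \<le> straighten p v0 v"
    and min: "\<And>q'. sublinear sc q' \<Longrightarrow> (\<And>v. q' v \<le> q v) \<Longrightarrow> q' = q"
    using minimal_sublinear_exists[OF straighten_sublinear[OF p]] by blast
  have neg: "q (- w) = - q w" for w
  proof -
    have "straighten q w = q" by (intro min straighten_sublinear straighten_below q)
    then have "q (- w) \<le> - q w" using straighten_neg[OF q, of w] by simp
    then show ?thesis using sublinear_minus[OF q, of w] by simp
  qed
  have add: "q (v + w) = q v + q w" for v w
  proof (rule order.antisym)
    show "q (v + w) \<le> q v + q w" using q unfolding sublinear_def by blast
    have "q ((v + w) + - w) \<le> q (v + w) + q (- w)" using q unfolding sublinear_def by blast
    then show "q v + q w \<le> q (v + w)" by (simp add: neg)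
  qed
  have "q (sc (of_real t) v) = t * q v" for t v
  proof (cases "t \<ge> 0")
    case False
    have "sc (of_real t) v = - sc (of_real (- t)) v" by simp
    then show ?thesis using sublinear_scale[OF q, of "- t" v] False by (simp add: neg del: of_real_minus scale_minus_left)
  qed (rule sublinear_scale[OF q])
  moreover have "p v0 \<le> q v0" using le[of "- v0"] straighten_neg[OF p, of v0] neg[of v0] by linarith
  moreover have "q v \<le> p v" for v using le[of v] straighten_below[OF p, of v0 v] by linarith
  ultimately show ?thesis using add by (intro exI[of _ q]) auto
qed

text \<open>
  The Hahn-Banach theorem: a dominated real functional \<open>u\<close> is the real part of
  \<open>v \<mapsto> u v - \<i> u (\<i> v)\<close>.  Bounding both parts separately costs the factor \<open>2\<close>.
\<close>

lemma functional_exists: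
  assumes p: "seminorm sc p" and v0: "p v0 \<noteq> 0"
  shows "\<exists>l. Vector_Spaces.linear sc (*) l \<and> (\<forall>v. cmod (l v) \<le> 2 * p v) \<and> l v0 \<noteq> 0"
proof -
  have pn: "p v \<ge> 0" "p (sc c v) = cmod c * p v" for c v
    using p unfolding seminorm_def by blast+
  have "sublinear sc p"
    using p unfolding seminorm_def sublinear_def by (auto simp: abs_if)
  then obtain u where add: "\<And>v w. u (v + w) = u v + u w" and sca: "\<And>t v. u (sc (of_real t) v) = t * u v"
    and le: "\<And>v. u v \<le> p v" and u0: "p v0 \<le> u v0"
    using real_functional_exists[of p v0] by blast
  have abs: "\<bar>u v\<bar> \<le> p v" for v
    using le[of v] le[of "sc (of_real (-1)) v"] sca[of "-1" v] pn(2)[of "of_real (-1)" v] by (simp add: abs_le_iff)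
  define l where "l v = Complex (u v) (- u (sc \<i> v))" for v
  have "l (v + w) = l v + l w" for v w by (simp add: l_def complex_eq_iff add scale_right_distrib)
  moreover have "l (sc c v) = c * l v" for c v
  proof -
    have c: "c = of_real (Re c) + of_real (Im c) * \<i>" by (simp add: complex_eq_iff)
    have "sc c v = sc (of_real (Re c)) v + sc (of_real (Im c)) (sc \<i> v)"
      by (subst c) (simp add: scale_left_distrib)
    moreover have "sc \<i> (sc c v) = sc (of_real (Re c)) (sc \<i> v) + sc (of_real (- Im c)) v"
    proof -
      have "\<i> * c = of_real (Re c) * \<i> + of_real (- Im c)" by (simp add: complex_eq_iff)
      then show ?thesis by (simp add: scale_left_distrib[symmetric] del: of_real_minus)
    qed
    ultimately have "u (sc c v) = Re c * u v + Im c * u (sc \<i> v)"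
      "u (sc \<i> (sc c v)) = Re c * u (sc \<i> v) + (- Im c) * u v"
      by (simp_all only: add sca)
    then show ?thesis unfolding l_def complex_eq_iff by simp
  qed
  moreover have "vector_space ((*) :: complex \<Rightarrow> complex \<Rightarrow> complex)"
    by unfold_locales (simp_all add: algebra_simps)
  ultimately have "Vector_Spaces.linear sc (*) l"
    unfolding Vector_Spaces.linear_iff using vector_space_axioms by blast
  moreover have "cmod (l v) \<le> 2 * p v" for v
    using cmod_le[of "l v"] abs[of v] abs[of "sc \<i> v"] pn(2)[of "\<i>" v] by (simp add: l_def)
  moreover have "l v0 \<noteq> 0" using u0 v0 pn(1)[of v0] by (auto simp: l_def complex_eq_iff)
  ultimately show ?thesis by blast
qed

end

locale frechet = complex_space sc for sc :: "complex \<Rightarrow> 'v::ab_group_add \<Rightarrow> 'v" +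
  fixes T :: "'v topology" and p :: "nat \<Rightarrow> 'v \<Rightarrow> real"
  assumes seminorm: "seminorm sc (p j)"
    and separated: "(\<And>j. p j v = 0) \<Longrightarrow> v = 0"
    and openin_iff: "openin T U \<longleftrightarrow> (\<forall>v\<in>U. \<exists>m. \<exists>e>0. \<forall>w. (\<forall>j\<le>m. p j (w - v) < e) \<longrightarrow> w \<in> U)"
begin

lemma topspace_UNIV: "topspace T = UNIV"
proof -
  have "openin T UNIV" unfolding openin_iff by (auto intro: exI[of _ 1])
  then show ?thesis using openin_subset by blast
qed

lemma continuous_functional:
  assumes l: "Vector_Spaces.linear sc (*) l"
    and small: "\<And>e. e > 0 \<Longrightarrow> \<exists>m. \<exists>d>0. \<forall>w. (\<forall>j\<le>m. p j w < d) \<longrightarrow> cmod (l w) < e"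
  shows "continuous_map T euclidean l"
proof -
  interpret l: Vector_Spaces.linear sc "(*)" l by (rule l)
  have "openin T {v. l v \<in> U}" if U: "open U" for U
    unfolding openin_iff
  proof
    fix v assume "v \<in> {v. l v \<in> U}"
    then obtain e where e: "e > 0" "ball (l v) e \<subseteq> U" using U open_contains_ball by blast
    obtain m d where md: "d > 0" "\<And>w. (\<forall>j\<le>m. p j w < d) \<Longrightarrow> cmod (l w) < e" using small[OF e(1)] by blast
    show "\<exists>m. \<exists>e>0. \<forall>w. (\<forall>j\<le>m. p j (w - v) < e) \<longrightarrow> w \<in> {v. l v \<in> U}"
    proof (intro exI[of _ m] exI[of _ d] conjI md(1) allI impI)
      fix w assume "\<forall>j\<le>m. p j (w - v) < d"
      from md(2)[OF this] have "l w \<in> ball (l v) e"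
        by (simp add: l.diff dist_norm norm_minus_commute)
      then show "w \<in> {v. l v \<in> U}" using e by blast
    qed
  qed
  then show ?thesis by (simp add: continuous_map_def topspace_UNIV)
qed

lemma continuous_functional_exists:
  assumes "v0 \<noteq> 0"
  shows "\<exists>l. Vector_Spaces.linear sc (*) l \<and> continuous_map T euclidean l \<and> l v0 \<noteq> 0"
proof -
  obtain i where "p i v0 \<noteq> 0" using separated assms by blast
  from functional_exists[OF seminorm this] obtain l
    where l: "Vector_Spaces.linear sc (*) l" "\<And>v. cmod (l v) \<le> 2 * p i v" "l v0 \<noteq> 0" by blast
  have "continuous_map T euclidean l"
  proof (rule continuous_functional[OF l(1)])
    fix e :: real assume e: "e > 0"
    have "cmod (l w) < e" if "\<forall>j\<le>i. p j w < e / 2" for w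
      using l(2)[of w] that[rule_format, of i] by simp
    then show "\<exists>m. \<exists>d>0. \<forall>w. (\<forall>j\<le>m. p j w < d) \<longrightarrow> cmod (l w) < e"
      using e by (intro exI[of _ i] exI[of _ "e / 2"]) auto
  qed
  then show ?thesis using l by blast
qed

end

lemma frechetE:
  assumes "vector_space sc" "frechet_space sc T"
  obtains p where "frechet sc T p"
proof -
  obtain p where "\<forall>j. seminorm sc (p j)" "\<forall>v. (\<forall>j. p (j::nat) v = 0) \<longrightarrow> v = 0"
    "\<forall>U. openin T U \<longleftrightarrow> (\<forall>v\<in>U. \<exists>m. \<exists>e>0. \<forall>w. (\<forall>j\<le>m. p j (w - v) < e) \<longrightarrow> w \<in> U)"
    using assms(2) unfolding frechet_space_def by (elim exE conjE) blast
  then have "frechet sc T p"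
    using assms(1) by (intro frechet.intro complex_space.intro frechet_axioms.intro) simp_all
  then show thesis by (rule that)
qed


section \<open>Smoothness of matrix coefficients\<close>

lemma GL_1: "mat 1 \<in> (GL :: ('a::local_field^'n^'n) set)"
  by (simp add: GL_det det_I)

lemma GL_mult: "g \<in> GL \<Longrightarrow> h \<in> GL \<Longrightarrow> g ** h \<in> (GL :: ('a::local_field^'n^'n) set)"
  by (simp add: GL_det det_mul)

lemma GL_inv: "g \<in> GL \<Longrightarrow> matrix_inv g \<in> (GL :: ('a::local_field^'n^'n) set)"
  unfolding GL_def using matrix_inv_left matrix_inv_right by (auto simp: invertible_def)

lemma
  assumes "g \<in> (GL :: ('a::local_field^'n^'n) set)"
  shows GL_right_inv: "g ** matrix_inv g = mat 1" and GL_left_inv: "matrix_inv g ** g = mat 1"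
  using assms by (simp_all add: GL_def matrix_inv_left matrix_inv_right)

lemma matrix_inv_unique:
  assumes "A ** B = mat 1"
  shows "matrix_inv A = (B :: 'a::local_field^'n^'n)"
proof -
  have "B ** A = mat 1" using assms by (simp add: matrix_left_right_inverse)
  then have "invertible A" using assms unfolding invertible_def by blast
  have "matrix_inv A = matrix_inv A ** (A ** B)" by (simp add: assms)
  also have "\<dots> = B" unfolding matrix_mul_assoc matrix_inv_left[OF \<open>invertible A\<close>] by simp
  finally show ?thesis .
qed

lemma matrix_inv_mult:
  assumes "g \<in> GL" "h \<in> GL"
  shows "matrix_inv (g ** h) = matrix_inv h ** (matrix_inv g :: 'a::local_field^'n^'n)"
proof (rule matrix_inv_unique)
  have "g ** h ** (matrix_inv h ** matrix_inv g) = g ** (h ** matrix_inv h) ** matrix_inv g"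
    by (simp only: matrix_mul_assoc)
  then show "g ** h ** (matrix_inv h ** matrix_inv g) = mat 1"
    using assms by (simp add: GL_right_inv)
qed

lemma matrix_inv_inv: "g \<in> GL \<Longrightarrow> matrix_inv (matrix_inv g) = (g :: 'a::local_field^'n^'n)"
  by (intro matrix_inv_unique GL_left_inv)

lemma eventually_near_identity:
  fixes g :: "'a::local_field^'n^'n"
  assumes "g \<in> GL" "open S" "mat 1 \<in> S"
  shows "\<forall>\<^sub>F h in nhds g. matrix_inv g ** h \<in> S"
proof -
  have "open ((\<lambda>h. matrix_inv g ** h) -` S)"
    by (intro open_vimage assms continuous_on_matrix_mult continuous_intros)
  moreover have "g \<in> (\<lambda>h. matrix_inv g ** h) -` S" using assms by (simp add: GL_left_inv)
  ultimately show ?thesis unfolding eventually_nhds by (intro exI[of _ "(\<lambda>h. matrix_inv g ** h) -` S"]) auto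
qed

lemma Ck_on_functional:
  assumes l: "Vector_Spaces.linear sc (*) l" "continuous_map T euclidean l"
  shows "Ck_on s sc T k U f \<Longrightarrow> Ck_on s (*) euclidean k U (\<lambda>x. l (f x))"
proof (induct k arbitrary: f)
  case 0
  then show ?case using continuous_map_compose[OF _ l(2), of "top_of_set U" f] by (simp add: o_def)
next
  case (Suc k)
  interpret l: Vector_Spaces.linear sc "(*)" l by (rule l(1))
  show ?case unfolding Ck_on.simps
  proof (intro conjI allI)
    show "continuous_map (top_of_set U) euclidean (\<lambda>x. l (f x))"
      using Suc.prems continuous_map_compose[OF _ l(2), of "top_of_set U" f] by (simp add: o_def)
    fix v
    obtain f' where f': "\<And>x. x \<in> U \<Longrightarrow> limitin T (\<lambda>t::real. sc (complex_of_real (1 / t)) (f (x + s (real_emb t) v) - f x)) (f' x) (at 0)"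
      "Ck_on s sc T k U f'" using Suc.prems unfolding Ck_on.simps by blast
    have "limitin euclidean (\<lambda>t::real. complex_of_real (1 / t) * (l (f (x + s (real_emb t) v)) - l (f x))) (l (f' x)) (at 0)"
      if "x \<in> U" for x
      using continuous_map_limit[OF l(2) f'(1)[OF that]] by (simp add: o_def l.scale l.diff)
    then show "\<exists>f'. (\<forall>x\<in>U. limitin euclidean (\<lambda>t::real. complex_of_real (1 / t) *
        (l (f (x + s (real_emb t) v)) - l (f x))) (f' x) (at 0)) \<and> Ck_on s (*) euclidean k U f'"
      using Suc.hyps[OF f'(2)] by (intro exI[of _ "\<lambda>x. l (f' x)"] conjI ballI)
  qed
qed

locale irreducible_rep_of_GL = haar_measure GL \<nu> for \<nu> :: "('a::local_field^'n^'n) measure" +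
  fixes sc :: "complex \<Rightarrow> 'v::ab_group_add \<Rightarrow> 'v" and T :: "'v topology"
    and \<pi> :: "'a^'n^'n \<Rightarrow> 'v \<Rightarrow> 'v"
  assumes in_Pi: "in_Pi sc T \<pi>"
begin

lemma rep: "representation sc \<pi>"
  using in_Pi by (simp add: in_Pi_def)

sublocale complex_space sc
  using rep by (simp add: complex_space_def Defs.representation_def)

lemma \<pi>_1: "\<pi> (mat 1) v = v"
  using rep by (simp add: Defs.representation_def)

lemma \<pi>_mult: "g \<in> GL \<Longrightarrow> h \<in> GL \<Longrightarrow> \<pi> (g ** h) v = \<pi> g (\<pi> h v)"
  using rep by (simp add: Defs.representation_def)

lemma \<pi>_linear: "g \<in> GL \<Longrightarrow> Vector_Spaces.linear sc sc (\<pi> g)"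
  using rep by (simp add: Defs.representation_def)

lemma \<pi>_inv: "g \<in> GL \<Longrightarrow> \<pi> g (\<pi> (matrix_inv g) v) = v"
  using \<pi>_mult[of g "matrix_inv g" v] by (simp add: GL_inv GL_right_inv \<pi>_1)

lemma nonzero_vector: "\<exists>v :: 'v. v \<noteq> 0"
  using in_Pi unfolding in_Pi_def irreducible_rep_def by blast

lemma \<pi>_add: "g \<in> GL \<Longrightarrow> \<pi> g (v + w) = \<pi> g v + \<pi> g w"
  using \<pi>_linear unfolding Vector_Spaces.linear_iff by blast

lemma \<pi>_scale: "g \<in> GL \<Longrightarrow> \<pi> g (sc c v) = sc c (\<pi> g v)"
  using \<pi>_linear unfolding Vector_Spaces.linear_iff by blast

lemma orbit_locally_constant:
  assumes na: "\<not> archimedean TYPE('a)" and g: "g \<in> GL"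
  shows "\<forall>\<^sub>F h in nhds g. h \<in> GL \<and> \<pi> h v = \<pi> g v"
proof -
  have "open {h \<in> GL. \<pi> h v = v}"
    using in_Pi na by (simp add: in_Pi_def nonarch_smooth_def)
  then have "\<forall>\<^sub>F h in nhds g. matrix_inv g ** h \<in> {h \<in> GL. \<pi> h v = v}"
    by (intro eventually_near_identity g) (simp_all add: GL_1 \<pi>_1)
  then show ?thesis
  proof eventually_elim
    case (elim h)
    have "h = g ** (matrix_inv g ** h)" using g by (simp add: matrix_mul_assoc GL_right_inv)
    then show ?case using elim g \<pi>_mult[of g "matrix_inv g ** h" v] GL_mult[of g "matrix_inv g ** h"] by simp
  qed
qed

lemma coefficient_smooth:
  assumes "archimedean TYPE('a) \<Longrightarrow> Vector_Spaces.linear sc (*) l \<and> continuous_map T euclidean l"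
  shows "smooth_on mat_scale GL (\<lambda>g. l (\<pi> g v))"
proof (cases "archimedean TYPE('a)")
  case True
  then have "v \<in> smooth_vectors sc T \<pi>"
    using in_Pi by (simp add: in_Pi_def casselman_wallach_def)
  then show ?thesis
    using True assms by (auto simp: smooth_on_arch smooth_vectors_def intro: Ck_on_functional)
next
  case False
  have "\<forall>\<^sub>F h in at g within GL. l (\<pi> h v) = l (\<pi> g v)" if "g \<in> GL" for g
    using orbit_locally_constant[OF False that, of v]
    by (auto simp: eventually_at_filter elim: eventually_mono)
  then show ?thesis using False by (simp add: smooth_on_nonarch)
qed

text \<open>
  Averaging a continuous functional against a compactly supported function gives a continuous
  functional: by joint continuity of the action and compactness, \<open>\<bar>l (\<pi>(g) w)\<bar>\<close> is small for \<open>w\<close> near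
  \<open>0\<close>, uniformly in \<open>g\<close> in the support.
\<close>

lemma averaged_functional:
  assumes arch: "archimedean TYPE('a)" and l: "Vector_Spaces.linear sc (*) l" "continuous_map T euclidean l"
    and f: "f \<in> Cc_smooth mat_scale GL"
  defines "l' \<equiv> \<lambda>v. LINT g|\<nu>. f g * l (\<pi> g v)"
  shows "Vector_Spaces.linear sc (*) l'" "continuous_map T euclidean l'"
proof -
  interpret l: Vector_Spaces.linear sc "(*)" l by (rule l(1))
  obtain C where C: "compact C" "C \<subseteq> GL" "\<And>g. g \<notin> C \<Longrightarrow> f g = 0"
    using f unfolding Cc_smooth_def by blast
  have fc: "continuous_on GL f"
    using f unfolding Cc_smooth_def by (auto intro: domain_of_smoothness.smooth_continuous[OF matrix_domain])
  have coeff: "continuous_on GL (\<lambda>g. l (\<pi> g v))" for v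
    using l by (intro domain_of_smoothness.smooth_continuous[OF matrix_domain] coefficient_smooth) auto
  have int: "integrable \<nu> (\<lambda>g. f g * l (\<pi> g v))" for v
    by (rule integrable_compact_support[OF _ C(1,2)]) (use C(3) in \<open>auto intro!: continuous_intros fc coeff\<close>)
  have "l' (v + w) = l' v + l' w" for v w
  proof -
    have "l' (v + w) = (LINT g|\<nu>. f g * l (\<pi> g v) + f g * l (\<pi> g w))"
      unfolding l'_def by (intro Bochner_Integration.integral_cong) (simp_all add: space_\<mu> \<pi>_add l.add algebra_simps)
    then show ?thesis using int by (simp add: l'_def)
  qed
  moreover have "l' (sc c v) = c * l' v" for c v
  proof -
    have "l' (sc c v) = (LINT g|\<nu>. c * (f g * l (\<pi> g v)))"
      unfolding l'_def by (intro Bochner_Integration.integral_cong) (simp_all add: space_\<mu> \<pi>_scale l.scale)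
    then show ?thesis by (simp add: l'_def)
  qed
  ultimately show lin: "Vector_Spaces.linear sc (*) l'"
    using l(1) unfolding Vector_Spaces.linear_iff by blast
  have cw: "frechet_space sc T" "continuous_rep T \<pi>"
    using in_Pi arch by (simp_all add: in_Pi_def casselman_wallach_def)
  obtain p where "frechet sc T p" using frechetE[OF vector_space_axioms cw(1)] .
  then interpret frechet sc T p .
  have p0: "p j 0 = 0" for j
    using seminorm[of j] unfolding seminorm_def by (metis mult_zero_left norm_zero scale_zero_left)
  obtain m e where me: "e > 0" "\<And>w g. (\<forall>j\<le>m. p j w < e) \<Longrightarrow> g \<in> C \<Longrightarrow> cmod (l (\<pi> g w)) < 1"
  proof -
    let ?X = "prod_topology (top_of_set GL) T"
    have cont: "continuous_map ?X euclidean (\<lambda>z. l (\<pi> (fst z) (snd z)))"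
      using continuous_map_compose[OF cw(2)[unfolded continuous_rep_def] l(2)] by (simp add: o_def case_prod_beta)
    define W where "W = {z \<in> topspace ?X. l (\<pi> (fst z) (snd z)) \<in> ball 0 1}"
    have "openin ?X W" unfolding W_def by (rule openin_continuous_map_preimage[OF cont]) simp
    moreover have "compactin (top_of_set GL) C" using C by (simp add: compactin_subtopology)
    moreover have "compactin T {0}" by (simp add: topspace_UNIV)
    moreover have "C \<times> {0} \<subseteq> W"
    proof -
      have "\<pi> g 0 = 0" if "g \<in> GL" for g using \<pi>_scale[OF that, of 0 0] by simp
      then show ?thesis using C(2) by (auto simp: W_def topspace_UNIV)
    qed
    ultimately obtain U V where UV: "openin T V" "C \<subseteq> U" "{0} \<subseteq> V" "U \<times> V \<subseteq> W"
      by (metis Wallace_theorem_prod_topology)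
    obtain m e where "e > 0" "\<And>w. (\<forall>j\<le>m. p j (w - 0) < e) \<Longrightarrow> w \<in> V"
      using UV(1,3) unfolding openin_iff by blast
    moreover have "cmod (l (\<pi> g w)) < 1" if "g \<in> C" "w \<in> V" for g w
    proof -
      have "(g, w) \<in> W" using UV that by blast
      then show ?thesis by (simp add: W_def)
    qed
    ultimately show thesis by (intro that[of e m]) auto
  qed
  define M where "M = (LINT g|\<nu>. cmod (f g))"
  have fint: "integrable \<nu> f" by (rule integrable_compact_support[OF fc C(1,2)]) (use C(3) in auto)
  have M0: "M \<ge> 0" unfolding M_def by simp
  show "continuous_map T euclidean l'"
  proof (rule continuous_functional[OF lin])
    fix \<epsilon> :: real assume \<epsilon>: "\<epsilon> > 0"
    define \<delta> where "\<delta> = \<epsilon> / (M + 1)"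
    have \<delta>: "\<delta> > 0" "\<delta> * M < \<epsilon>" using \<epsilon> M0 by (simp_all add: \<delta>_def field_simps)
    have "cmod (l' w) < \<epsilon>" if w: "\<forall>j\<le>m. p j w < e * \<delta>" for w
    proof -
      have small: "cmod (l (\<pi> g w)) \<le> \<delta>" if g: "g \<in> C" for g
      proof -
        have "p j (sc (of_real (1 / \<delta>)) w) = 1 / \<delta> * p j w" for j
          using seminorm[of j] \<delta>(1) unfolding seminorm_def by (simp add: norm_divide)
        then have "\<forall>j\<le>m. p j (sc (of_real (1 / \<delta>)) w) < e" using w \<delta>(1) by (simp add: divide_less_eq)
        from me(2)[OF this g] have "cmod (of_real (1 / \<delta>) * l (\<pi> g w)) < 1"
          using g C(2) by (simp only: \<pi>_scale l.scale subset_iff)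
        then show ?thesis using \<delta>(1) by (simp add: norm_mult norm_divide divide_less_eq)
      qed
      have "cmod (l' w) \<le> (LINT g|\<nu>. cmod (f g * l (\<pi> g w)))" unfolding l'_def by (rule integral_norm_bound)
      also have "\<dots> \<le> (LINT g|\<nu>. \<delta> * cmod (f g))"
      proof (rule integral_mono)
        show "cmod (f g * l (\<pi> g w)) \<le> \<delta> * cmod (f g)" for g
          using small[of g] C(3)[of g] by (cases "g \<in> C") (auto simp: norm_mult mult.commute[of \<delta>] intro: mult_left_mono)
      qed (use int fint in auto)
      also have "\<dots> = \<delta> * M" by (simp add: M_def)
      finally show ?thesis using \<delta>(2) by simp
    qed
    then show "\<exists>m. \<exists>d>0. \<forall>w. (\<forall>j\<le>m. p j w < d) \<longrightarrow> cmod (l' w) < \<epsilon>"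
      using me(1) \<delta>(1) by (intro exI[of _ m] exI[of _ "e * \<delta>"]) auto
  qed
qed

lemma matrix_coefficient_smooth:
  assumes "\<phi> \<in> matrix_coefficients \<nu> sc T \<pi>"
  shows "smooth_on mat_scale GL \<phi>"
proof -
  interpret fm: module "\<lambda>c (f :: 'a^'n^'n \<Rightarrow> complex) x. c * f x"
    by unfold_locales (auto simp: fun_eq_iff algebra_simps)
  interpret domain_of_smoothness "mat_scale :: 'a \<Rightarrow> 'a^'n^'n \<Rightarrow> 'a^'n^'n" by (rule matrix_domain)
  show ?thesis
    using assms unfolding matrix_coefficients_def cspan_def
  proof (induct rule: fm.span_induct_alt)
    case base
    show ?case using smooth_const[of GL 0] by (simp add: zero_fun_def)
  next
    case (step c x y)
    then obtain v l where x: "x = (\<lambda>g. if g \<in> GL then l (\<pi> g v) else 0)"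
      and l: "l \<in> contragredient_vectors \<nu> sc T \<pi>" by blast
    have "smooth_on mat_scale GL (\<lambda>g. l (\<pi> g v))"
    proof (rule coefficient_smooth)
      assume "archimedean TYPE('a)"
      then show "Vector_Spaces.linear sc (*) l \<and> continuous_map T euclidean l"
        using l averaged_functional unfolding contragredient_vectors_def by auto
    qed
    then have "smooth_on mat_scale GL x"
      by (rule smooth_cong[OF open_GL, rotated]) (simp add: x)
    then have "smooth_on mat_scale GL (\<lambda>g. c * x g + y g)"
      using step by (intro smooth_add smooth_mult smooth_const)
    then show ?case by (simp add: plus_fun_def)
  qed
qed

end


section \<open>Nonzero vectors in the contragredient\<close>

lemma ultrametric:
  "\<not> archimedean TYPE('a::local_field) \<Longrightarrow> absval (x + y :: 'a) \<le> max (absval x) (absval y)"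
  unfolding archimedean_def by (meson not_le)

lemma ultrametric_sum:
  assumes na: "\<not> archimedean TYPE('a::local_field)" and r: "r \<ge> 0"
    and "\<And>i. i \<in> I \<Longrightarrow> absval (f i :: 'a) \<le> r"
  shows "absval (\<Sum>i\<in>I. f i) \<le> r"
  using assms(3)
proof (induct I rule: infinite_finite_induct)
  case (insert i I)
  then show ?case using ultrametric[OF na, of "f i" "\<Sum>i\<in>I. f i"] by fastforce
qed (use r in auto)

definition congruence_subgroup :: "real \<Rightarrow> ('a::local_field^'n^'n) set" where
  "congruence_subgroup r = {g. \<forall>i j. absval (g $ i $ j - mat 1 $ i $ j) \<le> r}"

lemma dist_matrix_le:
  fixes g h :: "'a::local_field^'n^'n"
  assumes "\<And>i j. absval (g $ i $ j - h $ i $ j) \<le> r"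
  shows "dist g h \<le> real CARD('n) * (real CARD('n) * r)"
proof -
  have "dist g h \<le> (\<Sum>i\<in>UNIV. dist (g $ i) (h $ i))"
    unfolding dist_vec_def by (rule L2_set_le_sum) simp
  also have "\<dots> \<le> (\<Sum>i\<in>(UNIV::'n set). \<Sum>j\<in>(UNIV::'n set). r)"
  proof (rule sum_mono)
    fix i :: 'n
    have "dist (g $ i) (h $ i) \<le> (\<Sum>j\<in>UNIV. dist (g $ i $ j) (h $ i $ j))"
      unfolding dist_vec_def by (rule L2_set_le_sum) simp
    also have "\<dots> \<le> (\<Sum>j\<in>(UNIV::'n set). r)"
      by (rule sum_mono) (simp add: dist_absval assms)
    finally show "dist (g $ i) (h $ i) \<le> (\<Sum>j\<in>(UNIV::'n set). r)" .
  qed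
  finally show ?thesis by simp
qed

lemma compact_matrix_box:
  fixes h :: "'a::local_field^'n^'n"
  assumes "\<And>i j. closed (B i j)" "\<And>i j x. x \<in> B i j \<Longrightarrow> absval (x - h $ i $ j) \<le> r"
  shows "compact {g :: 'a^'n^'n. \<forall>i j. g $ i $ j \<in> B i j}"
  unfolding compact_eq_bounded_closed
proof
  show "bounded {g :: 'a^'n^'n. \<forall>i j. g $ i $ j \<in> B i j}"
    unfolding bounded_any_center[where a=h] dist_commute[of h]
    by (intro exI[of _ "real CARD('n) * (real CARD('n) * r)"] ballI dist_matrix_le assms(2)) simp
  have "{g :: 'a^'n^'n. \<forall>i j. g $ i $ j \<in> B i j} = (\<Inter>i. \<Inter>j. (\<lambda>g. g $ i $ j) -` B i j)" by auto
  also have "closed \<dots>"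
    by (intro closed_INT ballI closed_vimage assms continuous_intros)
  finally show "closed {g :: 'a^'n^'n. \<forall>i j. g $ i $ j \<in> B i j}" .
qed

context
  fixes r :: real
  assumes na: "\<not> archimedean TYPE('a::local_field)" and r: "0 < r" "r < 1"
begin

lemma compact_congruence_subgroup: "compact (congruence_subgroup r :: ('a^'n^'n) set)"
proof -
  have "compact {g :: 'a^'n^'n. \<forall>i j. g $ i $ j \<in> {x. absval (x - mat 1 $ i $ j) \<le> r}}"
    by (intro compact_matrix_box[where h="mat 1" and r=r] closed_Collect_le continuous_intros) simp
  then show ?thesis by (simp add: congruence_subgroup_def)
qed

lemma open_congruence_subgroup: "open (congruence_subgroup r :: ('a^'n^'n) set)"
proof -
  have "open {x :: 'a. absval (x - c) \<le> r}" for c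
    unfolding open_dist
  proof (intro ballI exI[of _ r] conjI r allI impI)
    fix x y assume "x \<in> {x. absval (x - c) \<le> r}" "dist y x < r"
    then show "y \<in> {x. absval (x - c) \<le> r}"
      using ultrametric[OF na, of "y - x" "x - c"] by (simp add: dist_absval)
  qed
  then have "open (\<Inter>i. \<Inter>j. (\<lambda>g :: 'a^'n^'n. g $ i $ j) -` {x. absval (x - mat 1 $ i $ j) \<le> r})"
    by (intro open_INT finite ballI open_vimage continuous_intros) auto
  moreover have "(\<Inter>i. \<Inter>j. (\<lambda>g :: 'a^'n^'n. g $ i $ j) -` {x. absval (x - mat 1 $ i $ j) \<le> r}) = congruence_subgroup r"
    by (auto simp: congruence_subgroup_def)
  ultimately show ?thesis by simp
qed

lemma congruence_subgroup_1: "mat 1 \<in> congruence_subgroup r"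
  using r by (simp add: congruence_subgroup_def)

lemma absval_mat_1: "absval (mat 1 $ i $ j :: 'a) \<le> 1"
  by (simp add: mat_def)

lemma absval_entry:
  assumes "g \<in> (congruence_subgroup r :: ('a^'n^'n) set)"
  shows "absval (g $ i $ j) \<le> 1"
proof -
  have "absval (g $ i $ j - mat 1 $ i $ j) \<le> r" using assms by (simp add: congruence_subgroup_def)
  then show ?thesis
    using ultrametric[OF na, of "g $ i $ j - mat 1 $ i $ j" "mat 1 $ i $ j"] r absval_mat_1[of i j]
    by (simp add: max_def split: if_splits)
qed

lemma near_1_times_integral:
  fixes g h :: "'a^'n^'n"
  assumes g: "g \<in> congruence_subgroup r" and M: "\<And>i j. absval (h $ i $ j) \<le> M" "M \<ge> 0"
  shows "absval ((g ** h) $ i $ j - h $ i $ j) \<le> r * M"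
proof -
  have "h $ i $ j = (mat 1 ** h) $ i $ j" by simp
  then have "(g ** h) $ i $ j - h $ i $ j = (\<Sum>k\<in>UNIV. (g $ i $ k - mat 1 $ i $ k) * h $ k $ j)"
    by (simp only: matrix_matrix_mult_def vec_lambda_beta left_diff_distrib sum_subtractf)
  also have "absval \<dots> \<le> r * M"
  proof (rule ultrametric_sum[OF na])
    show "absval ((g $ i $ k - mat 1 $ i $ k) * h $ k $ j) \<le> r * M" for k
      unfolding absval_mult using g M r by (intro mult_mono) (auto simp: congruence_subgroup_def)
  qed (use r M in simp)
  finally show ?thesis .
qed

lemma congruence_subgroup_mult:
  assumes "g \<in> congruence_subgroup r" "h \<in> (congruence_subgroup r :: ('a^'n^'n) set)"
  shows "g ** h \<in> congruence_subgroup r"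
  unfolding congruence_subgroup_def
proof (intro CollectI allI)
  fix i j
  have "absval ((g ** h) $ i $ j - h $ i $ j) \<le> r"
    using near_1_times_integral[OF assms(1), of h 1 i j] absval_entry[OF assms(2)] by simp
  moreover have "absval (h $ i $ j - mat 1 $ i $ j) \<le> r" using assms(2) by (simp add: congruence_subgroup_def)
  ultimately show "absval ((g ** h) $ i $ j - mat 1 $ i $ j) \<le> r"
    using ultrametric[OF na, of "(g ** h) $ i $ j - h $ i $ j" "h $ i $ j - mat 1 $ i $ j"] by simp
qed

text \<open>
  For \<open>h = g\<^sup>-\<^sup>1\<close> the identity \<open>h - 1 = - (g - 1) h\<close> bounds the entries of \<open>h - 1\<close> by \<open>r\<close> times the
  largest entry of \<open>h\<close>, which therefore cannot exceed \<open>1\<close>.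
\<close>

lemma congruence_subgroup_inv:
  assumes g: "g \<in> (congruence_subgroup r :: ('a^'n^'n) set)" and GL: "g \<in> GL"
  shows "matrix_inv g \<in> congruence_subgroup r"
proof -
  define h where "h = matrix_inv g"
  define M where "M = Max (range (\<lambda>p. absval (h $ fst p $ snd p)))"
  have le_M: "absval (h $ i $ j) \<le> M" for i j
    unfolding M_def by (intro Max_ge finite_imageI finite) (auto intro!: image_eqI[of _ _ "(i, j)"])
  have M0: "M \<ge> 0" using le_M[of undefined undefined] absval_nonneg order_trans by blast
  have near: "absval (h $ i $ j - mat 1 $ i $ j) \<le> r * M" for i j
    using near_1_times_integral[OF g le_M M0, of i j] GL_right_inv[OF GL]
    by (simp add: h_def absval_minus_commute)
  have "M \<le> 1"
  proof (rule ccontr)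
    assume M1: "\<not> M \<le> 1"
    have "M \<in> range (\<lambda>p. absval (h $ fst p $ snd p))"
      unfolding M_def by (intro Max_in finite_imageI finite) auto
    then obtain i j where "M = absval (h $ i $ j)" by auto
    also have "\<dots> \<le> max (r * M) 1"
      using ultrametric[OF na, of "h $ i $ j - mat 1 $ i $ j" "mat 1 $ i $ j"] near[of i j] absval_mat_1[of i j]
      by (simp add: max_def split: if_splits)
    finally show False using M1 r mult_strict_right_mono[of r 1 M] by (simp add: max_def split: if_splits)
  qed
  then have "r * M \<le> r" using r by simp
  then have "absval (h $ i $ j - mat 1 $ i $ j) \<le> r" for i j using near[of i j] by linarith
  then show ?thesis by (simp add: congruence_subgroup_def h_def)
qed

end

lemma small_congruence_subgroup:
  assumes "open S" "mat 1 \<in> (S :: ('a::local_field^'n^'n) set)"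
  obtains r where "0 < r" "r < 1" "congruence_subgroup r \<subseteq> S"
proof -
  obtain e where e: "e > 0" "ball (mat 1) e \<subseteq> S" using assms open_contains_ball by blast
  let ?c = "real CARD('n) * real CARD('n)"
  define r where "r = min (1/2) (e / (2 * ?c))"
  have r: "0 < r" "r < 1" using e(1) by (auto simp: r_def)
  have "?c * r \<le> ?c * (e / (2 * ?c))" unfolding r_def by (intro mult_left_mono) auto
  also have "\<dots> < e" using e(1) by (simp add: field_simps)
  finally have "?c * r < e" .
  then have "g \<in> ball (mat 1) e" if "g \<in> congruence_subgroup r" for g :: "'a^'n^'n"
    using dist_matrix_le[of g "mat 1" r] that by (simp add: congruence_subgroup_def dist_commute mult.assoc)
  then show thesis using r e(2) by (intro that[of r]) auto
qed

context irreducible_rep_of_GL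
begin

text \<open>
  Let \<open>v\<^sub>0 \<noteq> 0\<close> be fixed by a compact open subgroup \<open>K\<close>.  Averaging a linear functional over \<open>K\<close>
  makes it \<open>K\<close>-invariant, hence smooth, and multiplies its value at \<open>v\<^sub>0\<close> by the volume of \<open>K\<close>.
\<close>

lemma contragredient_nonzero_nonarch:
  assumes na: "\<not> archimedean TYPE('a)"
  shows "\<exists>l\<in>contragredient_vectors \<nu> sc T \<pi>. \<exists>v. l v \<noteq> 0"
proof -
  obtain v0 :: 'v where v0: "v0 \<noteq> 0" using nonzero_vector by blast
  define S where "S = {g \<in> GL. \<pi> g v0 = v0}"
  have "open S" "mat 1 \<in> S"
    using in_Pi na by (simp_all add: in_Pi_def nonarch_smooth_def S_def GL_1 \<pi>_1)
  then obtain r where r: "0 < r" "r < 1" and sub: "congruence_subgroup r \<subseteq> S"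
    by (rule small_congruence_subgroup)
  define K where "K = (congruence_subgroup r :: ('a^'n^'n) set)"
  have KS: "K \<subseteq> S" and KGL: "K \<subseteq> GL" using sub by (auto simp: K_def S_def)
  have K: "compact K" "open K" "mat 1 \<in> K" "\<And>g h. g \<in> K \<Longrightarrow> h \<in> K \<Longrightarrow> g ** h \<in> K"
    using compact_congruence_subgroup[OF na r] open_congruence_subgroup[OF na r]
      congruence_subgroup_1[OF na r] congruence_subgroup_mult[OF na r] by (auto simp: K_def)
  have Kinv: "matrix_inv g \<in> K" if "g \<in> K" for g
    using congruence_subgroup_inv[OF na r, of g] that KGL by (auto simp: K_def)
  have "vector_space ((*) :: complex \<Rightarrow> complex \<Rightarrow> complex)"
    by unfold_locales (simp_all add: algebra_simps)
  then interpret P: vector_space_pair sc "(*) :: complex \<Rightarrow> complex \<Rightarrow> complex"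
    by (intro vector_space_pair.intro vector_space_axioms)
  obtain L where L: "Vector_Spaces.linear sc (*) L" "L v0 = (1::complex)"
    using P.linear_independent_extend[of "{v0}" "\<lambda>_. 1"] v0 independent_insert[of v0 "{}"] by auto
  interpret L: Vector_Spaces.linear sc "(*)" L by (rule L(1))
  define F where "F v k = (if k \<in> K then L (\<pi> (matrix_inv k) v) else 0)" for v k
  have F_cont: "continuous_on GL (F v)" for v
  proof -
    have "continuous_on K (\<lambda>k. L (\<pi> (matrix_inv k) v))"
      unfolding continuous_on_def
    proof
      fix k assume k: "k \<in> K"
      then have kGL: "k \<in> GL" using KGL by blast
      let ?w = "\<pi> (matrix_inv k) v"
      have "\<forall>\<^sub>F h in nhds k. matrix_inv k ** h \<in> {g \<in> GL. \<pi> g ?w = ?w}"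
        using in_Pi na by (intro eventually_near_identity kGL) (simp_all add: in_Pi_def nonarch_smooth_def GL_1 \<pi>_1)
      then have "\<forall>\<^sub>F h in nhds k. L (\<pi> (matrix_inv h) v) = L ?w"
      proof eventually_elim
        case (elim h)
        let ?u = "matrix_inv k ** h"
        have u: "?u \<in> GL" "\<pi> ?u ?w = ?w" using elim by auto
        have "h = k ** ?u" using kGL by (simp add: matrix_mul_assoc GL_right_inv)
        then have "matrix_inv h = matrix_inv ?u ** matrix_inv k" using matrix_inv_mult[OF kGL u(1)] by simp
        then have "\<pi> (matrix_inv h) v = \<pi> (matrix_inv ?u) (\<pi> ?u ?w)"
          using \<pi>_mult[of "matrix_inv ?u" "matrix_inv k" v] u kGL by (simp add: GL_inv)
        also have "\<dots> = ?w" using \<pi>_mult[of "matrix_inv ?u" ?u ?w] u(1) by (simp add: GL_inv GL_left_inv \<pi>_1)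
        finally show ?case by simp
      qed
      then have "\<forall>\<^sub>F h in at k within K. L (\<pi> (matrix_inv h) v) = L ?w"
        by (auto simp: eventually_at_filter elim: eventually_mono)
      then show "((\<lambda>h. L (\<pi> (matrix_inv h) v)) \<longlongrightarrow> L ?w) (at k within K)" by (rule tendsto_eventually)
    qed
    then have "continuous_on K (F v)" by (rule continuous_on_eq) (simp add: F_def)
    moreover have "continuous_on (- K) (F v)"
      by (rule continuous_on_eq[OF continuous_on_const[of _ 0]]) (simp add: F_def)
    ultimately have "continuous_on (K \<union> - K) (F v)"
      using K by (intro continuous_on_open_Un) (auto intro: compact_imp_closed open_Compl)
    then show ?thesis by (rule continuous_on_subset) auto
  qed
  have F_int: "integrable \<nu> (F v)" for v
    by (rule integrable_compact_support[OF F_cont K(1) KGL]) (simp add: F_def)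
  define l where "l v = (LINT k|\<nu>. F v k)" for v
  have "l (v + w) = l v + l w" for v w
  proof -
    have "l (v + w) = (LINT k|\<nu>. F v k + F w k)"
      unfolding l_def using KGL
      by (intro Bochner_Integration.integral_cong refl) (auto simp: F_def \<pi>_add GL_inv L.add subset_iff)
    then show ?thesis using F_int by (simp add: l_def)
  qed
  moreover have "l (sc c v) = c * l v" for c v
  proof -
    have "l (sc c v) = (LINT k|\<nu>. c * F v k)"
      unfolding l_def using KGL
      by (intro Bochner_Integration.integral_cong refl) (auto simp: F_def \<pi>_scale GL_inv L.scale subset_iff)
    then show ?thesis by (simp add: l_def)
  qed
  ultimately have lin: "Vector_Spaces.linear sc (*) l"
    using L(1) unfolding Vector_Spaces.linear_iff by blast
  have inv: "l (\<pi> g v) = l v" if g: "g \<in> K" for g v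
  proof -
    have gi: "matrix_inv g \<in> GL" "g \<in> GL" using g KGL GL_inv by auto
    have "l v = (LINT k|\<nu>. F v (matrix_inv g ** k))"
      unfolding l_def by (rule integral_left_translate[OF gi(1) _ F_cont, symmetric]) (intro GL_mult gi)
    also have "\<dots> = (LINT k|\<nu>. F (\<pi> g v) k)"
    proof (intro Bochner_Integration.integral_cong refl)
      fix k assume "k \<in> space \<nu>"
      then have k: "k \<in> GL" by (simp add: space_\<mu>)
      have "k = g ** (matrix_inv g ** k)" using gi by (simp add: matrix_mul_assoc GL_right_inv)
      then have "matrix_inv g ** k \<in> K \<longleftrightarrow> k \<in> K" using K(4) g Kinv by metis
      moreover have "\<pi> (matrix_inv (matrix_inv g ** k)) v = \<pi> (matrix_inv k) (\<pi> g v)"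
        using \<pi>_mult[of "matrix_inv k" g v] k gi by (simp add: matrix_inv_mult matrix_inv_inv GL_inv)
      ultimately show "F v (matrix_inv g ** k) = F (\<pi> g v) k" by (simp add: F_def)
    qed
    finally show ?thesis by (simp add: l_def)
  qed
  have "open {g \<in> GL. \<forall>v. l (\<pi> g v) = l v}"
    unfolding open_subopen[of "{g \<in> GL. \<forall>v. l (\<pi> g v) = l v}"]
  proof
    fix g assume g: "g \<in> {g \<in> GL. \<forall>v. l (\<pi> g v) = l v}"
    then have gGL: "g \<in> GL" by simp
    have "open ((\<lambda>h. matrix_inv g ** h) -` K)"
      by (intro open_vimage K continuous_on_matrix_mult continuous_intros)
    moreover have "g \<in> (\<lambda>h. matrix_inv g ** h) -` K" using K(3) gGL by (simp add: GL_left_inv)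
    moreover have "(\<lambda>h. matrix_inv g ** h) -` K \<subseteq> {g \<in> GL. \<forall>v. l (\<pi> g v) = l v}"
    proof
      fix h assume "h \<in> (\<lambda>h. matrix_inv g ** h) -` K"
      then have k: "matrix_inv g ** h \<in> K" by simp
      then have kGL: "matrix_inv g ** h \<in> GL" using KGL by blast
      have h: "h = g ** (matrix_inv g ** h)" using gGL by (simp add: matrix_mul_assoc GL_right_inv)
      have "l (\<pi> h v) = l v" for v
      proof -
        have "\<pi> h v = \<pi> g (\<pi> (matrix_inv g ** h) v)" by (subst h) (rule \<pi>_mult[OF gGL kGL])
        then show ?thesis using g inv[OF k] by simp
      qed
      moreover have "h \<in> GL" by (subst h) (rule GL_mult[OF gGL kGL])
      ultimately show "h \<in> {g \<in> GL. \<forall>v. l (\<pi> g v) = l v}" by simp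
    qed
    ultimately show "\<exists>T. open T \<and> g \<in> T \<and> T \<subseteq> {g \<in> GL. \<forall>v. l (\<pi> g v) = l v}" by blast
  qed
  moreover have "l v0 \<noteq> 0"
  proof -
    have "l v0 = (LINT k|\<nu>. indicator K k)"
      unfolding l_def
    proof (intro Bochner_Integration.integral_cong refl)
      fix k
      have "\<pi> (matrix_inv k) v0 = v0" if "k \<in> K" using Kinv[OF that] KS by (auto simp: S_def)
      then show "F v0 k = indicator K k" by (simp add: F_def L(2))
    qed
    also have "\<dots> = (LINT k|\<nu>. of_real (indicator K k))"
      by (intro Bochner_Integration.integral_cong refl) (simp add: indicator_def)
    also have "\<dots> = of_real (LINT k|\<nu>. indicator K k)"
      using compact_sets[OF K(1) KGL] compact_finite[OF K(1) KGL]
      by (intro integral_of_real integrable_real_indicator) auto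
    also have "(LINT k|\<nu>. indicator K k) = measure \<nu> K"
      using KGL by (simp add: space_\<mu> Int_absorb2)
    finally have "l v0 = of_real (measure \<nu> K)" .
    moreover have "emeasure \<nu> K > 0" using open_positive[OF K(2)] K(3) GL_1 KGL by (auto simp: Int_absorb2)
    then have "measure \<nu> K > 0"
      using compact_finite[OF K(1) KGL] by (simp add: measure_def enn2real_positive_iff)
    ultimately show ?thesis by simp
  qed
  ultimately show ?thesis
    using lin na unfolding contragredient_vectors_def by auto
qed

text \<open>
  For a continuous functional \<open>l\<close> with \<open>l v\<^sub>0 \<noteq> 0\<close> and \<open>c g = l (\<pi> g v\<^sub>0)\<close>, averaging against the weight
  \<open>b\<close> times the conjugate of \<open>c\<close> gives a functional with value \<open>\<integral> b \<bar>c\<bar>\<^sup>2 > 0\<close> at \<open>v\<^sub>0\<close>.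
\<close>

lemma contragredient_nonzero_arch:
  fixes b :: "'a^'n^'n \<Rightarrow> real"
  assumes arch: "archimedean TYPE('a)"
    and b: "(\<lambda>g. complex_of_real (b g)) \<in> Cc_smooth mat_scale GL" "\<And>g. b g \<ge> 0" "b (mat 1) > 0"
  shows "\<exists>l\<in>contragredient_vectors \<nu> sc T \<pi>. \<exists>v. l v \<noteq> 0"
proof -
  obtain v0 :: 'v where v0: "v0 \<noteq> 0" using nonzero_vector by blast
  have "frechet_space sc T" using in_Pi arch by (simp add: in_Pi_def casselman_wallach_def)
  then obtain p where "frechet sc T p" using frechetE[OF vector_space_axioms] by blast
  then obtain l where l: "Vector_Spaces.linear sc (*) l" "continuous_map T euclidean l" "l v0 \<noteq> 0"
    using frechet.continuous_functional_exists v0 by blast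
  interpret D: domain_of_smoothness "mat_scale :: 'a \<Rightarrow> 'a^'n^'n \<Rightarrow> 'a^'n^'n" by (rule matrix_domain)
  define c where "c g = l (\<pi> g v0)" for g
  have c: "smooth_on mat_scale GL c" unfolding c_def using l by (intro coefficient_smooth) auto
  define f where "f g = of_real (b g) * cnj (c g)" for g
  obtain C where C: "compact C" "C \<subseteq> GL" "\<And>g. g \<notin> C \<Longrightarrow> b g = 0" "smooth_on mat_scale GL (\<lambda>g. complex_of_real (b g))"
    using b(1) unfolding Cc_smooth_def by auto
  have "smooth_on mat_scale GL f" unfolding f_def by (intro D.smooth_mult D.smooth_cnj c C)
  then have f: "f \<in> Cc_smooth mat_scale GL"
    unfolding Cc_smooth_def using C by (auto simp: f_def)
  have bc: "continuous_on GL (\<lambda>g. b g * (cmod (c g))\<^sup>2)"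
  proof -
    have "continuous_on GL (\<lambda>g. Re (complex_of_real (b g)))"
      by (intro continuous_intros D.smooth_continuous C)
    then show ?thesis by (intro continuous_intros D.smooth_continuous c) simp
  qed
  have "integrable \<nu> (\<lambda>g. complex_of_real (b g * (cmod (c g))\<^sup>2))"
    by (rule integrable_compact_support[OF continuous_on_of_real[OF bc] C(1,2)]) (simp add: C(3))
  then have int: "integrable \<nu> (\<lambda>g. b g * (cmod (c g))\<^sup>2)" by (simp only: complex_of_real_integrable_eq)
  have "(LINT g|\<nu>. f g * l (\<pi> g v0)) = (LINT g|\<nu>. of_real (b g * (cmod (c g))\<^sup>2))"
    unfolding f_def c_def[symmetric] of_real_mult complex_norm_square by (simp add: mult_ac)
  also have "\<dots> = of_real (LINT g|\<nu>. b g * (cmod (c g))\<^sup>2)" using int by (rule integral_of_real)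
  finally have eq: "(LINT g|\<nu>. f g * l (\<pi> g v0)) = of_real (LINT g|\<nu>. b g * (cmod (c g))\<^sup>2)" .
  have "(LINT g|\<nu>. b g * (cmod (c g))\<^sup>2) > 0"
    by (rule integral_pos[OF bc int _ GL_1]) (use b l(3) in \<open>auto simp: c_def \<pi>_1\<close>)
  then have "(LINT g|\<nu>. f g * l (\<pi> g v0)) \<noteq> 0" unfolding eq by simp
  moreover have "(\<lambda>v. LINT g|\<nu>. f g * l (\<pi> g v)) \<in> contragredient_vectors \<nu> sc T \<pi>"
    unfolding contragredient_vectors_def using arch f l by auto
  ultimately show ?thesis by (intro bexI[of _ "\<lambda>v. LINT g|\<nu>. f g * l (\<pi> g v)"] exI[of _ v0])
qed

end


section \<open>The span of the fibre integrals\<close>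

lemma module_functions: "module (\<lambda>c (f :: 'x \<Rightarrow> complex) x. c * f x)"
  by unfold_locales (auto simp: fun_eq_iff algebra_simps)

lemma sum_functions: "(\<Sum>i\<in>I. F i) = (\<lambda>x. \<Sum>i\<in>I. F i x :: complex)"
  by (induct I rule: infinite_finite_induct) (auto simp: zero_fun_def plus_fun_def)

context domain_of_smoothness
begin

lemma Cc_smooth_subspace: "module.subspace (\<lambda>c (f :: 'x \<Rightarrow> complex) x. c * f x) (Cc_smooth s U)"
proof -
  interpret fm: module "\<lambda>c (f :: 'x \<Rightarrow> complex) x. c * f x" by (rule module_functions)
  show ?thesis
  proof (rule fm.subspaceI)
    show "0 \<in> Cc_smooth s U"
      unfolding Cc_smooth_def using smooth_const[of U 0] by (auto simp: zero_fun_def intro!: exI[of _ "{}"])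
    fix f g assume f: "f \<in> Cc_smooth s U"
    then obtain C where C: "smooth_on s U f" "compact C" "C \<subseteq> U" "\<And>x. x \<notin> C \<Longrightarrow> f x = 0"
      unfolding Cc_smooth_def by blast
    show "(\<lambda>x. c * f x) \<in> Cc_smooth s U" for c
      unfolding Cc_smooth_def using C smooth_mult[OF smooth_const C(1), of c] by auto
    assume "g \<in> Cc_smooth s U"
    then obtain C' where C': "smooth_on s U g" "compact C'" "C' \<subseteq> U" "\<And>x. x \<notin> C' \<Longrightarrow> g x = 0"
      unfolding Cc_smooth_def by blast
    have "f x + g x = 0" if "x \<notin> C \<union> C'" for x using that C(4) C'(4) by simp
    then show "f + g \<in> Cc_smooth s U"
      unfolding Cc_smooth_def plus_fun_def using C C' smooth_add[OF C(1) C'(1)]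
      by (intro CollectI conjI exI[of _ "C \<union> C'"]) auto
  qed
qed

lemma Cc_smooth_mult:
  assumes "f \<in> Cc_smooth s U" "smooth_on s U g"
  shows "(\<lambda>x. f x * g x) \<in> Cc_smooth s U"
proof -
  obtain C where C: "smooth_on s U f" "compact C" "C \<subseteq> U" "\<And>x. x \<notin> C \<Longrightarrow> f x = 0"
    using assms(1) unfolding Cc_smooth_def by blast
  show ?thesis
    unfolding Cc_smooth_def using C smooth_mult[OF C(1) assms(2)] by (intro CollectI conjI exI[of _ C]) auto
qed

end

text \<open>
  A nonzero smooth function of compact support on \<open>F\<^sup>\<times>\<close> yields bump functions on matrices: rescale
  it, and multiply copies of its squared modulus in the entries.
\<close>

lemma bump_function:
  fixes g0 :: "'a::local_field^'n^'n"
  assumes f: "f \<in> Cc_smooth (*) (UNIV - {0 :: 'a})" "f a \<noteq> 0" and g0: "g0 \<in> GL"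
  obtains b :: "'a^'n^'n \<Rightarrow> real" where
    "(\<lambda>g. complex_of_real (b g)) \<in> Cc_smooth mat_scale GL" "\<And>g. b g \<ge> 0" "b g0 > 0"
proof -
  interpret F: domain_of_smoothness "(*) :: 'a \<Rightarrow> 'a \<Rightarrow> 'a" by (rule field_domain)
  interpret M: domain_of_smoothness "mat_scale :: 'a \<Rightarrow> 'a^'n^'n \<Rightarrow> 'a^'n^'n" by (rule matrix_domain)
  have "open (UNIV - {0 :: 'a})" by (simp add: open_delete)
  then obtain K where K: "smooth_on (*) UNIV f" "compact K" "\<And>x. x \<notin> K \<Longrightarrow> f x = 0"
    using f(1) F.Cc_smooth_iff by blast
  obtain R where R: "\<And>x. x \<in> K \<Longrightarrow> absval x \<le> R"
    using compact_imp_bounded[OF K(2)] unfolding bounded_any_center[where a=0] by (auto simp: dist_absval)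
  obtain e where e: "e > 0" "ball g0 e \<subseteq> GL" using open_GL g0 open_contains_ball by blast
  let ?N = "real CARD('n) * real CARD('n)"
  obtain c :: 'a where "absval c > max 0 (?N * (R + absval a) / e)" using absval_unbounded by blast
  then have c: "absval c > 0" "?N * (R + absval a) / e < absval c" by auto
  then have c0: "c \<noteq> 0" by auto
  define A where "A i j g = a + c * (g $ i $ j - g0 $ i $ j)" for i j and g :: "'a^'n^'n"
  define b where "b g = (\<Prod>i\<in>UNIV. \<Prod>j\<in>UNIV. (cmod (f (A i j g)))\<^sup>2)" for g
  define r where "r = (R + absval a) / absval c"
  define B where "B i j = (\<lambda>y. a + c * (y - g0 $ i $ j)) -` K" for i j
  have B: "absval (y - g0 $ i $ j) \<le> r" if "y \<in> B i j" for y i j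
  proof -
    have "c * (y - g0 $ i $ j) = (a + c * (y - g0 $ i $ j)) - a" by simp
    then have "absval c * absval (y - g0 $ i $ j) \<le> R + absval a"
      using R[of "a + c * (y - g0 $ i $ j)"] that absval_triangle_diff[of "a + c * (y - g0 $ i $ j)" a]
      by (simp add: B_def absval_mult[symmetric])
    then show ?thesis using c by (simp add: r_def field_simps)
  qed
  let ?C = "{g :: 'a^'n^'n. \<forall>i j. g $ i $ j \<in> B i j}"
  have C: "compact ?C"
  proof (rule compact_matrix_box[OF _ B])
    show "closed (B i j)" for i j
      unfolding B_def by (intro closed_vimage compact_imp_closed K continuous_intros)
  qed
  have CGL: "?C \<subseteq> GL"
  proof
    fix g assume "g \<in> ?C"
    then have "dist g g0 \<le> ?N * r" using dist_matrix_le[of g g0 r] B by (simp add: mult.assoc)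
    also have "\<dots> < e" using c e(1) by (simp add: r_def field_simps)
    finally show "g \<in> GL" using e(2) by (auto simp: dist_commute)
  qed
  have b_0: "b g = 0" if g: "g \<notin> ?C" for g
  proof -
    obtain i j where "A i j g \<notin> K" using g by (auto simp: A_def B_def)
    then have "(\<Prod>j\<in>UNIV. (cmod (f (A i j g)))\<^sup>2) = 0" using K(3) by (intro prod_zero) auto
    then show ?thesis unfolding b_def by (intro prod_zero) auto
  qed
  have "smooth_on mat_scale UNIV (\<lambda>g. f (A i j g))" for i j
  proof (rule smooth_affine[OF F.domain_of_smoothness_axioms M.domain_of_smoothness_axioms _ _ K(1)])
    show "continuous_on UNIV (A i j)" unfolding A_def by (intro continuous_intros)
    show "A i j (y + mat_scale t v) = A i j y + t * (c * v $ i $ j)" for y t v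
      by (simp add: A_def mat_scale_def algebra_simps)
  qed
  then have "smooth_on mat_scale UNIV (\<lambda>g. \<Prod>i\<in>UNIV. \<Prod>j\<in>UNIV. f (A i j g) * cnj (f (A i j g)))"
    by (intro M.smooth_prod M.smooth_mult M.smooth_cnj finite)
  moreover have "(\<lambda>g. \<Prod>i\<in>UNIV. \<Prod>j\<in>UNIV. f (A i j g) * cnj (f (A i j g))) = (\<lambda>g. complex_of_real (b g))"
    unfolding b_def of_real_prod complex_norm_square ..
  ultimately have "smooth_on mat_scale UNIV (\<lambda>g. complex_of_real (b g))" by simp
  then have "(\<lambda>g. complex_of_real (b g)) \<in> Cc_smooth mat_scale GL"
    unfolding M.Cc_smooth_iff[OF open_GL] using C CGL b_0 by (intro conjI exI[of _ ?C]) auto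
  moreover have "b g \<ge> 0" for g unfolding b_def by (intro prod_nonneg) auto
  moreover have "b g0 > 0" unfolding b_def A_def using f(2) by (intro prod_pos) auto
  ultimately show thesis by (rule that)
qed

lemma (in haar_SL) phi_fun_eq_fibre_int:
  fixes \<xi> \<phi> :: "'a^'n^'n \<Rightarrow> complex"
  assumes \<xi>: "\<xi> \<in> Cc_smooth mat_scale GL" and \<phi>: "smooth_on mat_scale GL \<phi>"
  shows "phi_fun \<mu> \<xi> \<phi> = fibre_int i (\<lambda>g. \<xi> g * \<phi> g)"
proof
  fix x
  have F: "(\<lambda>g. \<xi> g * \<phi> g) \<in> Cc_smooth mat_scale GL"
    by (rule domain_of_smoothness.Cc_smooth_mult[OF matrix_domain \<xi> \<phi>])
  show "phi_fun \<mu> \<xi> \<phi> x = fibre_int i (\<lambda>g. \<xi> g * \<phi> g) x"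
  proof (cases "x = 0")
    case True
    have "fibre_int i (\<lambda>g. \<xi> g * \<phi> g) 0 = 0"
      using fibre_int_smooth[OF F, of i] unfolding Cc_smooth_def by blast
    then show ?thesis using True by (simp add: phi_fun_def)
  next
    case False
    have "smooth_on mat_scale UNIV (\<lambda>g. \<xi> g * \<phi> g)"
      using F domain_of_smoothness.Cc_smooth_iff[OF matrix_domain open_GL] by blast
    then have "continuous_on UNIV (\<lambda>g. \<xi> g * \<phi> g)"
      by (rule domain_of_smoothness.smooth_continuous[OF matrix_domain])
    from integral_fibre_measure[OF this False] show ?thesis using False by (simp add: phi_fun_def)
  qed
qed

text \<open>
  If \<open>\<phi>\<close> does not vanish at \<open>g0\<close>, integrating it against its conjugate times a bump function at \<open>g0\<close>
  gives a nonnegative function that is positive at \<open>det g0\<close>.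
\<close>

lemma (in haar_SL) positive_fibre_int:
  fixes \<phi> :: "'a^'n^'n \<Rightarrow> complex" and b :: "'a^'n^'n \<Rightarrow> real"
  assumes b: "(\<lambda>g. complex_of_real (b g)) \<in> Cc_smooth mat_scale GL" "\<And>g. b g \<ge> 0" "b g0 > 0"
    and g0: "g0 = row_scale i x (mat 1)" "x \<noteq> 0" and \<phi>: "smooth_on mat_scale GL \<phi>" "\<phi> g0 \<noteq> 0"
  obtains \<psi> d where "\<psi> \<in> Cc_smooth mat_scale GL" "\<And>y. d y \<ge> 0" "d x > 0"
    "\<And>y. y \<noteq> 0 \<Longrightarrow> fibre_int i (\<lambda>g. \<psi> g * \<phi> g) y = of_real (d y)"
proof -
  interpret M: domain_of_smoothness "mat_scale :: 'a \<Rightarrow> 'a^'n^'n \<Rightarrow> 'a^'n^'n" by (rule matrix_domain)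
  define \<psi> where "\<psi> g = of_real (b g) * cnj (\<phi> g)" for g
  define F where "F g = b g * (cmod (\<phi> g))\<^sup>2" for g
  have \<psi>\<phi>: "\<psi> g * \<phi> g = of_real (F g)" for g
    unfolding \<psi>_def F_def of_real_mult complex_norm_square by (simp add: mult_ac)
  have \<psi>: "\<psi> \<in> Cc_smooth mat_scale GL"
    unfolding \<psi>_def by (intro M.Cc_smooth_mult M.smooth_cnj b \<phi>)
  have "(\<lambda>g. complex_of_real (F g)) \<in> Cc_smooth mat_scale GL"
    unfolding \<psi>\<phi>[symmetric] by (intro M.Cc_smooth_mult \<psi> \<phi>)
  then obtain C where C: "compact C" "\<And>g. g \<notin> C \<Longrightarrow> complex_of_real (F g) = 0"
    and sm: "smooth_on mat_scale UNIV (\<lambda>g. complex_of_real (F g))"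
    unfolding M.Cc_smooth_iff[OF open_GL] by blast
  note c = M.smooth_continuous[OF sm]
  define d where "d y = (LINT h|\<mu>. F (row_scale i y h))" for y
  have int: "integrable \<mu> (\<lambda>h. F (row_scale i y h))" if "y \<noteq> 0" for y
    using fibre_integrable[OF c C that, of i] unfolding complex_of_real_integrable_eq .
  show thesis
  proof (rule that[of \<psi> d])
    show "fibre_int i (\<lambda>g. \<psi> g * \<phi> g) y = of_real (d y)" if "y \<noteq> 0" for y
      unfolding fibre_int_def \<psi>\<phi> d_def by (rule integral_of_real[OF int[OF that]])
    show "d y \<ge> 0" for y
      unfolding d_def F_def using b(2) by (intro Bochner_Integration.integral_nonneg) auto
    have "continuous_on SL (\<lambda>h. Re (complex_of_real (F (row_scale i x h))))"
      by (intro continuous_intros continuous_on_fibre_integrand[OF c])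
    then have "continuous_on SL (\<lambda>h. F (row_scale i x h))" unfolding Re_complex_of_real .
    then show "d x > 0"
      unfolding d_def
    proof (rule integral_pos[OF _ int[OF g0(2)], of "mat 1"])
      show "mat 1 \<in> SL" by (simp add: SL_def det_I)
      show "F (row_scale i x (mat 1)) > 0" using b(3) \<phi>(2) by (simp add: F_def g0(1))
    qed (use b(2) in \<open>auto simp: F_def\<close>)
  qed (rule \<psi>)
qed

text \<open>
  Finitely many of the sets where some \<open>D x\<close> is positive cover the support of \<open>f\<close>.  There the sum of
  the corresponding \<open>D x\<close> is positive, and \<open>p\<close> is the quotient of \<open>f\<close> by that sum.
\<close>

lemma smooth_combination:
  fixes f :: "'a::local_field \<Rightarrow> complex"
  assumes f: "f \<in> Cc_smooth (*) (UNIV - {0})"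
    and smooth: "\<And>x. x \<noteq> 0 \<Longrightarrow> smooth_on (*) (UNIV - {0}) (D x)"
    and D: "\<And>x y. x \<noteq> 0 \<Longrightarrow> y \<noteq> 0 \<Longrightarrow> D x y = of_real (d x y)"
    and d: "\<And>x y. x \<noteq> 0 \<Longrightarrow> d x y \<ge> 0" "\<And>x. x \<noteq> 0 \<Longrightarrow> d x x > 0"
  obtains I p where "finite I" "0 \<notin> I" "smooth_on (*) UNIV p" "\<And>y. f y = (\<Sum>x\<in>I. p y * D x y)"
proof -
  interpret F: domain_of_smoothness "(*) :: 'a \<Rightarrow> 'a \<Rightarrow> 'a" by (rule field_domain)
  have F0: "open (UNIV - {0 :: 'a})" by (simp add: open_delete)
  obtain K where K: "smooth_on (*) UNIV f" "compact K" "K \<subseteq> UNIV - {0}" "\<And>x. x \<notin> K \<Longrightarrow> f x = 0"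
    using f F.Cc_smooth_iff[OF F0] by blast
  have open_nonzero: "open {y \<in> UNIV - {0}. G y \<noteq> 0}" if "smooth_on (*) (UNIV - {0}) G" for G :: "'a \<Rightarrow> complex"
  proof -
    have "open ((UNIV - {0}) \<inter> G -` (- {0}))"
      using F.smooth_continuous[OF that] F0 by (intro continuous_open_preimage) auto
    moreover have "(UNIV - {0}) \<inter> G -` (- {0}) = {y \<in> UNIV - {0}. G y \<noteq> 0}" by auto
    ultimately show ?thesis by simp
  qed
  define U where "U x = {y \<in> UNIV - {0}. D x y \<noteq> 0}" for x
  have cover: "K \<subseteq> (\<Union>x\<in>K. U x)"
  proof
    fix y assume y: "y \<in> K"
    then have y0: "y \<noteq> 0" using K(3) by auto
    then have "y \<in> U y" using D[OF y0 y0] d(2)[OF y0] by (simp add: U_def)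
    then show "y \<in> (\<Union>x\<in>K. U x)" using y by blast
  qed
  have "open (U x)" if "x \<in> K" for x
    unfolding U_def using that K(3) by (intro open_nonzero smooth) auto
  from compactE_image[OF K(2) this cover]
  obtain I where I: "I \<subseteq> K" "finite I" "K \<subseteq> (\<Union>x\<in>I. U x)" by blast
  have I0: "x \<noteq> 0" if "x \<in> I" for x using that I(1) K(3) by auto
  define E where "E y = (\<Sum>x\<in>I. D x y)" for y
  have E_smooth: "smooth_on (*) (UNIV - {0}) E"
    unfolding E_def by (intro F.smooth_sum I smooth I0)
  have E_nz: "E y \<noteq> 0" if y: "y \<in> K" for y
  proof -
    have y0: "y \<noteq> 0" using y K(3) by auto
    obtain x where x: "x \<in> I" "D x y \<noteq> 0" using I(3) y by (auto simp: U_def)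
    have "E y = of_real (\<Sum>x\<in>I. d x y)"
      unfolding E_def of_real_sum by (intro sum.cong refl D I0 y0)
    moreover have "(\<Sum>x\<in>I. d x y) > 0"
      using x D[OF I0[OF x(1)] y0] d(1)[OF I0, of _ y] I(2)
      by (intro sum_pos2[of I x]) (auto simp: less_le)
    ultimately show ?thesis by (simp del: of_real_sum)
  qed
  define V where "V = {y \<in> UNIV - {0}. E y \<noteq> 0}"
  have V: "open V" "K \<subseteq> V"
    unfolding V_def using open_nonzero[OF E_smooth] K(3) E_nz by auto
  define p where "p y = f y * inverse (E y)" for y
  have "smooth_on (*) V p"
    unfolding p_def
    by (intro F.smooth_mult F.smooth_inverse F.smooth_subset[OF K(1)] F.smooth_subset[OF E_smooth])
       (auto simp: V_def)
  then have "smooth_on (*) UNIV p"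
    by (rule F.smooth_extend_0[OF V(1) _ K(2) V(2)]) (simp add: p_def K(4))
  moreover have "f y = (\<Sum>x\<in>I. p y * D x y)" for y
    unfolding sum_distrib_left[symmetric] E_def[symmetric]
    using E_nz[of y] K(4)[of y] by (cases "y \<in> K") (auto simp: p_def)
  ultimately show thesis using I(2) I0 by (intro that[of I p]) auto
qed

theorem theorem7p1:
  fixes \<mu> \<nu> :: "('a::local_field ^'n^'n) measure"
    and sc :: "complex \<Rightarrow> 'v::ab_group_add \<Rightarrow> 'v"
    and T :: "'v topology"
    and \<pi> :: "'a ^'n^'n \<Rightarrow> 'v \<Rightarrow> 'v"
  assumes "haar_measure_on SL \<mu>"
    and "haar_measure_on GL \<nu>"
    and "in_Pi sc T \<pi>"
  shows "S_pi_circ \<mu> \<nu> sc T \<pi> = Cc_smooth (*) (UNIV - {0})"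
proof -
  interpret S: haar_SL \<mu>
    using assms(1) by (intro haar_SL.intro haar_measure.intro borel_closed closed_SL)
  interpret R: irreducible_rep_of_GL \<nu> sc T \<pi>
    using assms(2,3)
    by (intro irreducible_rep_of_GL.intro haar_measure.intro irreducible_rep_of_GL_axioms.intro borel_open open_GL)
  interpret F: domain_of_smoothness "(*) :: 'a \<Rightarrow> 'a \<Rightarrow> 'a" by (rule field_domain)
  interpret M: domain_of_smoothness "mat_scale :: 'a \<Rightarrow> 'a^'n^'n \<Rightarrow> 'a^'n^'n" by (rule matrix_domain)
  interpret ff: module "\<lambda>c (f :: 'a \<Rightarrow> complex) x. c * f x" by (rule module_functions)
  interpret fm: module "\<lambda>c (f :: 'a^'n^'n \<Rightarrow> complex) x. c * f x" by (rule module_functions)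
  \<comment> \<open>Any row can carry the entry \<open>x\<close> of the diagonal section of the determinant.\<close>
  fix i :: 'n
  note phi = S.phi_fun_eq_fibre_int[OF _ R.matrix_coefficient_smooth, where i=i]
  show ?thesis
  proof (rule subset_antisym)
    have "phi_fun \<mu> \<xi> \<phi> \<in> Cc_smooth (*) (UNIV - {0})"
      if "\<xi> \<in> Cc_smooth mat_scale GL" "\<phi> \<in> matrix_coefficients \<nu> sc T \<pi>" for \<xi> \<phi>
      unfolding phi[OF that]
      by (intro S.fibre_int_smooth M.Cc_smooth_mult R.matrix_coefficient_smooth that)
    then show "S_pi_circ \<mu> \<nu> sc T \<pi> \<subseteq> Cc_smooth (*) (UNIV - {0})"
      unfolding S_pi_circ_def cspan_def by (intro ff.span_minimal F.Cc_smooth_subspace) blast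
  next
    show "Cc_smooth (*) (UNIV - {0}) \<subseteq> S_pi_circ \<mu> \<nu> sc T \<pi>"
    proof
      fix f :: "'a \<Rightarrow> complex" assume f: "f \<in> Cc_smooth (*) (UNIV - {0})"
      show "f \<in> S_pi_circ \<mu> \<nu> sc T \<pi>"
      proof (cases "f = 0")
        case True
        then show ?thesis unfolding S_pi_circ_def cspan_def using ff.span_zero by simp
      next
        case False
        then obtain a where a: "f a \<noteq> 0" by (auto simp: fun_eq_iff zero_fun_def)
        obtain b1 :: "'a^'n^'n \<Rightarrow> real" where b1: "(\<lambda>g. complex_of_real (b1 g)) \<in> Cc_smooth mat_scale GL"
          "\<And>g. b1 g \<ge> 0" "b1 (mat 1) > 0"
          by (rule bump_function[OF f a GL_1]) blast
        obtain l w where l: "l \<in> contragredient_vectors \<nu> sc T \<pi>" and lw: "l w \<noteq> 0"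
          using R.contragredient_nonzero_nonarch R.contragredient_nonzero_arch[OF _ b1] by blast
        define g0 where "g0 x = row_scale i x (mat 1 :: 'a^'n^'n)" for x
        have g0: "g0 x \<in> GL" if "x \<noteq> 0" for x using that by (simp add: g0_def GL_det det_I)
        \<comment> \<open>A matrix coefficient with the nonzero value \<open>l w\<close> at \<open>g0 x\<close>.\<close>
        define \<phi> where "\<phi> x = (\<lambda>g. if g \<in> GL then l (\<pi> g (\<pi> (matrix_inv (g0 x)) w)) else 0)" for x
        have \<phi>: "\<phi> x \<in> matrix_coefficients \<nu> sc T \<pi>" for x
          unfolding matrix_coefficients_def cspan_def \<phi>_def using l by (intro fm.span_base) blast
        define Q where "Q x \<psi> d \<longleftrightarrow> \<psi> \<in> Cc_smooth mat_scale GL \<and> (\<forall>y. d y \<ge> 0) \<and> d x > 0 \<and>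
            (\<forall>y. y \<noteq> 0 \<longrightarrow> S.fibre_int i (\<lambda>g. \<psi> g * \<phi> x g) y = complex_of_real (d y))" for x \<psi> d
        have "\<exists>\<psi> d. Q x \<psi> d" if x: "x \<noteq> 0" for x
        proof -
          obtain b :: "'a^'n^'n \<Rightarrow> real" where b: "(\<lambda>g. complex_of_real (b g)) \<in> Cc_smooth mat_scale GL"
            "\<And>g. b g \<ge> 0" "b (g0 x) > 0"
            by (rule bump_function[OF f a g0[OF x]]) blast
          have "\<phi> x (g0 x) \<noteq> 0" using lw g0[OF x] by (simp add: \<phi>_def R.\<pi>_inv)
          from S.positive_fibre_int[OF b g0_def x R.matrix_coefficient_smooth[OF \<phi>] this]
          show ?thesis unfolding Q_def by metis
        qed
        then obtain \<psi> d where "\<And>x. x \<noteq> 0 \<Longrightarrow> Q x (\<psi> x) (d x)" by metis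
        then have \<psi>: "\<And>x. x \<noteq> 0 \<Longrightarrow> \<psi> x \<in> Cc_smooth mat_scale GL"
          and d: "\<And>x y. x \<noteq> 0 \<Longrightarrow> d x y \<ge> 0" "\<And>x. x \<noteq> 0 \<Longrightarrow> d x x > 0"
            "\<And>x y. x \<noteq> 0 \<Longrightarrow> y \<noteq> 0 \<Longrightarrow> S.fibre_int i (\<lambda>g. \<psi> x g * \<phi> x g) y = of_real (d x y)"
          unfolding Q_def by blast+
        define D where "D x = S.fibre_int i (\<lambda>g. \<psi> x g * \<phi> x g)" for x
        have "smooth_on (*) (UNIV - {0}) (D x)" if "x \<noteq> 0" for x
          using S.fibre_int_smooth[OF M.Cc_smooth_mult[OF \<psi>[OF that] R.matrix_coefficient_smooth[OF \<phi>]], of i]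
          unfolding D_def Cc_smooth_def by blast
        then obtain I p where I: "finite I" "0 \<notin> I" and p: "smooth_on (*) UNIV p"
          and f_eq: "\<And>y. f y = (\<Sum>x\<in>I. p y * D x y)"
          by (rule smooth_combination[OF f, of D d]) (use d in \<open>auto simp: D_def\<close>)
        \<comment> \<open>A function of the determinant is constant on the fibres, so it can be pulled out of the integral.\<close>
        define \<xi> where "\<xi> x g = \<psi> x g * p (det g)" for x g
        have \<xi>: "\<xi> x \<in> Cc_smooth mat_scale GL" if "x \<in> I" for x
          unfolding \<xi>_def using that I(2)
          by (intro M.Cc_smooth_mult \<psi> M.smooth_subset[OF smooth_det[OF p]]) auto
        have "phi_fun \<mu> (\<xi> x) (\<phi> x) y = p y * D x y" if x: "x \<in> I" for x y
        proof -
          have "phi_fun \<mu> (\<xi> x) (\<phi> x) y = (LINT h|\<mu>. p y * (\<psi> x (row_scale i y h) * \<phi> x (row_scale i y h)))"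
            unfolding phi[OF \<xi>[OF x] \<phi>] S.fibre_int_def
            by (intro Bochner_Integration.integral_cong refl) (simp add: \<xi>_def S.space_\<mu> SL_def)
          also have "\<dots> = p y * D x y" by (simp add: D_def S.fibre_int_def)
          finally show ?thesis .
        qed
        then have "f = (\<Sum>x\<in>I. phi_fun \<mu> (\<xi> x) (\<phi> x))"
          unfolding sum_functions by (intro ext) (simp add: f_eq)
        also have "\<dots> \<in> S_pi_circ \<mu> \<nu> sc T \<pi>"
          unfolding S_pi_circ_def cspan_def
          by (intro ff.span_sum ff.span_base) (use \<xi> \<phi> in blast)
        finally show ?thesis .
      qed
    qed
  qed
qed

end
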